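(* Consider the linear state-space model $$X_{k+1}=A(\theta)X_k+W_k,\quad W_k\overset{\mathrm{i.i.d.}}{\sim}\mathcal N(0,\Sigma(\theta)),\qquad Y_k=H(\theta)X_k+V_k,\quad V_k\overset{\mathrm{i.i.d.}}{\sim}\mathcal N(0,\Gamma(\theta)),$$ with $X_k\in\mathbb R^n$, $Y_k\in\mathbb R^r$, $A(\theta)\in\mathbb R^{n\times n}$, $H(\theta)\in\mathbb R^{r\times n}$, random unknown parameter vector $\theta$ with prior density $\nu_0(\theta)$, and Gaussian conditional prior $p(X_0\mid\theta)=p_{\mathcal N}(X_0;m_0(\theta),C_0(\theta))$. Let $y_1,y_2,\dots$ be the observed data and $\mathcal Y_k=(y_1,\dots,y_k)$. For $i\ge1$ let $q_i(X_i,\theta)=\rho_i(X_i\mid\theta)\,\nu_i(\theta)$, where $\nu_i$ is a probability density in $\theta$ and $\rho_i(X_i\mid\theta)=p_{\mathcal N}(X_i;m_i(\theta),C_i(\theta))$ for given functions $m_i(\theta)\in\mathbb R^n$ and $C_i(\theta)\in\mathbb R^{n\times n}$ (positive definite). For $i\ge 1$ put $$m_i^{*-}(\theta)=A(\theta)m_{i-1}(\theta),\qquad C_i^{*-}(\theta)=A(\theta)C_{i-1}(\theta)A(\theta)^T+\Sigma(\theta).$$ Let $k\ge1$. Assume $\inf_\theta|\Gamma(\theta)|=\tilde C>0$ (with $|\cdot|$ the determinant), and suppose that the evidence lower bounds $\mathcal L_i(\nu_i)$ (defined in the context) satisfy $\mathcal L_i(\nu_i)\ge\epsilon_i$ for all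 integers $i\in[1,k]$. Then, both for $d$ the total variation distance and for $d$ the Hellinger distance, $$d\big(p(X_k,\theta\mid\mathcal Y_k),q_k(X_k,\theta)\big)\le\sum_{j=1}^{k-1}C'_{j,k}\sqrt{\mathbb E_{\theta\sim\nu_j}\big[\Psi_j(C_j(\theta),m_j(\theta),C_{j-1}(\theta),m_{j-1}(\theta),\theta)\big]-\tfrac r2\log(2\pi)-\tfrac12\log\tilde C-\epsilon_j}$$ $$\qquad+\frac1{\sqrt2}\sqrt{\mathbb E_{\theta\sim\nu_k}\big[\Psi_k(C_k(\theta),m_k(\theta),C_{k-1}(\theta),m_{k-1}(\theta),\theta)\big]-\tfrac r2\log(2\pi)-\tfrac12\log\tilde C-\epsilon_k}.$$ Here, for each integer $j\in[1,k]$, writing $F_m=F_m(m_{j-1}(\theta),C_{j-1}(\theta),\theta)$ and $F_c=F_c(m_{j-1}(\theta),C_{j-1}(\theta),\theta)$, $$\Psi_j(C_j(\theta),m_j(\theta),C_{j-1}(\theta),m_{j-1}(\theta),\theta)=\tfrac12\log|F_c|-\tfrac12\log|C_j(\theta)|-\tfrac n2+\tfrac12\mathrm{Tr}\big(F_c^{-1}C_j(\theta)\big)+\tfrac12\big(m_j(\theta)-F_m\big)^TF_c^{-1}\big(m_j(\theta)-F_m\big),$$ with $$F_m=m_j^{*-}(\theta)+C_j^{*-}(\theta)H(\theta)^T\big(H(\theta)C_j^{*-}(\theta)H(\theta)^T+\Gamma(\theta)\big)^{-1}\big(y_j-H(\theta)m_j^{*-}(\theta)\big),$$ $$F_c=C_j^{*-}(\theta)-C_j^{*-}(\theta)H(\theta)^T\big(H(\theta)C_j^{*-}(\theta)H(\theta)^T+\Gamma(\theta)\big)^{-1}H(\theta)C_j^{*-}(\theta).$$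 The coefficient $C'_{j,k}=C'(\mathcal Y_k,\tilde C,j,k,m_{j:k-1},C_{j:k-1},\nu_{j:k-1})$ is $$C'_{j,k}=\frac{(2\pi)^{-\frac{r(k-j)}2}\,\tilde C^{-\frac{k-j}2}}{\sqrt2\,\prod_{i=j+1}^kZ_i(m_{i-1},C_{i-1},\nu_{i-1})}$$ when $d$ is the total variation distance, and $$C'_{j,k}=\frac{2^{(k-j)}(2\pi)^{-\frac{r(k-j)}4}\,\tilde C^{-\frac{k-j}4}}{\sqrt{2\prod_{i=j+1}^kZ_i(m_{i-1},C_{i-1},\nu_{i-1})}}$$ when $d$ is the Hellinger distance, where $$Z_i(m_{i-1},C_{i-1},\nu_{i-1})=\mathbb E_{\theta\sim\nu_{i-1}}\big[p_{\mathcal N}\big(y_i;H(\theta)m_i^{*-}(\theta),\,H(\theta)C_i^{*-}(\theta)H(\theta)^T+\Gamma(\theta)\big)\big].$$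
   Context: Notation. $p$ denotes the probability density of the indicated random variables under the model; $p(X_k,\theta\mid\mathcal Y_k)$ is the joint posterior density of $(X_k,\theta)$ given $Y_1=y_1,\dots,Y_k=y_k$. $p_{\mathcal N}(x;\mu,R)$ is the density at $x$ of the Gaussian distribution with mean $\mu$ and covariance $R$. The covariances $\Sigma(\theta)\in\mathbb R^{n\times n}$, $\Gamma(\theta)\in\mathbb R^{r\times r}$ are positive definite. Conditionally on $\theta$, the noises $(W_k)$ and $(V_k)$ are mutually independent and independent of $X_0$. Data are received from time $1$ on. The sequence of approximations is initialized at the prior: $q_0(X_0,\theta)=p_{\mathcal N}(X_0;m_0(\theta),C_0(\theta))\,\nu_0(\theta)$, the joint prior of $(X_0,\theta)$. The notations $m_{j:k-1}$, $C_{j:k-1}$, $\nu_{j:k-1}$ stand for the sequences $\{m_i\}_{i=j}^{k-1}$, $\{C_i\}_{i=j}^{k-1}$, $\{\nu_i\}_{i=j}^{k-1}$. Evidence lower bound (ELBO). For $i\ge1$, let $$\rho_i^{*-}(X_i\mid\theta)=\int p_{\mathcal N}(X_i;A(\theta)X_{i-1},\Sigma(\theta))\,\rho_{i-1}(X_{i-1}\mid\theta)\,dX_{i-1}=p_{\mathcal N}(X_i;m_i^{*-}(\theta),C_i^{*-}(\theta)),$$ where $\rho_0(X_0\mid\theta)=p(X_0\mid\theta)$, and $$I_i(\theta)=\int p_{\mathcal N}(y_i;H(\theta)X_i,\Gamma(\theta))\,\rho_i^{*-}(X_i\mid\theta)\,dX_i=p_{\mathcal N}\big(y_i;H(\theta)m_i^{*-}(\theta),H(\theta)C_i^{*-}(\theta)H(\theta)^T+\Gamma(\theta)\big).$$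 Then $$\mathcal L_i(\nu_i)=\mathbb E_{\theta\sim\nu_i}[\log I_i(\theta)]-\mathrm{KL}(\nu_i\,\|\,\nu_{i-1}).$$ Divergences, for probability measures $\mu_1,\mu_2$ with densities $f_1,f_2$: $\mathrm{KL}(\mu_1\|\mu_2)=\int f_1\log\frac{f_1}{f_2}\,dx$; total variation distance $d_{TV}(\mu_1,\mu_2)=\frac12\int|f_1-f_2|\,dx$; Hellinger distance $d_H(\mu_1,\mu_2)=\sqrt{\frac12\int(\sqrt{f_1}-\sqrt{f_2})^2\,dx}$. *)

theory Defs
  imports "HOL-Probability.Probability"
begin

section \<open>Gaussian densities\<close>

definition pos_def :: "real^'n^'n \<Rightarrow> bool" where
  "pos_def R \<longleftrightarrow> transpose R = R \<and> (\<forall>x. x \<noteq> 0 \<longrightarrow> 0 < x \<bullet> (R *v x))"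

definition gauss_density :: "real^'n \<Rightarrow> real^'n^'n \<Rightarrow> real^'n \<Rightarrow> real" where
  "gauss_density \<mu> R x =
     (2 * pi) powr (- real CARD('n) / 2) * det R powr (- 1 / 2)
       * exp (- ((x - \<mu>) \<bullet> (matrix_inv R *v (x - \<mu>))) / 2)"

definition gauss_measure :: "real^'n \<Rightarrow> real^'n^'n \<Rightarrow> (real^'n) measure" where
  "gauss_measure \<mu> R = density lborel (\<lambda>x. ennreal (gauss_density \<mu> R x))"

definition prob_density :: "('a::euclidean_space \<Rightarrow> real) \<Rightarrow> bool" where
  "prob_density f \<longleftrightarrow>
     f \<in> borel_measurable borel \<and> (\<forall>x. 0 \<le> f x) \<and> (\<integral>\<^sup>+ x. ennreal (f x) \<partial>lborel) = 1"

definition law :: "('a::euclidean_space \<Rightarrow> real) \<Rightarrow> 'a measure" where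
  "law f = density lborel (\<lambda>x. ennreal (f x))"


section \<open>Extended-valued expectations and divergences\<close>

text \<open>
  The Bochner integral returns \<open>0\<close> for non-integrable functions. Expectations of logarithms and
  Kullback-Leibler divergences can be infinite, so they are defined here as the integral of the
  positive part minus the integral of the negative part, in \<open>ereal\<close>. In all uses below at most
  one of the two parts is infinite.
\<close>

definition eintegral :: "'a measure \<Rightarrow> ('a \<Rightarrow> ereal) \<Rightarrow> ereal" where
  "eintegral M f =
     enn2ereal (\<integral>\<^sup>+ x. e2ennreal (f x) \<partial>M) - enn2ereal (\<integral>\<^sup>+ x. e2ennreal (- f x) \<partial>M)"

definition KL_div :: "('a::euclidean_space \<Rightarrow> real) \<Rightarrow> ('a \<Rightarrow> real) \<Rightarrow> ereal" where
  "KL_div f g = eintegral lborel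
     (\<lambda>x. if f x = 0 then 0 else if g x = 0 then \<infinity> else ereal (f x * ln (f x / g x)))"

definition tv_dist :: "('a::euclidean_space \<Rightarrow> real) \<Rightarrow> ('a \<Rightarrow> real) \<Rightarrow> real" where
  "tv_dist f g = 1 / 2 * (\<integral>x. \<bar>f x - g x\<bar> \<partial>lborel)"

definition hellinger_dist :: "('a::euclidean_space \<Rightarrow> real) \<Rightarrow> ('a \<Rightarrow> real) \<Rightarrow> real" where
  "hellinger_dist f g = sqrt (1 / 2 * (\<integral>x. (sqrt (f x) - sqrt (g x))\<^sup>2 \<partial>lborel))"

text \<open>The value at \<open>-\<infinity>\<close> is a dummy.\<close>

fun esqrt :: "ereal \<Rightarrow> ereal" where
  "esqrt (ereal x) = ereal (sqrt x)"
| "esqrt PInfty = \<infinity>"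
| "esqrt MInfty = 0"


section \<open>The linear Gaussian state-space model with unknown parameter\<close>

text \<open>
  The last assumption states that, conditionally on the parameter \<open>\<Theta>\<close>, the initial state and
  all noises are independent with the indicated Gaussian laws: the conditional probability of every
  measurable rectangle given the \<open>\<sigma>\<close>-algebra generated by \<open>\<Theta>\<close> is the product of the Gaussian
  probabilities. Observations, and hence the observation noises, start at time 1.
\<close>

locale linear_gaussian_ssm = prob_space M
  for M :: "'w measure" +
  fixes A :: "real^'p \<Rightarrow> real^'n^'n"
    and H :: "real^'p \<Rightarrow> real^'n^'r"
    and S :: "real^'p \<Rightarrow> real^'n^'n"
    and G :: "real^'p \<Rightarrow> real^'r^'r"
    and m0 :: "real^'p \<Rightarrow> real^'n"
    and C0 :: "real^'p \<Rightarrow> real^'n^'n"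
    and \<nu>0 :: "real^'p \<Rightarrow> real"
    and \<Theta> :: "'w \<Rightarrow> real^'p"
    and X :: "nat \<Rightarrow> 'w \<Rightarrow> real^'n"
    and Y :: "nat \<Rightarrow> 'w \<Rightarrow> real^'r"
    and W :: "nat \<Rightarrow> 'w \<Rightarrow> real^'n"
    and V :: "nat \<Rightarrow> 'w \<Rightarrow> real^'r"
  assumes A_measurable: "A \<in> borel_measurable borel"
    and H_measurable: "H \<in> borel_measurable borel"
    and S_measurable: "S \<in> borel_measurable borel"
    and G_measurable: "G \<in> borel_measurable borel"
    and m0_measurable: "m0 \<in> borel_measurable borel"
    and C0_measurable: "C0 \<in> borel_measurable borel"
    and S_pos_def: "\<And>\<theta>. pos_def (S \<theta>)"
    and G_pos_def: "\<And>\<theta>. pos_def (G \<theta>)"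
    and C0_pos_def: "\<And>\<theta>. pos_def (C0 \<theta>)"
    and prior_density: "prob_density \<nu>0"
    and X0_measurable: "X 0 \<in> borel_measurable M"
    and W_measurable: "\<And>i. W i \<in> borel_measurable M"
    and V_measurable: "\<And>i. 1 \<le> i \<Longrightarrow> V i \<in> borel_measurable M"
    and state_eq: "\<And>i \<omega>. \<omega> \<in> space M \<Longrightarrow> X (Suc i) \<omega> = A (\<Theta> \<omega>) *v X i \<omega> + W i \<omega>"
    and obs_eq: "\<And>i \<omega>. \<lbrakk>\<omega> \<in> space M; 1 \<le> i\<rbrakk> \<Longrightarrow> Y i \<omega> = H (\<Theta> \<omega>) *v X i \<omega> + V i \<omega>"
    and parameter_prior: "distributed M lborel \<Theta> (\<lambda>\<theta>. ennreal (\<nu>0 \<theta>))"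
    and cond_law: "\<And>K B0 B D. \<lbrakk>B0 \<in> sets borel; \<And>i. B i \<in> sets borel; \<And>i. D i \<in> sets borel\<rbrakk> \<Longrightarrow>
      AE \<omega> in M.
        real_cond_exp M (vimage_algebra (space M) \<Theta> borel)
          (indicator {\<omega>' \<in> space M. X 0 \<omega>' \<in> B0 \<and> (\<forall>i\<in>{..<K}. W i \<omega>' \<in> B i)
             \<and> (\<forall>i\<in>{1..K}. V i \<omega>' \<in> D i)}) \<omega>
        = measure (gauss_measure (m0 (\<Theta> \<omega>)) (C0 (\<Theta> \<omega>))) B0
          * (\<Prod>i\<in>{..<K}. measure (gauss_measure 0 (S (\<Theta> \<omega>))) (B i))
          * (\<Prod>i\<in>{1..K}. measure (gauss_measure 0 (G (\<Theta> \<omega>))) (D i))"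

text \<open>
  A joint density is only determined up to null sets, whereas the posterior is evaluated at one
  fixed data record. The version is therefore required to be continuous in the observations
  (with the product topology on \<open>(\<real>\<^sup>r)\<^sup>k\<close>); for almost every \<open>(x, \<theta>)\<close> it is then unique.
\<close>

definition joint_density ::
  "'w measure \<Rightarrow> ('w \<Rightarrow> real^'p) \<Rightarrow> (nat \<Rightarrow> 'w \<Rightarrow> real^'n) \<Rightarrow> (nat \<Rightarrow> 'w \<Rightarrow> real^'r) \<Rightarrow> nat
    \<Rightarrow> ((real^'n) \<times> (real^'p) \<Rightarrow> (nat \<Rightarrow> real^'r) \<Rightarrow> real) \<Rightarrow> bool" where
  "joint_density M \<Theta> X Y k f \<longleftrightarrow>
     (\<forall>z y. 0 \<le> f z y) \<and>
     (\<forall>z. continuous_on (PiE {1..k} (\<lambda>_. UNIV)) (f z)) \<and>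
     distributed M (lborel \<Otimes>\<^sub>M (\<Pi>\<^sub>M i\<in>{1..k}. lborel))
       (\<lambda>\<omega>. ((X k \<omega>, \<Theta> \<omega>), \<lambda>i\<in>{1..k}. Y i \<omega>)) (\<lambda>(z, y). ennreal (f z y))"

definition posterior ::
  "((real^'n) \<times> (real^'p) \<Rightarrow> (nat \<Rightarrow> real^'r) \<Rightarrow> real) \<Rightarrow> nat \<Rightarrow> (nat \<Rightarrow> real^'r)
    \<Rightarrow> (real^'n) \<times> (real^'p) \<Rightarrow> real" where
  "posterior f k y z = f z (restrict y {1..k}) / (\<integral>z'. f z' (restrict y {1..k}) \<partial>lborel)"


section \<open>Approximations, one-step updates and error terms\<close>

definition approx ::
  "(real^'p \<Rightarrow> real^'n) \<Rightarrow> (real^'p \<Rightarrow> real^'n^'n) \<Rightarrow> (real^'p \<Rightarrow> real)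
    \<Rightarrow> (real^'n) \<times> (real^'p) \<Rightarrow> real" where
  "approx m C \<nu> = (\<lambda>(x, \<theta>). gauss_density (m \<theta>) (C \<theta>) x * \<nu> \<theta>)"

text \<open>
  In the rest of this section \<open>A\<close>, \<open>H\<close>, \<open>S\<close>, \<open>G\<close> and \<open>m\<close>, \<open>C\<close> (previous mean and covariance) are
  the values of the corresponding functions at one parameter, and \<open>y\<close> is the current observation.
\<close>

definition pred_mean :: "real^'n^'n \<Rightarrow> real^'n \<Rightarrow> real^'n" where
  "pred_mean A m = A *v m"

definition pred_cov :: "real^'n^'n \<Rightarrow> real^'n^'n \<Rightarrow> real^'n^'n \<Rightarrow> real^'n^'n" where
  "pred_cov A S C = A ** C ** transpose A + S"

definition obs_cov ::
  "real^'n^'n \<Rightarrow> real^'n^'r \<Rightarrow> real^'n^'n \<Rightarrow> real^'r^'r \<Rightarrow> real^'n^'n \<Rightarrow> real^'r^'r" where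
  "obs_cov A H S G C = H ** pred_cov A S C ** transpose H + G"

definition F_m ::
  "real^'n^'n \<Rightarrow> real^'n^'r \<Rightarrow> real^'n^'n \<Rightarrow> real^'r^'r \<Rightarrow> real^'r
    \<Rightarrow> real^'n \<Rightarrow> real^'n^'n \<Rightarrow> real^'n" where
  "F_m A H S G y m C = pred_mean A m +
     (pred_cov A S C ** transpose H ** matrix_inv (obs_cov A H S G C)) *v (y - H *v pred_mean A m)"

definition F_c ::
  "real^'n^'n \<Rightarrow> real^'n^'r \<Rightarrow> real^'n^'n \<Rightarrow> real^'r^'r \<Rightarrow> real^'n^'n \<Rightarrow> real^'n^'n" where
  "F_c A H S G C = pred_cov A S C -
     pred_cov A S C ** transpose H ** matrix_inv (obs_cov A H S G C) ** H ** pred_cov A S C"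

definition \<Psi> ::
  "real^'n^'n \<Rightarrow> real^'n^'r \<Rightarrow> real^'n^'n \<Rightarrow> real^'r^'r \<Rightarrow> real^'r
    \<Rightarrow> real^'n^'n \<Rightarrow> real^'n \<Rightarrow> real^'n^'n \<Rightarrow> real^'n \<Rightarrow> real" where
  "\<Psi> A H S G y C' m' C m =
     (let Fm = F_m A H S G y m C; Fc = F_c A H S G C in
      1 / 2 * ln (det Fc) - 1 / 2 * ln (det C') - real CARD('n) / 2
        + 1 / 2 * trace (matrix_inv Fc ** C')
        + 1 / 2 * ((m' - Fm) \<bullet> (matrix_inv Fc *v (m' - Fm))))"

definition pred_density ::
  "real^'n^'n \<Rightarrow> real^'n^'n \<Rightarrow> real^'n \<Rightarrow> real^'n^'n \<Rightarrow> real^'n \<Rightarrow> real" where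
  "pred_density A S m C x = (\<integral>x'. gauss_density (A *v x') S x * gauss_density m C x' \<partial>lborel)"

definition incr_lik ::
  "real^'n^'n \<Rightarrow> real^'n^'r \<Rightarrow> real^'n^'n \<Rightarrow> real^'r^'r \<Rightarrow> real^'r
    \<Rightarrow> real^'n \<Rightarrow> real^'n^'n \<Rightarrow> real" where
  "incr_lik A H S G y m C = (\<integral>x. gauss_density (H *v x) G y * pred_density A S m C x \<partial>lborel)"

definition ELBO ::
  "(real^'p \<Rightarrow> real^'n^'n) \<Rightarrow> (real^'p \<Rightarrow> real^'n^'r) \<Rightarrow> (real^'p \<Rightarrow> real^'n^'n)
    \<Rightarrow> (real^'p \<Rightarrow> real^'r^'r) \<Rightarrow> (nat \<Rightarrow> real^'r) \<Rightarrow> (nat \<Rightarrow> real^'p \<Rightarrow> real^'n)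
    \<Rightarrow> (nat \<Rightarrow> real^'p \<Rightarrow> real^'n^'n) \<Rightarrow> (nat \<Rightarrow> real^'p \<Rightarrow> real) \<Rightarrow> nat \<Rightarrow> ereal" where
  "ELBO A H S G y m C \<nu> i =
     eintegral (law (\<nu> i))
       (\<lambda>\<theta>. ereal (ln (incr_lik (A \<theta>) (H \<theta>) (S \<theta>) (G \<theta>) (y i) (m (i - 1) \<theta>) (C (i - 1) \<theta>))))
     - KL_div (\<nu> i) (\<nu> (i - 1))"

definition Z ::
  "(real^'p \<Rightarrow> real^'n^'n) \<Rightarrow> (real^'p \<Rightarrow> real^'n^'r) \<Rightarrow> (real^'p \<Rightarrow> real^'n^'n)
    \<Rightarrow> (real^'p \<Rightarrow> real^'r^'r) \<Rightarrow> real^'r \<Rightarrow> (real^'p \<Rightarrow> real^'n)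
    \<Rightarrow> (real^'p \<Rightarrow> real^'n^'n) \<Rightarrow> (real^'p \<Rightarrow> real) \<Rightarrow> real" where
  "Z A H S G y m C \<nu> =
     (\<integral>\<theta>. gauss_density (H \<theta> *v pred_mean (A \<theta>) (m \<theta>))
            (obs_cov (A \<theta>) (H \<theta>) (S \<theta>) (G \<theta>) (C \<theta>)) y \<partial>law \<nu>)"

definition step_error ::
  "(real^'p \<Rightarrow> real^'n^'n) \<Rightarrow> (real^'p \<Rightarrow> real^'n^'r) \<Rightarrow> (real^'p \<Rightarrow> real^'n^'n)
    \<Rightarrow> (real^'p \<Rightarrow> real^'r^'r) \<Rightarrow> (nat \<Rightarrow> real^'r) \<Rightarrow> (nat \<Rightarrow> real^'p \<Rightarrow> real^'n)
    \<Rightarrow> (nat \<Rightarrow> real^'p \<Rightarrow> real^'n^'n) \<Rightarrow> (nat \<Rightarrow> real^'p \<Rightarrow> real) \<Rightarrow> real \<Rightarrow> (nat \<Rightarrow> real)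
    \<Rightarrow> nat \<Rightarrow> ereal" where
  "step_error A H S G y m C \<nu> c \<epsilon> j = esqrt (
     eintegral (law (\<nu> j))
       (\<lambda>\<theta>. ereal (\<Psi> (A \<theta>) (H \<theta>) (S \<theta>) (G \<theta>) (y j) (C j \<theta>) (m j \<theta>) (C (j - 1) \<theta>) (m (j - 1) \<theta>)))
     - ereal (real CARD('r) / 2 * ln (2 * pi)) - ereal (1 / 2 * ln c) - ereal (\<epsilon> j))"

definition coeff_tv ::
  "(real^'p \<Rightarrow> real^'n^'n) \<Rightarrow> (real^'p \<Rightarrow> real^'n^'r) \<Rightarrow> (real^'p \<Rightarrow> real^'n^'n)
    \<Rightarrow> (real^'p \<Rightarrow> real^'r^'r) \<Rightarrow> (nat \<Rightarrow> real^'r) \<Rightarrow> (nat \<Rightarrow> real^'p \<Rightarrow> real^'n)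
    \<Rightarrow> (nat \<Rightarrow> real^'p \<Rightarrow> real^'n^'n) \<Rightarrow> (nat \<Rightarrow> real^'p \<Rightarrow> real) \<Rightarrow> real \<Rightarrow> nat \<Rightarrow> nat \<Rightarrow> real" where
  "coeff_tv A H S G y m C \<nu> c j k =
     (2 * pi) powr (- (real CARD('r) * real (k - j)) / 2) * c powr (- real (k - j) / 2)
     / (sqrt 2 * (\<Prod>i=j+1..k. Z A H S G (y i) (m (i - 1)) (C (i - 1)) (\<nu> (i - 1))))"

definition coeff_hellinger ::
  "(real^'p \<Rightarrow> real^'n^'n) \<Rightarrow> (real^'p \<Rightarrow> real^'n^'r) \<Rightarrow> (real^'p \<Rightarrow> real^'n^'n)
    \<Rightarrow> (real^'p \<Rightarrow> real^'r^'r) \<Rightarrow> (nat \<Rightarrow> real^'r) \<Rightarrow> (nat \<Rightarrow> real^'p \<Rightarrow> real^'n)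
    \<Rightarrow> (nat \<Rightarrow> real^'p \<Rightarrow> real^'n^'n) \<Rightarrow> (nat \<Rightarrow> real^'p \<Rightarrow> real) \<Rightarrow> real \<Rightarrow> nat \<Rightarrow> nat \<Rightarrow> real" where
  "coeff_hellinger A H S G y m C \<nu> c j k =
     2 ^ (k - j) * (2 * pi) powr (- (real CARD('r) * real (k - j)) / 4) * c powr (- real (k - j) / 4)
     / sqrt (2 * (\<Prod>i=j+1..k. Z A H S G (y i) (m (i - 1)) (C (i - 1)) (\<nu> (i - 1))))"

end

theory Submission
  imports Defs
begin

text \<open>
  The exact posterior evolves by a Markov prediction followed by a Bayes update, and so would the
  approximation if it were not re-fitted at every step. Prediction contracts both distances, and a
  Bayes update with likelihood bounded by \<open>L = (2 \<pi>)\<^bsup>- r / 2\<^esup> c\<^bsup>- 1 / 2\<^esup>\<close> and evidence \<open>Z\<close> expands them at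
  most by \<open>L / Z\<close> (total variation) and \<open>2 sqrt (L / Z)\<close> (Hellinger). The error committed by the
  re-fit in step \<open>j\<close> is controlled by the Kullback-Leibler divergence from the re-fitted density to
  the updated one, which equals the expectation of \<open>\<Psi>\<close> minus the evidence lower bound plus
  \<open>ln Z \<le> ln L\<close>; Pinsker's inequality and its Hellinger analogue turn it into a distance.
\<close>

section \<open>Linear changes of variables\<close>

text \<open>The posterior is taken at one fixed data record, a null event. It is accessible only
  through a version of the joint density that is continuous in the data, and that version has to be
  identified with the predict-update recursion, starting from conditional probabilities of noise
  rectangles. The stability estimate of the Bayes update involves the evidence of its second
  argument only. With the approximation in that place, the coefficients contain the computable
  \<open>Z\<close> and never the evidence of the exact filter. The asymmetry costs nothing in total
  variation and leads to the factor 2 in the Hellinger distance. Expectations of logarithms may be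
  infinite. The divergence is handled through \<open>KL_term\<close>, which is nonnegative
  pointwise, so that state and parameter can be integrated in either order. Integrability of the
  logarithms is then extracted from the finite evidence lower bound, and an infinite expectation of
  \<Psi> makes the one-step bound trivial.\<close>

lemma matrix_vector_mult_borel_measurable [measurable]:
  "(\<lambda>x. (A :: real^'n^'m) *v x) \<in> borel_measurable borel"
  by (intro borel_measurable_continuous_onI linear_continuous_on matrix_vector_mul_bounded_linear)

lemma det_shear:
  fixes m n :: "'n::finite"
  assumes "m \<noteq> n"
  shows "det ((\<chi> i j. of_bool (i = m \<and> j = n \<or> i = j)) :: real^'n^'n) = 1"
proof -
  have "((\<chi> i j. of_bool (i = m \<and> j = n \<or> i = j)) :: real^'n^'n) =
      (\<chi> k. if k = m then row m (mat 1) + 1 *s row n (mat 1) else row k (mat 1))"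
    using assms by (auto simp: vec_eq_iff row_def mat_def)
  then show ?thesis
    using det_row_operation[OF assms, of "mat 1 :: real^'n^'n" 1] by simp
qed

text \<open>The shear invariance of closed boxes is \<open>measure_shear_interval\<close>;
  \<open>measure_linear_sufficient\<close> carries it over to open boxes, and these determine
  Lebesgue measure.\<close>

lemma distr_lborel_shear:
  fixes m n :: "'n::finite"
  assumes mn: "m \<noteq> n"
  defines "h \<equiv> \<lambda>x::real^'n. \<chi> i. if i = m then x$m + x$n else x$i"
  shows "distr lborel borel h = lborel"
proof -
  define h' where "h' = (\<lambda>x::real^'n. \<chi> i. if i = m then x$m - x$n else x$i)"
  have lin: "linear h" "linear h'"
    unfolding h_def h'_def by (rule linearI; auto simp: algebra_simps vec_eq_iff)+
  have [measurable]: "h \<in> borel_measurable borel" "h' \<in> borel_measurable borel"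
    using lin by (auto intro!: borel_measurable_continuous_onI linear_continuous_on
        simp: linear_conv_bounded_linear)
  have inv: "h (h' x) = x" "h' (h x) = x" for x
    using mn by (auto simp: h_def h'_def vec_eq_iff)
  have cb: "measure lebesgue (h ` cbox a b) = 1 * measure lebesgue (cbox a b)" for a b
  proof (cases "cbox a b = {}")
    case False
    \<comment> \<open>\<open>measure_shear_interval\<close> asks for a nonnegative lower end in
      coordinate \<open>n\<close>. The shift by \<open>v\<close> moves that end to 0, and linearity
      of \<open>h\<close> turns the shift into a translation of the image.\<close>
    define v where "v = ((\<chi> i. if i = n then - a $ n else 0) :: real^'n)"
    have ne: "cbox (v + a) (v + b) \<noteq> {}"
      using False by (metis cbox_translation image_is_empty)
    have "h ` cbox a b = (+) (h (- v)) ` h ` (+) v ` cbox a b"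
      unfolding image_image by (simp add: linear_add[OF lin(1), symmetric])
    then have "measure lebesgue (h ` cbox a b) = measure lebesgue (h ` (+) v ` cbox a b)"
      by (simp add: measure_translation)
    also have "\<dots> = measure lebesgue (h ` cbox (v + a) (v + b))"
      by (simp only: cbox_translation)
    also have "\<dots> = measure lebesgue (cbox (v + a) (v + b))"
      unfolding h_def using mn ne by (intro measure_shear_interval) (auto simp: v_def)
    also have "\<dots> = measure lebesgue (cbox a b)"
      by (simp only: cbox_translation measure_translation)
    finally show ?thesis by simp
  qed simp
  \<comment> \<open>Preimages under the inverse shear are images under \<open>h\<close>, whose
    measure has just been computed. Pushing this identity forward by \<open>h\<close> gives the
    claim.\<close>
  have "lborel = distr lborel borel h'"
  proof (rule lborel_eqI)
    fix l u :: "real^'n" assume "\<And>b. b \<in> Basis \<Longrightarrow> l \<bullet> b \<le> u \<bullet> b"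
    then have 1: "emeasure lborel (box l u) = (\<Prod>b\<in>Basis. (u - l) \<bullet> b)" by simp
    have img: "h' -` box l u = h ` box l u"
      by (auto simp: image_iff inv) (metis inv(1))
    have S: "h ` box l u \<in> sets borel"
      unfolding img[symmetric] using measurable_sets[of h' borel borel "box l u"] by simp
    have lm: "h ` box l u \<in> lmeasurable" and ms: "measure lebesgue (h ` box l u) = 1 * measure lebesgue (box l u)"
      using measure_linear_sufficient[OF lin(1) _ cb, of "box l u"] by auto
    have "emeasure lborel (h ` box l u) = emeasure lebesgue (h ` box l u)"
      using S by simp
    also have "\<dots> = ennreal (measure lebesgue (h ` box l u))"
      using lm by (simp add: emeasure_eq_measure2)
    also have "\<dots> = emeasure lebesgue (box l u)"
      using ms by (simp add: emeasure_eq_measure2)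
    finally have "emeasure lborel (h ` box l u) = (\<Prod>b\<in>Basis. (u - l) \<bullet> b)" using 1 by simp
    then show "emeasure (distr lborel borel h') (box l u) = (\<Prod>b\<in>Basis. (u - l) \<bullet> b)"
      by (simp add: emeasure_distr img)
  qed simp
  then have "distr lborel borel h = distr (distr lborel borel h') borel h" by simp
  also have "\<dots> = distr lborel borel (\<lambda>x. x)"
    by (subst distr_distr) (auto simp: comp_def inv)
  also have "\<dots> = lborel" by (simp add: distr_id2)
  finally show ?thesis .
qed

lemma prod_Basis_vec: "(\<Prod>b\<in>(Basis :: (real^'n) set). f b) = (\<Prod>i\<in>UNIV. f (axis i 1))"
proof -
  have "(Basis :: (real^'n) set) = (\<lambda>i. axis i 1) ` UNIV"
    by (auto simp: Basis_vec_def)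
  moreover have "inj (\<lambda>i::'n. axis i 1 :: real^'n)"
    by (auto simp: inj_on_def axis_eq_axis)
  ultimately show ?thesis
    by (metis (no_types, lifting) prod.reindex_cong)
qed

lemma distr_lborel_permute_vec:
  fixes p :: "'n::finite \<Rightarrow> 'n"
  assumes p: "bij p"
  shows "distr lborel borel (\<lambda>x::real^'n. \<chi> i. x $ p i) = lborel"
proof (rule lborel_eqI[symmetric])
  have [measurable]: "(\<lambda>x::real^'n. \<chi> i. x $ p i) \<in> borel_measurable borel"
    by (intro borel_measurable_continuous_onI continuous_intros)
  fix l u :: "real^'n" assume le: "\<And>b. b \<in> Basis \<Longrightarrow> l \<bullet> b \<le> u \<bullet> b"
  let ?q = "inv p"
  have q: "p (?q i) = i" "?q (p i) = i" for i
    using p by (auto simp: bij_def surj_f_inv_f)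
  have "(\<lambda>x::real^'n. \<chi> i. x $ p i) -` box l u = box (\<chi> i. l $ ?q i) (\<chi> i. u $ ?q i)"
    by (auto simp: mem_box_cart) (metis q)+
  moreover have "(\<chi> i. l $ ?q i) \<bullet> b \<le> (\<chi> i. u $ ?q i) \<bullet> b" if "b \<in> Basis" for b :: "real^'n"
    using le that by (force simp: Basis_vec_def inner_axis)
  ultimately have "emeasure (distr lborel borel (\<lambda>x::real^'n. \<chi> i. x $ p i)) (box l u)
      = ennreal (\<Prod>b\<in>Basis. ((\<chi> i. u $ ?q i) - (\<chi> i. l $ ?q i)) \<bullet> b)"
    by (simp add: emeasure_distr)
  also have "(\<Prod>b\<in>Basis. ((\<chi> i. u $ ?q i) - (\<chi> i. l $ ?q i)) \<bullet> b) = (\<Prod>i\<in>UNIV. (u - l) $ ?q i)"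
    by (simp add: prod_Basis_vec inner_axis)
  also have "\<dots> = (\<Prod>i\<in>UNIV. (u - l) $ i)"
    using bij_imp_bij_inv[OF p] by (rule prod.reindex_bij_betw)
  also have "\<dots> = (\<Prod>b\<in>Basis. (u - l) \<bullet> b)"
    by (simp add: prod_Basis_vec inner_axis)
  finally show "emeasure (distr lborel borel (\<lambda>x::real^'n. \<chi> i. x $ p i)) (box l u) = (\<Prod>b\<in>Basis. (u - l) \<bullet> b)" .
qed simp

text \<open>The library proves the scaling of Lebesgue measure under linear maps only for index types
  that carry a well-order.\<close>

lemma nn_integral_lborel_linear:
  fixes A :: "real^'n^'n"
  assumes "det A \<noteq> 0" and "g \<in> borel_measurable borel"
  shows "(\<integral>\<^sup>+x. g x \<partial>lborel) = ennreal \<bar>det A\<bar> * (\<integral>\<^sup>+x. g (A *v x) \<partial>lborel)"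
proof -
  \<comment> \<open>Quantifying over all \<open>g\<close> inside \<open>P\<close> lets the product
    case apply the hypothesis for \<open>B\<close> to the composition of \<open>g\<close> with
    \<open>A\<close>. The guard on the determinant makes a matrix with a zero row trivial.\<close>
  define P where "P A \<longleftrightarrow> (det A \<noteq> 0 \<longrightarrow> (\<forall>g \<in> borel_measurable borel.
      (\<integral>\<^sup>+x. g x \<partial>lborel) = ennreal \<bar>det A\<bar> * (\<integral>\<^sup>+x. g (A *v x) \<partial>lborel)))" for A :: "real^'n^'n"
  have "P A"
  proof (rule induct_matrix_elementary_alt)
    fix A B :: "real^'n^'n" assume AB: "P A" "P B"
    show "P (A ** B)"
      unfolding P_def
    proof (intro impI ballI)
      fix g :: "real^'n \<Rightarrow> ennreal" assume d: "det (A ** B) \<noteq> 0" and [measurable]: "g \<in> borel_measurable borel"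
      have d': "det A \<noteq> 0" "det B \<noteq> 0" using d by (auto simp: det_mul)
      have "(\<integral>\<^sup>+x. g x \<partial>lborel) = ennreal \<bar>det A\<bar> * (\<integral>\<^sup>+x. g (A *v x) \<partial>lborel)"
        by (rule AB(1)[unfolded P_def, rule_format]) (use d' in measurable)
      also have "(\<integral>\<^sup>+x. g (A *v x) \<partial>lborel) = ennreal \<bar>det B\<bar> * (\<integral>\<^sup>+x. g (A *v (B *v x)) \<partial>lborel)"
        by (rule AB(2)[unfolded P_def, rule_format]) (use d' in measurable)
      finally show "(\<integral>\<^sup>+x. g x \<partial>lborel) = ennreal \<bar>det (A ** B)\<bar> * (\<integral>\<^sup>+x. g ((A ** B) *v x) \<partial>lborel)"
        by (simp add: det_mul abs_mult ennreal_mult mult.assoc matrix_vector_mul_assoc)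
    qed
  next
    fix A :: "real^'n^'n" and i assume "row i A = 0"
    then show "P A" by (simp add: P_def det_zero_row)
  next
    fix A :: "real^'n^'n" assume diag: "\<And>i j. i \<noteq> j \<Longrightarrow> A$i$j = 0"
    show "P A" unfolding P_def
    proof (intro impI ballI)
      fix g :: "real^'n \<Rightarrow> ennreal" assume d: "det A \<noteq> 0" and [measurable]: "g \<in> borel_measurable borel"
      \<comment> \<open>The diagonal entries, indexed by basis vectors as
        \<open>lborel_affine_euclidean\<close> expects.\<close>
      define c where "c b = b \<bullet> (A *v b)" for b :: "real^'n"
      have c_axis: "c (axis i 1) = A $ i $ i" for i
        by (simp add: c_def inner_axis' matrix_vector_mult_basis column_def)
      have det: "det A = (\<Prod>i\<in>UNIV. A$i$i)"
        using diag by (rule det_diagonal)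
      have T: "0 + (\<Sum>j\<in>Basis. (c j * (x \<bullet> j)) *\<^sub>R j) = A *v x" for x
      proof (rule euclidean_eqI)
        fix b :: "real^'n" assume b: "b \<in> Basis"
        then obtain i where i: "b = axis i 1" by (auto simp: Basis_vec_def)
        have "(A *v x) $ i = A$i$i * x$i"
          by (simp add: matrix_vector_mult_def sum.remove[of _ i] diag)
        then show "(0 + (\<Sum>j\<in>Basis. (c j * (x \<bullet> j)) *\<^sub>R j)) \<bullet> b = (A *v x) \<bullet> b"
          unfolding add_0 inner_sum_left_Basis[OF b] by (simp add: i inner_axis c_axis)
      qed
      have c0: "j \<in> Basis \<Longrightarrow> c j \<noteq> 0" for j :: "real^'n"
        using d det by (auto simp: Basis_vec_def c_axis)
      have "lborel = density (distr lborel borel ((*v) A)) (\<lambda>_. ennreal (\<Prod>j\<in>Basis. \<bar>c j\<bar>))"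
        using lborel_affine_euclidean[of c 0, OF c0] unfolding T .
      also have "(\<Prod>j\<in>Basis. \<bar>c j\<bar>) = \<bar>det A\<bar>"
        by (simp add: prod_Basis_vec c_axis det abs_prod)
      finally have *: "lborel = density (distr lborel borel ((*v) A)) (\<lambda>_. ennreal \<bar>det A\<bar>)" .
      show "(\<integral>\<^sup>+x. g x \<partial>lborel) = ennreal \<bar>det A\<bar> * (\<integral>\<^sup>+x. g (A *v x) \<partial>lborel)"
        by (subst *) (simp add: nn_integral_density nn_integral_distr nn_integral_cmult)
    qed
  next
    fix m n :: 'n assume "m \<noteq> n"
    let ?p = "Transposition.transpose m n"
    let ?A = "(\<chi> i j. mat 1 $ i $ ?p j) :: real^'n^'n"
    have mv: "?A *v x = (\<chi> i. x $ ?p i)" for x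
    proof -
      have "(if i = ?p j then 1 else 0) * x $ j = (if j = ?p i then x $ j else 0)" for i j
        by auto
      then show ?thesis by (simp add: matrix_vector_mult_def mat_def vec_eq_iff)
    qed
    have det: "\<bar>det ?A\<bar> = 1"
      by (simp add: det_permute_columns permutes_swap_id sign_swap_id abs_mult sign_def)
    show "P ?A" unfolding P_def
    proof (intro impI ballI)
      fix g :: "real^'n \<Rightarrow> ennreal" assume [measurable]: "g \<in> borel_measurable borel"
      have [measurable]: "(\<lambda>x::real^'n. \<chi> i. x $ ?p i) \<in> borel_measurable borel"
        by (intro borel_measurable_continuous_onI continuous_intros)
      show "(\<integral>\<^sup>+x. g x \<partial>lborel) = ennreal \<bar>det ?A\<bar> * (\<integral>\<^sup>+x. g (?A *v x) \<partial>lborel)"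
        unfolding det mv by (subst distr_lborel_permute_vec[of ?p, symmetric]) (auto simp: nn_integral_distr)
    qed
  next
    fix m n :: 'n assume mn: "m \<noteq> n"
    let ?A = "(\<chi> i j. of_bool (i = m \<and> j = n \<or> i = j)) :: real^'n^'n"
    let ?h = "\<lambda>x::real^'n. \<chi> i. if i = m then x$m + x$n else x$i"
    have mv: "?A *v x = ?h x" for x
    proof -
      have "of_bool (i = m \<and> j = n \<or> i = j) * x $ j =
          (if j = i then x $ j else 0) + (if j = n then if i = m then x $ j else 0 else 0)" for i j
        using mn by auto
      then show ?thesis using mn by (simp add: matrix_vector_mult_def vec_eq_iff sum.distrib)
    qed
    show "P ?A" unfolding P_def
    proof (intro impI ballI)
      fix g :: "real^'n \<Rightarrow> ennreal" assume [measurable]: "g \<in> borel_measurable borel"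
      have [measurable]: "?h \<in> borel_measurable borel"
        unfolding mv[symmetric] by measurable
      show "(\<integral>\<^sup>+x. g x \<partial>lborel) = ennreal \<bar>det ?A\<bar> * (\<integral>\<^sup>+x. g (?A *v x) \<partial>lborel)"
        using nn_integral_distr[of ?h lborel borel g]
        unfolding det_shear[OF mn] mv distr_lborel_shear[OF mn] by simp
    qed
  qed
  from this[unfolded P_def, rule_format, OF assms] show ?thesis .
qed

lemma nn_integral_lborel_translate:
  fixes a :: "'a::euclidean_space"
  assumes [measurable]: "g \<in> borel_measurable borel"
  shows "(\<integral>\<^sup>+x. g (a + x) \<partial>lborel) = (\<integral>\<^sup>+x. g x \<partial>lborel)"
  using lborel_affine[of 1 a] nn_integral_distr[of "\<lambda>x. a + x" lborel borel g]
  by (simp add: density_1)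

section \<open>Positive definite matrices\<close>

lemma inner_matrix_vector_left: "((A :: real^'n^'m) *v x) \<bullet> y = x \<bullet> (transpose A *v y)"
  by (metis dot_lmul_matrix transpose_matrix_vector transpose_transpose)

lemma matrix_inv_mult:
  fixes A :: "real^'n^'n"
  assumes "invertible A"
  shows "A ** matrix_inv A = mat 1" "matrix_inv A ** A = mat 1"
  using someI_ex[OF assms[unfolded invertible_def]] by (auto simp: matrix_inv_def)

text \<open>\<open>matrix_inv\<close> is a choice among two-sided inverses; a right inverse of a
  square matrix is two-sided, so one product pins it down.\<close>

lemma matrix_inv_unique:
  fixes A :: "real^'n^'n"
  assumes "A ** B = mat 1"
  shows "matrix_inv A = B"
proof -
  have "invertible A" using assms by (auto simp: invertible_right_inverse)
  then have "matrix_inv A = matrix_inv A ** (A ** B)" by (simp add: assms)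
  also have "\<dots> = B"
    unfolding matrix_mul_assoc matrix_inv_mult(2)[OF \<open>invertible A\<close>] by simp
  finally show ?thesis .
qed

lemma inner_symmetric_matrix:
  assumes "transpose R = R"
  shows "x \<bullet> (R *v y) = y \<bullet> (R *v (x :: real^'n))"
  by (metis assms inner_commute inner_matrix_vector_left)

text \<open>Gram-Schmidt for the scalar product \<open>(x, y) \<mapsto> x \<bullet> R y\<close>; keeping the support of
  \<open>b i\<close> inside \<open>I\<close> makes every new vector nonzero.\<close>

lemma pos_def_orthonormal_family:
  fixes R :: "real^'n^'n"
  assumes R: "pos_def R"
  shows "\<exists>b :: 'n \<Rightarrow> real^'n. \<forall>i\<in>I. (\<forall>j\<in>I. b i \<bullet> (R *v b j) = of_bool (i = j)) \<and> (\<forall>k. k \<notin> I \<longrightarrow> b i $ k = 0)"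
  using finite[of I]
proof (induction I rule: finite_induct)
  case empty then show ?case by simp
next
  case (insert i I)
  then obtain b :: "'n \<Rightarrow> real^'n" where b: "\<And>i j. i \<in> I \<Longrightarrow> j \<in> I \<Longrightarrow> b i \<bullet> (R *v b j) = of_bool (i = j)"
    and b0: "\<And>i k. i \<in> I \<Longrightarrow> k \<notin> I \<Longrightarrow> b i $ k = 0" by blast
  define v where "v = axis i 1 - (\<Sum>j\<in>I. (b j \<bullet> (R *v axis i 1)) *\<^sub>R b j)"
  have "v $ i = 1" using insert.hyps b0 by (simp add: v_def)
  then have "v \<noteq> 0" by auto
  then have pos: "0 < v \<bullet> (R *v v)" using R by (auto simp: pos_def_def)
  have sym: "x \<bullet> (R *v y) = y \<bullet> (R *v x)" for x y
    using R by (intro inner_symmetric_matrix) (simp add: pos_def_def)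
  have lin: "linear (\<lambda>x. y \<bullet> (R *v x))" for y
    by (intro linearI) (auto simp: matrix_vector_right_distrib inner_add_right matrix_vector_mult_scaleR)
  have orth: "b j \<bullet> (R *v v) = 0" if "j \<in> I" for j
  proof -
    have "b j \<bullet> (R *v v) = b j \<bullet> (R *v axis i 1) - (\<Sum>l\<in>I. (b l \<bullet> (R *v axis i 1)) * (b j \<bullet> (R *v b l)))"
      unfolding v_def linear_diff[OF lin] linear_sum[OF lin] linear_scale[OF lin] by simp
    also have "(\<Sum>l\<in>I. (b l \<bullet> (R *v axis i 1)) * (b j \<bullet> (R *v b l)))
        = (\<Sum>l\<in>I. if l = j then b l \<bullet> (R *v axis i 1) else 0)"
      using that by (intro sum.cong) (auto simp: b)
    finally show ?thesis using that insert.hyps by simp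
  qed
  define c where "c = inverse (sqrt (v \<bullet> (R *v v)))"
  have c: "c * (c * (v \<bullet> (R *v v))) = 1"
    using pos by (simp add: c_def field_simps flip: power2_eq_square)
  let ?b = "b(i := c *\<^sub>R v)"
  have "?b j \<bullet> (R *v ?b l) = of_bool (j = l)" if "j \<in> insert i I" "l \<in> insert i I" for j l
    using that insert.hyps c orth sym b by (auto simp: matrix_vector_mult_scaleR)
  moreover have "?b j $ k = 0" if "j \<in> insert i I" "k \<notin> insert i I" for j k
    using that insert.hyps b0 by (auto simp: v_def axis_def)
  ultimately show ?case by blast
qed

text \<open>An orthonormal basis for the scalar product of \<open>R\<close>, written as the columns
  of \<open>B\<close>, makes \<open>transpose B ** R ** B\<close> the identity; solving for
  \<open>R\<close> gives \<open>L\<close> as the transposed inverse of \<open>B\<close>. Such a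
  factor reduces every Gaussian to the standard one.\<close>

lemma pos_def_factor:
  fixes R :: "real^'n^'n"
  assumes R: "pos_def R"
  obtains L where "det L \<noteq> 0" "R = L ** transpose L"
proof -
  obtain b :: "'n \<Rightarrow> real^'n" where b: "\<And>i j. b i \<bullet> (R *v b j) = of_bool (i = j)"
    using pos_def_orthonormal_family[OF R, of UNIV] by auto
  define B where "B = transpose (\<chi> i. b i)"
  have "transpose B ** (R ** B) = mat 1"
  proof -
    have "(transpose B ** (R ** B)) $ i $ j = b i \<bullet> (R *v b j)" for i j
      by (simp add: B_def matrix_matrix_mult_def matrix_vector_mult_def transpose_def inner_vec_def)
    then show ?thesis by (simp add: vec_eq_iff mat_def b)
  qed
  then have 1: "transpose B ** R ** B = mat 1" by (simp add: matrix_mul_assoc)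
  then have "invertible B" by (auto simp: invertible_left_inverse)
  define L where "L = transpose (matrix_inv B)"
  have BL: "B ** transpose L = mat 1" "transpose L ** B = mat 1"
    using matrix_inv_mult[OF \<open>invertible B\<close>] by (auto simp: L_def)
  have LB: "L ** transpose B = mat 1"
    using BL(1) by (metis matrix_transpose_mul transpose_mat transpose_transpose)
  have "L ** transpose L = L ** (transpose B ** R ** B) ** transpose L" by (simp add: 1)
  also have "\<dots> = (L ** transpose B) ** R ** (B ** transpose L)" by (simp only: matrix_mul_assoc)
  also have "\<dots> = R" by (simp add: LB BL)
  finally have "R = L ** transpose L" by simp
  moreover have "det L \<noteq> 0"
    using LB by (metis invertible_det_nz invertible_right_inverse)
  ultimately show thesis using that by blast
qed

lemma pos_def_det_pos: "pos_def (R :: real^'n^'n) \<Longrightarrow> 0 < det R"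
  by (erule pos_def_factor) (simp add: det_mul det_transpose zero_less_mult_iff not_less less_le)

lemma pos_def_invertible: "pos_def (R :: real^'n^'n) \<Longrightarrow> invertible R"
  using pos_def_det_pos[of R] by (simp add: invertible_det_nz)

lemma pos_def_symmetric: "pos_def R \<Longrightarrow> transpose R = R"
  by (simp add: pos_def_def)

lemma symmetric_matrix_inv:
  fixes R :: "real^'n^'n"
  assumes "transpose R = R" "invertible R"
  shows "transpose (matrix_inv R) = matrix_inv R"
  by (metis assms matrix_inv_mult(2) matrix_inv_unique matrix_transpose_mul transpose_mat)

text \<open>For x = R z, the quadratic form of the inverse at x is the form of \<open>R\<close> at
  z.\<close>

lemma pos_def_matrix_inv:
  fixes R :: "real^'n^'n"
  assumes R: "pos_def R"
  shows "pos_def (matrix_inv R)"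
  unfolding pos_def_def
proof (intro conjI allI impI)
  note inv = matrix_inv_mult[OF pos_def_invertible[OF R]]
  show sym: "transpose (matrix_inv R) = matrix_inv R"
    using symmetric_matrix_inv[OF pos_def_symmetric[OF R] pos_def_invertible[OF R]] .
  fix x :: "real^'n" assume "x \<noteq> 0"
  let ?z = "matrix_inv R *v x"
  have x: "x = R *v ?z" by (simp add: matrix_vector_mul_assoc inv)
  then have "?z \<noteq> 0" using \<open>x \<noteq> 0\<close> by (metis matrix_vector_mult_0_right)
  then have "0 < ?z \<bullet> (R *v ?z)" using R by (simp add: pos_def_def)
  then show "0 < x \<bullet> ?z" by (metis x inner_commute)
qed

lemma pos_def_mat_1: "pos_def (mat 1 :: real^'n^'n)"
  by (simp add: pos_def_def)

lemma pos_def_quadratic_nonneg: "pos_def R \<Longrightarrow> 0 \<le> x \<bullet> (R *v x)"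
  by (cases "x = 0") (auto simp: pos_def_def less_imp_le)

lemma transpose_add: "transpose (A + B) = transpose A + (transpose B :: real^'n^'m)"
  by (simp add: transpose_def vec_eq_iff)

text \<open>Strictness comes from \<open>G\<close>, so \<open>H\<close> may have any rank. The lemma
  serves the predicted covariance, the observation covariance and, with \<open>transpose H\<close>,
  the posterior precision.\<close>

lemma pos_def_congruence_add:
  fixes H :: "real^'n^'m"
  assumes C: "pos_def C" and G: "pos_def G"
  shows "pos_def (H ** C ** transpose H + G)"
  unfolding pos_def_def
proof (intro conjI allI impI)
  show "transpose (H ** C ** transpose H + G) = H ** C ** transpose H + G"
    by (simp add: transpose_add matrix_transpose_mul matrix_mul_assoc pos_def_symmetric[OF C] pos_def_symmetric[OF G])
  fix x :: "real^'m" assume "x \<noteq> 0"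
  then have "0 < x \<bullet> (G *v x)" using G by (simp add: pos_def_def)
  moreover have "x \<bullet> ((H ** C ** transpose H) *v x) = (transpose H *v x) \<bullet> (C *v (transpose H *v x))"
    by (simp only: inner_matrix_vector_left transpose_transpose matrix_vector_mul_assoc matrix_mul_assoc)
  ultimately show "0 < x \<bullet> ((H ** C ** transpose H + G) *v x)"
    using pos_def_quadratic_nonneg[OF C, of "transpose H *v x"]
    by (simp add: matrix_vector_mult_add_rdistrib inner_add_right del: transpose_matrix_vector)
qed

section \<open>Gaussian densities\<close>

lemma gauss_density_nonneg: "0 \<le> gauss_density \<mu> R x"
  by (simp add: gauss_density_def)

lemma gauss_density_pos: "pos_def R \<Longrightarrow> 0 < gauss_density \<mu> R x"
  using pos_def_det_pos[of R] by (simp add: gauss_density_def)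

lemma gauss_density_measurable_arg [measurable]: "gauss_density \<mu> R \<in> borel_measurable borel"
  unfolding gauss_density_def
  by (intro borel_measurable_continuous_onI continuous_intros linear_continuous_on_compose[where f="\<lambda>x. x - \<mu>"])
     (auto intro!: continuous_intros)

lemma gauss_density_std:
  fixes u :: "real^'n"
  shows "gauss_density 0 (mat 1) u = (\<Prod>i\<in>UNIV. std_normal_density (u $ i))"
proof -
  have inv: "matrix_inv (mat 1 :: real^'n^'n) = mat 1"
    by (rule matrix_inv_unique) simp
  have "(2 * pi) powr (- real CARD('n) / 2) = (1 / sqrt (2 * pi)) ^ CARD('n)"
  proof -
    have "(1 / sqrt (2 * pi)) ^ CARD('n) = ((2 * pi) powr (- 1 / 2)) powr real CARD('n)"
      by (simp add: powr_realpow[symmetric] powr_half_sqrt[symmetric] powr_minus_divide)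
    then show ?thesis by (simp add: powr_powr)
  qed
  moreover have "exp (- (u \<bullet> u) / 2) = (\<Prod>i\<in>UNIV. exp (- (u $ i)\<^sup>2 / 2))"
    by (simp add: exp_sum[symmetric] inner_vec_def power2_eq_square sum_negf sum_divide_distrib)
  ultimately show ?thesis
    by (simp add: gauss_density_def inv std_normal_density_def prod.distrib power_divide prod_dividef)
qed

lemma nn_integral_vec_prod:
  assumes [measurable]: "\<And>i. f i \<in> borel_measurable borel"
  shows "(\<integral>\<^sup>+(x::real^'n). (\<Prod>i\<in>UNIV. f i (x $ i)) \<partial>lborel) = (\<Prod>i\<in>UNIV. (\<integral>\<^sup>+x. f i x \<partial>lborel))"
proof -
  \<comment> \<open>\<open>nn_integral_lborel_prod\<close> indexes its factors by basis vectors;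
    \<open>g\<close> recovers the coordinate from the basis vector.\<close>
  define g where "g b = f (THE i. b = axis i (1::real))" for b :: "real^'n"
  have g: "g (axis i 1) = f i" for i
    by (simp add: g_def axis_eq_axis)
  have "(\<integral>\<^sup>+(x::real^'n). (\<Prod>b\<in>Basis. g b (x \<bullet> b)) \<partial>lborel) = (\<Prod>b\<in>Basis. (\<integral>\<^sup>+x. g b x \<partial>lborel))"
    by (intro nn_integral_lborel_prod) (auto simp: g_def)
  then show ?thesis by (simp add: prod_Basis_vec g inner_axis)
qed

text \<open>The substitution turns the quadratic form into the squared norm of \<open>u\<close>, and
  the determinant of \<open>R\<close> is the square of that of \<open>L\<close>, so the Jacobian
  cancels the normalising constant.\<close>

lemma gauss_density_affine:
  assumes L: "det L \<noteq> 0" "R = L ** transpose L"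
  shows "\<bar>det L\<bar> * gauss_density \<mu> R (\<mu> + L *v u) = gauss_density 0 (mat 1) u"
proof -
  have inv1: "matrix_inv (mat 1 :: real^'a^'a) = mat 1"
    by (rule matrix_inv_unique) simp
  let ?P = "matrix_inv L"
  have P: "L ** ?P = mat 1" "?P ** L = mat 1"
    using matrix_inv_mult[of L] L(1) by (auto simp: invertible_det_nz)
  then have Pt: "transpose L ** transpose ?P = mat 1"
    by (metis matrix_transpose_mul transpose_mat)
  have "R ** (transpose ?P ** ?P) = L ** (transpose L ** transpose ?P) ** ?P"
    unfolding L by (simp only: matrix_mul_assoc)
  then have "R ** (transpose ?P ** ?P) = mat 1" by (simp add: Pt P)
  then have inv: "matrix_inv R = transpose ?P ** ?P" by (rule matrix_inv_unique)
  have "(L *v u) \<bullet> (matrix_inv R *v (L *v u)) = (?P *v (L *v u)) \<bullet> (?P *v (L *v u))"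
    unfolding inv inner_matrix_vector_left[of ?P] by (simp only: matrix_vector_mul_assoc matrix_mul_assoc)
  also have "\<dots> = u \<bullet> u" by (simp add: matrix_vector_mul_assoc P)
  finally have "(L *v u) \<bullet> (matrix_inv R *v (L *v u)) = u \<bullet> u" .
  moreover have "det R powr (- 1 / 2) = 1 / \<bar>det L\<bar>"
  proof -
    have "det R = \<bar>det L\<bar> powr 2" using L by (simp add: det_mul powr_numeral power2_eq_square)
    then show ?thesis using L(1) by (simp add: powr_powr powr_minus_divide)
  qed
  ultimately show ?thesis using L(1) by (simp add: gauss_density_def inv1)
qed

lemma sets_gauss_measure [simp, measurable_cong]: "sets (gauss_measure \<mu> R) = sets borel"
  by (simp add: gauss_measure_def)

lemma space_gauss_measure [simp]: "space (gauss_measure \<mu> R) = UNIV"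
  by (simp add: gauss_measure_def)

text \<open>Total mass, first and second moments thus have to be computed for the standard Gaussian
  only.\<close>

lemma gauss_measure_affine:
  fixes L :: "real^'n^'n"
  assumes L: "det L \<noteq> 0" "R = L ** transpose L"
  shows "gauss_measure \<mu> R = distr (gauss_measure 0 (mat 1)) borel (\<lambda>u. \<mu> + L *v u)"
proof (rule measure_eqI)
  fix A assume "A \<in> sets (gauss_measure \<mu> R)"
  then have [measurable]: "A \<in> sets borel" by simp
  have "emeasure (gauss_measure \<mu> R) A = (\<integral>\<^sup>+x. ennreal (gauss_density \<mu> R x) * indicator A x \<partial>lborel)"
    by (simp add: gauss_measure_def emeasure_density)
  also have "\<dots> = (\<integral>\<^sup>+x. ennreal (gauss_density \<mu> R (\<mu> + x)) * indicator A (\<mu> + x) \<partial>lborel)"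
    by (subst nn_integral_lborel_translate[symmetric, of _ \<mu>]) auto
  also have "\<dots> = ennreal \<bar>det L\<bar> * (\<integral>\<^sup>+u. ennreal (gauss_density \<mu> R (\<mu> + L *v u)) * indicator A (\<mu> + L *v u) \<partial>lborel)"
    by (subst nn_integral_lborel_linear[OF L(1)]) auto
  also have "\<dots> = (\<integral>\<^sup>+u. ennreal (\<bar>det L\<bar> * gauss_density \<mu> R (\<mu> + L *v u)) * indicator A (\<mu> + L *v u) \<partial>lborel)"
    by (subst nn_integral_cmult[symmetric]) (auto simp: ennreal_mult gauss_density_nonneg mult.assoc)
  also have "\<dots> = (\<integral>\<^sup>+u. ennreal (gauss_density 0 (mat 1) u) * indicator A (\<mu> + L *v u) \<partial>lborel)"
    unfolding gauss_density_affine[OF L] ..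
  also have "\<dots> = emeasure (distr (gauss_measure 0 (mat 1)) borel (\<lambda>u. \<mu> + L *v u)) A"
    using measurable_sets[of "\<lambda>u. \<mu> + L *v u" borel borel A]
    by (subst emeasure_distr) (auto simp: gauss_measure_def emeasure_density indicator_def)
  finally show "emeasure (gauss_measure \<mu> R) A = emeasure (distr (gauss_measure 0 (mat 1)) borel (\<lambda>u. \<mu> + L *v u)) A" .
qed simp

lemma nn_integral_std_normal_density: "(\<integral>\<^sup>+x. ennreal (std_normal_density x) \<partial>lborel) = 1"
  using prob_space.emeasure_space_1[OF prob_space_normal_density[of 1 0]]
  by (simp add: emeasure_density)

lemma prob_space_gauss_measure:
  fixes R :: "real^'n^'n"
  assumes "pos_def R"
  shows "prob_space (gauss_measure \<mu> R)"
proof -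
  obtain L where L: "det L \<noteq> 0" "R = L ** transpose L" using pos_def_factor[OF assms] .
  have "(\<integral>\<^sup>+(x::real^'n). ennreal (gauss_density 0 (mat 1) x) \<partial>lborel) = 1"
    by (simp add: gauss_density_std prod_ennreal[symmetric] nn_integral_std_normal_density
        nn_integral_vec_prod[of "\<lambda>_ x. ennreal (std_normal_density x)"])
  then have "prob_space (gauss_measure 0 (mat 1) :: (real^'n) measure)"
    by (intro prob_spaceI) (simp add: gauss_measure_def emeasure_density)
  then show ?thesis
    unfolding gauss_measure_affine[OF L] by (rule prob_space.prob_space_distr) simp
qed

lemma nn_integral_gauss_density:
  fixes R :: "real^'n^'n"
  assumes "pos_def R"
  shows "(\<integral>\<^sup>+x. ennreal (gauss_density \<mu> R x) \<partial>lborel) = 1"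
  using prob_space.emeasure_space_1[OF prob_space_gauss_measure[OF assms, of \<mu>]]
  by (simp add: gauss_measure_def emeasure_density)

lemma gauss_density_integral:
  fixes R :: "real^'n^'n"
  assumes "pos_def R"
  shows "integrable lborel (gauss_density \<mu> R)" "(\<integral>x. gauss_density \<mu> R x \<partial>lborel) = 1"
  using nn_integral_gauss_density[OF assms, of \<mu>]
  by (auto simp: gauss_density_nonneg integrable_iff_bounded integral_eq_nn_integral)
lemma integral_gauss_measure:
  "integrable (gauss_measure \<mu> R) g \<longleftrightarrow> integrable lborel (\<lambda>x. gauss_density \<mu> R x * g x)"
  "(\<integral>x. g x \<partial>gauss_measure \<mu> R) = (\<integral>x. gauss_density \<mu> R x * g x \<partial>lborel)"
  if "g \<in> borel_measurable borel" for g :: "real^'n \<Rightarrow> real"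
  unfolding gauss_measure_def using that
  by (simp_all add: integrable_density integral_density gauss_density_nonneg)

section \<open>Moments of Gaussian laws\<close>

lemma std_gauss_invariant:
  fixes L :: "real^'n^'n"
  assumes "L ** transpose L = mat 1"
  shows "distr (gauss_measure 0 (mat 1)) borel ((*v) L) = gauss_measure 0 (mat 1)"
proof -
  have "det L \<noteq> 0" using assms by (metis invertible_det_nz invertible_right_inverse)
  from gauss_measure_affine[OF this assms[symmetric], of 0] show ?thesis by simp
qed

lemma std_gauss_integral_transform:
  fixes L :: "real^'n^'n" and g :: "real^'n \<Rightarrow> real"
  assumes "L ** transpose L = mat 1" "g \<in> borel_measurable borel"
  shows "(\<integral>u. g (L *v u) \<partial>gauss_measure 0 (mat 1)) = (\<integral>u. g u \<partial>gauss_measure 0 (mat 1))"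
  by (subst std_gauss_invariant[OF assms(1), symmetric]) (simp add: integral_distr assms(2))

text \<open>A nonnegative integral factorises over the coordinates before integrability is known;
  all factors are total masses except the \<open>i\<close>-th, which is the second moment in
  dimension one.\<close>

lemma std_gauss_second_moment:
  "integrable (gauss_measure 0 (mat 1 :: real^'n^'n)) (\<lambda>u. (u $ i)\<^sup>2)"
  "(\<integral>u. (u $ i)\<^sup>2 \<partial>gauss_measure 0 (mat 1 :: real^'n^'n)) = 1"
proof -
  have m2: "(\<integral>\<^sup>+x. ennreal (std_normal_density x * x\<^sup>2) \<partial>lborel) = 1"
    using std_normal_moment_even[of 1]
    by (subst nn_integral_eq_integral) (auto simp: has_bochner_integral_iff numeral_2_eq_2)
  have "(\<integral>\<^sup>+u. ennreal ((u $ i)\<^sup>2) \<partial>gauss_measure 0 (mat 1 :: real^'n^'n))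
      = (\<integral>\<^sup>+u. ennreal ((\<Prod>j\<in>UNIV. std_normal_density (u $ j)) * (u $ i)\<^sup>2) \<partial>lborel)"
    by (simp add: gauss_measure_def nn_integral_density ennreal_mult gauss_density_std prod_nonneg)
  also have "\<dots> = (\<integral>\<^sup>+(u::real^'n). (\<Prod>j\<in>UNIV. ennreal (std_normal_density (u $ j) * (if j = i then (u $ j)\<^sup>2 else 1))) \<partial>lborel)"
    by (simp add: prod_ennreal prod.distrib)
  also have "\<dots> = (\<Prod>j\<in>(UNIV :: 'n set). (\<integral>\<^sup>+x. ennreal (std_normal_density x * (if j = i then x\<^sup>2 else 1)) \<partial>lborel))"
    by (subst nn_integral_vec_prod[of "\<lambda>j x. ennreal (std_normal_density x * (if j = i then x\<^sup>2 else 1))"]) auto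
  also have "\<dots> = 1"
  proof (intro prod.neutral ballI)
    fix j show "(\<integral>\<^sup>+x. ennreal (std_normal_density x * (if j = i then x\<^sup>2 else 1)) \<partial>lborel) = 1"
      by (cases "j = i") (simp_all only: refl if_True if_False mult_1_right m2 nn_integral_std_normal_density)
  qed
  finally have *: "(\<integral>\<^sup>+u. ennreal ((u $ i)\<^sup>2) \<partial>gauss_measure 0 (mat 1 :: real^'n^'n)) = 1" .
  then show "integrable (gauss_measure 0 (mat 1 :: real^'n^'n)) (\<lambda>u. (u $ i)\<^sup>2)"
    by (intro integrableI_bounded) auto
  show "(\<integral>u. (u $ i)\<^sup>2 \<partial>gauss_measure 0 (mat 1 :: real^'n^'n)) = 1"
    by (subst integral_eq_nn_integral) (auto simp: *)
qed

text \<open>Odd moments vanish because the standard Gaussian is invariant under reflections.\<close>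

lemma std_gauss_moments:
  fixes i j :: "'n::finite"
  shows "integrable (gauss_measure 0 (mat 1 :: real^'n^'n)) (\<lambda>u. u $ i * u $ j)"
    "(\<integral>u. u $ i * u $ j \<partial>gauss_measure 0 (mat 1 :: real^'n^'n)) = of_bool (i = j)"
    "integrable (gauss_measure 0 (mat 1 :: real^'n^'n)) (\<lambda>u. u $ i)"
    "(\<integral>u. u $ i \<partial>gauss_measure 0 (mat 1 :: real^'n^'n)) = 0"
proof -
  let ?N = "gauss_measure 0 (mat 1 :: real^'n^'n)"
  interpret prob_space ?N by (rule prob_space_gauss_measure[OF pos_def_mat_1])
  show "integrable ?N (\<lambda>u. u $ i * u $ j)"
  proof (rule Bochner_Integration.integrable_bound)
    show "integrable ?N (\<lambda>u. (u $ i)\<^sup>2 + (u $ j)\<^sup>2)"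
      by (intro Bochner_Integration.integrable_add std_gauss_second_moment)
    have "\<bar>a * b\<bar> \<le> \<bar>a\<^sup>2 + b\<^sup>2\<bar>" for a b :: real
    proof -
      have "0 \<le> \<bar>a\<bar> * \<bar>b\<bar>" by simp
      then show ?thesis using sum_squares_bound[of "\<bar>a\<bar>" "\<bar>b\<bar>"] unfolding abs_mult power2_abs by linarith
    qed
    then show "AE u in ?N. norm (u $ i * u $ j) \<le> norm ((u $ i)\<^sup>2 + (u $ j)\<^sup>2)"
      by (simp only: real_norm_def) simp
  qed simp
  show "integrable ?N (\<lambda>u. u $ i)"
  proof (rule Bochner_Integration.integrable_bound)
    show "integrable ?N (\<lambda>u. 1 + (u $ i)\<^sup>2)"
      by (intro Bochner_Integration.integrable_add std_gauss_second_moment) simp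
    have "\<bar>a\<bar> \<le> \<bar>1 + a\<^sup>2\<bar>" for a :: real
      using sum_squares_bound[of 1 "\<bar>a\<bar>"] by (simp add: abs_mult)
    then show "AE u in ?N. norm (u $ i) \<le> norm (1 + (u $ i)\<^sup>2)"
      by (simp only: real_norm_def) simp
  qed simp
  define L where "L = ((\<chi> k l. if k = l then if k = i then -1 else 1 else 0) :: real^'n^'n)"
  have "transpose L = L" by (auto simp: L_def transpose_def vec_eq_iff)
  have Lu: "L *v u = (\<chi> k. if k = i then - u $ k else u $ k)" for u
  proof -
    have "(if k = l then if k = i then -1 else 1 else 0) * u $ l = (if l = k then if k = i then - u $ k else u $ k else 0)" for k l
      by auto
    then show ?thesis by (simp add: L_def matrix_vector_mult_def vec_eq_iff)
  qed
  have LL: "L ** transpose L = mat 1"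
  proof -
    have "L *v (L *v u) = u" for u by (simp add: Lu vec_eq_iff)
    then show ?thesis unfolding \<open>transpose L = L\<close> by (simp add: matrix_eq matrix_vector_mul_assoc)
  qed
  have "(\<integral>u. - (u $ i) \<partial>?N) = (\<integral>u. u $ i \<partial>?N)"
    using std_gauss_integral_transform[OF LL, of "\<lambda>u. u $ i"] by (simp add: Lu)
  then show "(\<integral>u. u $ i \<partial>?N) = 0" by simp
  show "(\<integral>u. u $ i * u $ j \<partial>?N) = of_bool (i = j)"
  proof (cases "i = j")
    case True
    then show ?thesis using std_gauss_second_moment(2)[of i] by (simp add: power2_eq_square)
  next
    case False
    have "(\<integral>u. - (u $ i * u $ j) \<partial>?N) = (\<integral>u. u $ i * u $ j \<partial>?N)"
      using std_gauss_integral_transform[OF LL, of "\<lambda>u. u $ i * u $ j"] False by (simp add: Lu)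
    then show ?thesis using False by simp
  qed
qed

text \<open>After the substitution x = \<mu> + L u the linear part has mean zero, and the covariance
  of \<open>u\<close> being the identity turns the quadratic part into the trace of
  \<open>transpose L ** Q ** L\<close>, which is cyclic.\<close>

lemma gauss_measure_quadratic:
  fixes R Q :: "real^'n^'n"
  assumes R: "pos_def R"
  shows "integrable (gauss_measure \<mu> R) (\<lambda>x. (x - a) \<bullet> (Q *v (x - a)))"
    "(\<integral>x. (x - a) \<bullet> (Q *v (x - a)) \<partial>gauss_measure \<mu> R) = trace (Q ** R) + (\<mu> - a) \<bullet> (Q *v (\<mu> - a))"
proof -
  let ?N = "gauss_measure 0 (mat 1 :: real^'n^'n)"
  interpret N: prob_space ?N by (rule prob_space_gauss_measure[OF pos_def_mat_1])
  obtain L where L: "det L \<noteq> 0" "R = L ** transpose L" using pos_def_factor[OF R] .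
  define b where "b = \<mu> - a"
  \<comment> \<open>\<open>Q\<close> may be asymmetric, so the linear term collects contributions of
    both \<open>Q\<close> and its transpose.\<close>
  define w where "w = transpose L *v (Q *v b) + transpose L *v (transpose Q *v b)"
  define M where "M = transpose L ** Q ** L"
  have expand: "(\<mu> + L *v u - a) \<bullet> (Q *v (\<mu> + L *v u - a))
      = b \<bullet> (Q *v b) + (\<Sum>i\<in>UNIV. w $ i * u $ i) + (\<Sum>i\<in>UNIV. \<Sum>j\<in>UNIV. M $ i $ j * (u $ i * u $ j))" for u
  proof -
    have "(\<mu> + L *v u - a) \<bullet> (Q *v (\<mu> + L *v u - a)) = (b + L *v u) \<bullet> (Q *v (b + L *v u))"
      by (simp add: b_def algebra_simps)
    also have "\<dots> = b \<bullet> (Q *v b) + ((L *v u) \<bullet> (Q *v b) + b \<bullet> (Q *v (L *v u))) + (L *v u) \<bullet> (Q *v (L *v u))"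
      by (simp add: matrix_vector_right_distrib inner_add_left inner_add_right)
    also have "b \<bullet> (Q *v (L *v u)) = (L *v u) \<bullet> (transpose Q *v b)"
      by (metis inner_commute inner_matrix_vector_left)
    also have "(L *v u) \<bullet> (Q *v b) + (L *v u) \<bullet> (transpose Q *v b) = u \<bullet> w"
      unfolding w_def inner_add_right by (simp only: inner_matrix_vector_left)
    also have "(L *v u) \<bullet> (Q *v (L *v u)) = u \<bullet> (M *v u)"
      unfolding M_def by (simp only: inner_matrix_vector_left matrix_vector_mul_assoc matrix_mul_assoc)
    finally show ?thesis
      by (simp add: inner_vec_def matrix_vector_mult_def sum_distrib_left mult_ac)
  qed
  have int: "integrable ?N (\<lambda>u. (\<mu> + L *v u - a) \<bullet> (Q *v (\<mu> + L *v u - a)))"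
    unfolding expand by (intro Bochner_Integration.integrable_add Bochner_Integration.integrable_sum
        integrable_mult_right std_gauss_moments) auto
  have "(\<integral>u. (\<mu> + L *v u - a) \<bullet> (Q *v (\<mu> + L *v u - a)) \<partial>?N)
      = b \<bullet> (Q *v b) + (\<Sum>i\<in>UNIV. w $ i * 0) + (\<Sum>i\<in>UNIV. \<Sum>j\<in>UNIV. M $ i $ j * of_bool (i = j))"
    unfolding expand
    by (simp add: Bochner_Integration.integral_add Bochner_Integration.integral_sum std_gauss_moments N.prob_space[simplified])
  also have "(\<Sum>i\<in>UNIV. \<Sum>j\<in>UNIV. M $ i $ j * of_bool (i = j)) = trace M"
    by (simp add: trace_def of_bool_def if_distrib cong: if_cong)
  also have "trace M = trace (Q ** R)"
    unfolding M_def L by (metis matrix_mul_assoc trace_mul_sym)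
  finally have eq: "(\<integral>u. (\<mu> + L *v u - a) \<bullet> (Q *v (\<mu> + L *v u - a)) \<partial>?N) = trace (Q ** R) + b \<bullet> (Q *v b)"
    by simp
  have [measurable]: "(\<lambda>x. (x - a) \<bullet> (Q *v (x - a))) \<in> borel_measurable borel"
    by measurable
  show "integrable (gauss_measure \<mu> R) (\<lambda>x. (x - a) \<bullet> (Q *v (x - a)))"
    unfolding gauss_measure_affine[OF L] by (subst integrable_distr_eq) (auto intro: int)
  show "(\<integral>x. (x - a) \<bullet> (Q *v (x - a)) \<partial>gauss_measure \<mu> R) = trace (Q ** R) + (\<mu> - a) \<bullet> (Q *v (\<mu> - a))"
    unfolding gauss_measure_affine[OF L] by (subst integral_distr) (auto simp: eq b_def)
qed

section \<open>Kullback-Leibler divergence between Gaussian densities\<close>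

lemma ln_gauss_density:
  fixes R :: "real^'n^'n"
  assumes "pos_def R"
  shows "ln (gauss_density \<mu> R x) =
    - real CARD('n) / 2 * ln (2 * pi) - 1 / 2 * ln (det R) - 1 / 2 * ((x - \<mu>) \<bullet> (matrix_inv R *v (x - \<mu>)))"
  using pos_def_det_pos[OF assms] by (simp add: gauss_density_def ln_mult ln_powr)

text \<open>The logarithm of the ratio is a constant plus half the difference of two quadratic
  forms. The form belonging to \<open>C\<close> has expectation equal to the dimension; the other
  yields the trace and the mean term. With the updated moments for \<open>\<mu>\<close> and
  \<open>F\<close> the value is exactly \<open>\<Psi>\<close>.\<close>

lemma gauss_density_KL:
  fixes C F :: "real^'n^'n" and m \<mu> :: "real^'n"
  assumes C: "pos_def C" and F: "pos_def F"
  defines "g \<equiv> (\<lambda>x. gauss_density m C x * ln (gauss_density m C x / gauss_density \<mu> F x))"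
  shows "integrable lborel g"
    "(\<integral>x. g x \<partial>lborel) = 1 / 2 * ln (det F) - 1 / 2 * ln (det C) - real CARD('n) / 2
      + 1 / 2 * trace (matrix_inv F ** C) + 1 / 2 * ((m - \<mu>) \<bullet> (matrix_inv F *v (m - \<mu>)))"
proof -
  interpret N: prob_space "gauss_measure m C" by (rule prob_space_gauss_measure[OF C])
  define q where "q x = 1 / 2 * ln (det F) - 1 / 2 * ln (det C)
    - 1 / 2 * ((x - m) \<bullet> (matrix_inv C *v (x - m))) + 1 / 2 * ((x - \<mu>) \<bullet> (matrix_inv F *v (x - \<mu>)))" for x
  have g: "g = (\<lambda>x. gauss_density m C x * q x)"
    unfolding g_def q_def
    using gauss_density_pos[OF C, of m] gauss_density_pos[OF F, of \<mu>]
    by (simp add: fun_eq_iff ln_div less_imp_neq[symmetric] ln_gauss_density C F field_simps)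
  have [measurable]: "q \<in> borel_measurable borel" unfolding q_def by measurable
  have tr: "trace (matrix_inv C ** C) = real CARD('n)"
    by (simp add: matrix_inv_mult pos_def_invertible C trace_I)
  have "integrable (gauss_measure m C) q"
    unfolding q_def by (intro Bochner_Integration.integrable_add Bochner_Integration.integrable_diff
        integrable_mult_right gauss_measure_quadratic C) auto
  then show "integrable lborel g" unfolding g by (simp add: integral_gauss_measure)
  have "(\<integral>x. g x \<partial>lborel) = (\<integral>x. q x \<partial>gauss_measure m C)"
    unfolding g by (simp add: integral_gauss_measure)
  also have "\<dots> = 1 / 2 * ln (det F) - 1 / 2 * ln (det C) - real CARD('n) / 2
      + 1 / 2 * trace (matrix_inv F ** C) + 1 / 2 * ((m - \<mu>) \<bullet> (matrix_inv F *v (m - \<mu>)))"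
    unfolding q_def using gauss_measure_quadratic[OF C, of m]
    by (simp add: N.prob_space[simplified] tr)
  finally show "(\<integral>x. g x \<partial>lborel) = 1 / 2 * ln (det F) - 1 / 2 * ln (det C) - real CARD('n) / 2
      + 1 / 2 * trace (matrix_inv F ** C) + 1 / 2 * ((m - \<mu>) \<bullet> (matrix_inv F *v (m - \<mu>)))" .
qed

section \<open>Gaussian conditioning on a linear observation\<close>

lemma matrix_sub_ldistrib: "A ** (B - C) = A ** B - A ** (C :: real^'n^'m)"
  by (simp add: matrix_matrix_mult_def vec_eq_iff right_diff_distrib sum_subtractf)

lemma matrix_sub_rdistrib: "(A - B) ** C = A ** C - B ** (C :: real^'n^'m)"
  by (simp add: matrix_matrix_mult_def vec_eq_iff left_diff_distrib sum_subtractf)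

lemma matrix_add_rdistrib: "(A + B) ** C = A ** C + B ** (C :: real^'n^'m)"
  by (simp add: matrix_matrix_mult_def vec_eq_iff distrib_right sum.distrib)

text \<open>The candidate \<open>J\<close> is checked by one multiplication. The identity
  \<open>key\<close> behind it is S - G = \<open>H ** C ** transpose H\<close> multiplied by the two
  inverses. Positivity of \<open>Fc\<close> is then free, since \<open>J\<close> is a sum of
  positive forms and \<open>Fc\<close> its inverse.\<close>

lemma woodbury:
  fixes C :: "real^'n^'n" and G :: "real^'r^'r" and H :: "real^'n^'r"
  assumes C: "pos_def C" and G: "pos_def G"
  defines "S \<equiv> H ** C ** transpose H + G"
  defines "Fc \<equiv> C - C ** transpose H ** matrix_inv S ** H ** C"
  shows "matrix_inv Fc = matrix_inv C + transpose H ** matrix_inv G ** H" "pos_def Fc"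
proof -
  define J where "J = matrix_inv C + transpose H ** matrix_inv G ** H"
  have J: "pos_def J"
    using pos_def_congruence_add[OF pos_def_matrix_inv[OF G] pos_def_matrix_inv[OF C], of "transpose H"]
    by (simp add: J_def add.commute)
  have S: "pos_def S" unfolding S_def by (rule pos_def_congruence_add[OF C G])
  note Ci = matrix_inv_mult[OF pos_def_invertible[OF C]]
  note Gi = matrix_inv_mult[OF pos_def_invertible[OF G]]
  note Si = matrix_inv_mult[OF pos_def_invertible[OF S]]
  have "matrix_inv S ** (H ** C ** transpose H) ** matrix_inv G = matrix_inv S ** (S - G) ** matrix_inv G"
    by (simp add: S_def)
  also have "\<dots> = matrix_inv G - matrix_inv S"
    by (simp add: matrix_sub_ldistrib matrix_sub_rdistrib Si flip: matrix_mul_assoc) (simp add: Gi)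
  finally have key: "matrix_inv S ** H ** C ** transpose H ** matrix_inv G = matrix_inv G - matrix_inv S"
    by (simp only: matrix_mul_assoc)
  have "Fc ** J = C ** matrix_inv C + C ** transpose H ** matrix_inv G ** H
      - C ** transpose H ** matrix_inv S ** H ** (C ** matrix_inv C)
      - C ** transpose H ** (matrix_inv S ** H ** C ** transpose H ** matrix_inv G) ** H"
    unfolding Fc_def J_def by (simp add: matrix_sub_rdistrib matrix_add_ldistrib matrix_mul_assoc)
  also have "\<dots> = mat 1"
    unfolding key Ci by (simp add: matrix_sub_ldistrib matrix_sub_rdistrib)
  finally have FJ: "Fc ** J = mat 1" .
  then show "matrix_inv Fc = matrix_inv C + transpose H ** matrix_inv G ** H"
    unfolding J_def[symmetric] by (rule matrix_inv_unique)
  have "J ** Fc = mat 1" using FJ by (metis matrix_left_right_inverse)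
  then have "matrix_inv J = Fc" by (rule matrix_inv_unique)
  then show "pos_def Fc" using pos_def_matrix_inv[OF J] by simp
qed

text \<open>The two sides are positive multiples of the same exponential, and both integrate to one
  over the product space; this yields the identity of the determinants for free.\<close>

lemma gauss_density_update:
  fixes C :: "real^'n^'n" and G :: "real^'r^'r" and H :: "real^'n^'r" and m :: "real^'n"
  assumes C: "pos_def C" and G: "pos_def G"
  defines "S \<equiv> H ** C ** transpose H + G"
  defines "Fc \<equiv> C - C ** transpose H ** matrix_inv S ** H ** C"
  defines "Fm \<equiv> \<lambda>y. m + (C ** transpose H ** matrix_inv S) *v (y - H *v m)"
  shows "gauss_density (H *v x) G y * gauss_density m C x
    = gauss_density (H *v m) S y * gauss_density (Fm y) Fc x"
proof -
  define J where "J = matrix_inv C + transpose H ** matrix_inv G ** H"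
  have S: "pos_def S" unfolding S_def by (rule pos_def_congruence_add[OF C G])
  have Fc: "pos_def Fc" "matrix_inv Fc = J"
    using woodbury[OF C G, of H] by (simp_all add: Fc_def S_def J_def)
  note Ci = matrix_inv_mult[OF pos_def_invertible[OF C]]
  note Gi = matrix_inv_mult[OF pos_def_invertible[OF G]]
  note Si = matrix_inv_mult[OF pos_def_invertible[OF S]]
  note symC = symmetric_matrix_inv[OF pos_def_symmetric[OF C] pos_def_invertible[OF C]]
  note symG = symmetric_matrix_inv[OF pos_def_symmetric[OF G] pos_def_invertible[OF G]]
  \<comment> \<open>The Kalman gain. Of its two identities, \<open>JK\<close> identifies the cross
    term when the square is completed in the state, and \<open>HK\<close> reduces what remains to
    the inverse of \<open>S\<close>.\<close>
  define K where "K = C ** transpose H ** matrix_inv S"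
  have HK: "H ** K = mat 1 - G ** matrix_inv S"
  proof -
    have "H ** K = (S - G) ** matrix_inv S" by (simp add: K_def S_def matrix_mul_assoc)
    then show ?thesis by (simp add: matrix_sub_rdistrib Si)
  qed
  have JK: "J ** K = transpose H ** matrix_inv G"
  proof -
    have "J ** K = (matrix_inv C ** C) ** transpose H ** matrix_inv S
        + transpose H ** matrix_inv G ** (H ** K)"
      by (simp add: J_def K_def matrix_add_rdistrib matrix_mul_assoc)
    also have "transpose H ** matrix_inv G ** (H ** K)
        = transpose H ** matrix_inv G - transpose H ** (matrix_inv G ** G) ** matrix_inv S"
      unfolding HK by (simp add: matrix_sub_ldistrib matrix_mul_assoc)
    finally show ?thesis by (simp add: Ci Gi)
  qed
  have quad: "(y - H *v x) \<bullet> (matrix_inv G *v (y - H *v x)) + (x - m) \<bullet> (matrix_inv C *v (x - m))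
      = (y - H *v m) \<bullet> (matrix_inv S *v (y - H *v m)) + (x - Fm y) \<bullet> (matrix_inv Fc *v (x - Fm y))" for x y
  proof -
    define e where "e = x - m"
    define d where "d = y - H *v m"
    have 1: "y - H *v x = d - H *v e" by (simp add: d_def e_def matrix_vector_mult_diff_distrib)
    have 2: "x - Fm y = e - K *v d" by (simp add: d_def e_def Fm_def K_def)
    have symJ: "a \<bullet> (J *v b) = b \<bullet> (J *v a)" for a b
      using pos_def_symmetric[OF pos_def_matrix_inv[OF Fc(1)]] by (intro inner_symmetric_matrix) (simp add: Fc)
    have a1: "e \<bullet> (J *v e) = e \<bullet> (matrix_inv C *v e) + (H *v e) \<bullet> (matrix_inv G *v (H *v e))"
      unfolding J_def matrix_vector_mult_add_rdistrib inner_add_right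
      by (simp only: inner_matrix_vector_left matrix_vector_mul_assoc matrix_mul_assoc)
    have a2: "a \<bullet> (J *v (K *v d)) = (H *v a) \<bullet> (matrix_inv G *v d)" for a
      by (simp only: inner_matrix_vector_left matrix_vector_mul_assoc JK)
    have a3: "H *v (K *v d) = d - G *v (matrix_inv S *v d)"
      by (simp add: matrix_vector_mul_assoc HK matrix_vector_mult_diff_rdistrib)
    have a4: "(G *v z) \<bullet> (matrix_inv G *v d) = z \<bullet> d" for z
      unfolding inner_matrix_vector_left[of G] pos_def_symmetric[OF G]
      by (simp add: matrix_vector_mul_assoc Gi)
    have "(e - K *v d) \<bullet> (J *v (e - K *v d)) = e \<bullet> (J *v e) - 2 * (e \<bullet> (J *v (K *v d))) + (K *v d) \<bullet> (J *v (K *v d))"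
      using symJ[of "K *v d" e] by (simp add: matrix_vector_mult_diff_distrib inner_diff_left inner_diff_right)
    also have "\<dots> = e \<bullet> (matrix_inv C *v e) + (H *v e) \<bullet> (matrix_inv G *v (H *v e))
        - 2 * ((H *v e) \<bullet> (matrix_inv G *v d)) + d \<bullet> (matrix_inv G *v d) - d \<bullet> (matrix_inv S *v d)"
      unfolding a1 a2 a3 inner_diff_left a4 by (simp add: inner_commute)
    finally have r: "(e - K *v d) \<bullet> (J *v (e - K *v d)) = \<dots>" .
    have "(d - H *v e) \<bullet> (matrix_inv G *v (d - H *v e))
        = d \<bullet> (matrix_inv G *v d) - 2 * ((H *v e) \<bullet> (matrix_inv G *v d)) + (H *v e) \<bullet> (matrix_inv G *v (H *v e))"
      using inner_symmetric_matrix[OF symG, of d "H *v e"]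
      by (simp add: matrix_vector_mult_diff_distrib inner_diff_left inner_diff_right)
    then show ?thesis unfolding 1 2 Fc r by (simp add: d_def e_def)
  qed
  define E where "E x y = exp (- ((y - H *v x) \<bullet> (matrix_inv G *v (y - H *v x)) + (x - m) \<bullet> (matrix_inv C *v (x - m))) / 2)" for x y
  define a where "a = (2 * pi) powr (- real CARD('r) / 2) * det G powr (- 1 / 2) * ((2 * pi) powr (- real CARD('n) / 2) * det C powr (- 1 / 2))"
  define b where "b = (2 * pi) powr (- real CARD('r) / 2) * det S powr (- 1 / 2) * ((2 * pi) powr (- real CARD('n) / 2) * det Fc powr (- 1 / 2))"
  have half: "exp (- (p + q) / 2) = exp (- p / 2) * exp (- q / 2)" for p q :: real
    by (subst exp_add[symmetric]) (simp add: field_simps)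
  have lhs: "gauss_density (H *v x) G y * gauss_density m C x = a * E x y" for x y
    unfolding gauss_density_def a_def E_def half by (simp only: mult_ac)
  have rhs: "gauss_density (H *v m) S y * gauss_density (Fm y) Fc x = b * E x y" for x y
    unfolding E_def quad gauss_density_def b_def half by (simp only: mult_ac)
  have pos: "0 < a" "0 < b"
    using pos_def_det_pos[OF C] pos_def_det_pos[OF G] pos_def_det_pos[OF S] pos_def_det_pos[OF Fc(1)]
    by (auto simp: a_def b_def)
  have E0: "0 \<le> E x y" for x y by (simp add: E_def)
  have [measurable]: "(\<lambda>(x, y). E x y) \<in> borel_measurable (lborel \<Otimes>\<^sub>M lborel)"
    unfolding E_def split_beta' by measurable
  \<comment> \<open>On this side the observation integrates out first, on the other side the state
    does; Tonelli equates the two double integrals of \<open>E\<close>.\<close>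
  have "ennreal a * (\<integral>\<^sup>+x. \<integral>\<^sup>+y. ennreal (E x y) \<partial>lborel \<partial>lborel)
      = (\<integral>\<^sup>+x. \<integral>\<^sup>+y. ennreal (gauss_density (H *v x) G y * gauss_density m C x) \<partial>lborel \<partial>lborel)"
    unfolding lhs using pos E0 by (simp add: ennreal_mult nn_integral_cmult)
  also have "\<dots> = 1"
    by (simp add: ennreal_mult gauss_density_nonneg nn_integral_multc nn_integral_gauss_density G C)
  finally have 1: "ennreal a * (\<integral>\<^sup>+x. \<integral>\<^sup>+y. ennreal (E x y) \<partial>lborel \<partial>lborel) = 1" .
  have "ennreal b * (\<integral>\<^sup>+y. \<integral>\<^sup>+x. ennreal (E x y) \<partial>lborel \<partial>lborel)
      = (\<integral>\<^sup>+y. \<integral>\<^sup>+x. ennreal (gauss_density (H *v m) S y * gauss_density (Fm y) Fc x) \<partial>lborel \<partial>lborel)"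
    unfolding rhs using pos E0 by (simp add: ennreal_mult nn_integral_cmult)
  also have "\<dots> = 1"
    by (simp add: ennreal_mult gauss_density_nonneg nn_integral_cmult nn_integral_gauss_density Fc S)
  finally have 2: "ennreal b * (\<integral>\<^sup>+x. \<integral>\<^sup>+y. ennreal (E x y) \<partial>lborel \<partial>lborel) = 1"
    by (subst lborel_pair.Fubini') auto
  have "ennreal a = ennreal b"
  proof -
    let ?I = "\<integral>\<^sup>+x. \<integral>\<^sup>+y. ennreal (E x y) \<partial>lborel \<partial>lborel"
    have "ennreal a = ennreal a * (ennreal b * ?I)" by (simp add: 2)
    also have "\<dots> = ennreal b * (ennreal a * ?I)" by (simp add: mult_ac)
    finally show ?thesis by (simp add: 1)
  qed
  then have "a = b" using pos by simp
  then show ?thesis unfolding lhs rhs by simp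
qed

text \<open>After \<open>gauss_density_update\<close> only one factor depends on the state, and it
  has mass one. With the transition matrix in place of \<open>H\<close> this is the prediction step,
  with the observation matrix it is the evidence.\<close>

lemma gauss_density_predict:
  fixes C :: "real^'n^'n" and G :: "real^'r^'r" and H :: "real^'n^'r"
  assumes C: "pos_def C" and G: "pos_def G"
  shows "(\<integral>x. gauss_density (H *v x) G y * gauss_density m C x \<partial>lborel)
      = gauss_density (H *v m) (H ** C ** transpose H + G) y"
    "integrable lborel (\<lambda>x. gauss_density (H *v x) G y * gauss_density m C x)"
  unfolding gauss_density_update[OF C G]
  using gauss_density_integral[OF woodbury(2)[OF C G, of H]] by simp_all

section \<open>Distances between densities\<close>

lemma Cauchy_Schwarz_integral:
  fixes u v :: "'a \<Rightarrow> real"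
  assumes [measurable]: "u \<in> borel_measurable M" "v \<in> borel_measurable M"
    and u: "integrable M (\<lambda>x. (u x)\<^sup>2)" and v: "integrable M (\<lambda>x. (v x)\<^sup>2)"
  shows "integrable M (\<lambda>x. u x * v x)"
    "(\<integral>x. u x * v x \<partial>M) \<le> sqrt (\<integral>x. (u x)\<^sup>2 \<partial>M) * sqrt (\<integral>x. (v x)\<^sup>2 \<partial>M)"
proof -
  let ?a = "\<integral>x. (u x)\<^sup>2 \<partial>M" and ?b = "\<integral>x. (v x)\<^sup>2 \<partial>M"
  have "(\<integral>\<^sup>+x. ennreal \<bar>u x\<bar> * ennreal \<bar>v x\<bar> \<partial>M)\<^sup>2
      \<le> (\<integral>\<^sup>+x. ennreal \<bar>u x\<bar> ^ 2 \<partial>M) * (\<integral>\<^sup>+x. ennreal \<bar>v x\<bar> ^ 2 \<partial>M)"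
    by (intro Cauchy_Schwarz_nn_integral) auto
  also have "(\<integral>\<^sup>+x. ennreal \<bar>u x\<bar> ^ 2 \<partial>M) = ennreal ?a"
    using u by (simp add: ennreal_power nn_integral_eq_integral)
  also have "(\<integral>\<^sup>+x. ennreal \<bar>v x\<bar> ^ 2 \<partial>M) = ennreal ?b"
    using v by (simp add: ennreal_power nn_integral_eq_integral)
  also have "ennreal ?a * ennreal ?b = ennreal ((sqrt ?a * sqrt ?b)\<^sup>2)"
    by (simp add: ennreal_mult power_mult_distrib)
  also have "\<dots> = (ennreal (sqrt ?a * sqrt ?b))\<^sup>2"
    by (subst ennreal_power) auto
  finally have sq: "(\<integral>\<^sup>+x. ennreal (norm (u x * v x)) \<partial>M)\<^sup>2 \<le> (ennreal (sqrt ?a * sqrt ?b))\<^sup>2"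
    by (simp add: abs_mult ennreal_mult)
  have "(\<integral>\<^sup>+x. ennreal (norm (u x * v x)) \<partial>M) \<le> ennreal (sqrt ?a * sqrt ?b)"
  proof (cases "\<integral>\<^sup>+x. ennreal (norm (u x * v x)) \<partial>M")
    case (real r)
    have "0 \<le> sqrt ?a * sqrt ?b" by simp
    with real show ?thesis
      using sq by (simp only: ennreal_power ennreal_le_iff zero_le_power2) (auto intro: power2_le_imp_le)
  next
    case top
    have "(ennreal (sqrt ?a * sqrt ?b))\<^sup>2 < top"
      by (simp add: power_less_top_ennreal)
    with top sq show ?thesis by (simp add: top_unique)
  qed
  then show int: "integrable M (\<lambda>x. u x * v x)"
    by (intro integrableI_bounded) (auto intro: le_less_trans)
  have "ennreal (\<integral>x. \<bar>u x * v x\<bar> \<partial>M) \<le> ennreal (sqrt ?a * sqrt ?b)"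
    using int \<open>_ \<le> ennreal (sqrt ?a * sqrt ?b)\<close>
    by (subst nn_integral_eq_integral[symmetric]) (auto intro: integrable_abs)
  then have "(\<integral>x. \<bar>u x * v x\<bar> \<partial>M) \<le> sqrt ?a * sqrt ?b"
    by (simp add: ennreal_le_iff)
  moreover have "(\<integral>x. u x * v x \<partial>M) \<le> (\<integral>x. \<bar>u x * v x\<bar> \<partial>M)"
    using int by (intro integral_mono integrable_abs) auto
  ultimately show "(\<integral>x. u x * v x \<partial>M) \<le> sqrt ?a * sqrt ?b" by simp
qed

lemma Minkowski_integral:
  fixes u v :: "'a \<Rightarrow> real"
  assumes [measurable]: "u \<in> borel_measurable M" "v \<in> borel_measurable M"
    and u: "integrable M (\<lambda>x. (u x)\<^sup>2)" and v: "integrable M (\<lambda>x. (v x)\<^sup>2)"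
  shows "sqrt (\<integral>x. (u x + v x)\<^sup>2 \<partial>M) \<le> sqrt (\<integral>x. (u x)\<^sup>2 \<partial>M) + sqrt (\<integral>x. (v x)\<^sup>2 \<partial>M)"
proof -
  note CS = Cauchy_Schwarz_integral[OF assms]
  have "(\<integral>x. (u x + v x)\<^sup>2 \<partial>M) = (\<integral>x. (u x)\<^sup>2 \<partial>M) + (\<integral>x. (v x)\<^sup>2 \<partial>M) + 2 * (\<integral>x. u x * v x \<partial>M)"
    using u v CS(1) by (simp add: power2_sum mult.assoc)
  also have "\<dots> \<le> (sqrt (\<integral>x. (u x)\<^sup>2 \<partial>M) + sqrt (\<integral>x. (v x)\<^sup>2 \<partial>M))\<^sup>2"
    using CS(2) by (simp add: power2_sum)
  finally show ?thesis by (rule real_le_lsqrt[rotated]) auto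
qed

text \<open>The cross term is the Bhattacharyya affinity. Total masses are kept general because the
  formula is also applied to functions weighted by a likelihood and to slices at a fixed
  parameter.\<close>

lemma sqrt_affinity:
  fixes p q :: "'a \<Rightarrow> real"
  assumes p: "integrable M p" and q: "integrable M q" and nn: "\<And>x. 0 \<le> p x" "\<And>x. 0 \<le> q x"
  shows "integrable M (\<lambda>x. sqrt (p x) * sqrt (q x))"
    "(\<integral>x. sqrt (p x) * sqrt (q x) \<partial>M) \<le> sqrt (\<integral>x. p x \<partial>M) * sqrt (\<integral>x. q x \<partial>M)"
    "integrable M (\<lambda>x. (sqrt (p x) - sqrt (q x))\<^sup>2)"
    "(\<integral>x. (sqrt (p x) - sqrt (q x))\<^sup>2 \<partial>M) =
      (\<integral>x. p x \<partial>M) + (\<integral>x. q x \<partial>M) - 2 * (\<integral>x. sqrt (p x) * sqrt (q x) \<partial>M)"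
proof -
  have [measurable]: "p \<in> borel_measurable M" "q \<in> borel_measurable M" using p q by auto
  show 1: "integrable M (\<lambda>x. sqrt (p x) * sqrt (q x))"
    "(\<integral>x. sqrt (p x) * sqrt (q x) \<partial>M) \<le> sqrt (\<integral>x. p x \<partial>M) * sqrt (\<integral>x. q x \<partial>M)"
    using Cauchy_Schwarz_integral[of "\<lambda>x. sqrt (p x)" M "\<lambda>x. sqrt (q x)"] p q nn by auto
  have *: "(sqrt (p x) - sqrt (q x))\<^sup>2 = p x + q x - 2 * (sqrt (p x) * sqrt (q x))" for x
    using nn[of x] by (simp add: power2_diff)
  show "integrable M (\<lambda>x. (sqrt (p x) - sqrt (q x))\<^sup>2)"
    unfolding * using p q 1(1) by (intro Bochner_Integration.integrable_diff Bochner_Integration.integrable_add integrable_mult_right)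
  show "(\<integral>x. (sqrt (p x) - sqrt (q x))\<^sup>2 \<partial>M) =
      (\<integral>x. p x \<partial>M) + (\<integral>x. q x \<partial>M) - 2 * (\<integral>x. sqrt (p x) * sqrt (q x) \<partial>M)"
    unfolding * using p q 1(1) by simp
qed

text \<open>The reverse triangle inequality for the square roots in the space of square-integrable
  functions. Applied slice by slice it is the reason that averaging contracts the Hellinger
  distance.\<close>

lemma sqrt_integral_diff_le:
  fixes p q :: "'a \<Rightarrow> real"
  assumes "integrable M p" "integrable M q" "\<And>x. 0 \<le> p x" "\<And>x. 0 \<le> q x"
  shows "(sqrt (\<integral>x. p x \<partial>M) - sqrt (\<integral>x. q x \<partial>M))\<^sup>2 \<le> (\<integral>x. (sqrt (p x) - sqrt (q x))\<^sup>2 \<partial>M)"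
  using sqrt_affinity[OF assms] assms by (simp add: power2_diff)

section \<open>Basic properties of the two distances\<close>

lemma prob_density_integrable:
  assumes "prob_density f"
  shows "integrable lborel f" "(\<integral>x. f x \<partial>lborel) = 1"
  using assms
  by (auto simp: prob_density_def integrable_iff_bounded integral_eq_nn_integral)

lemma prob_densityD:
  assumes "prob_density f"
  shows "f \<in> borel_measurable borel" "0 \<le> f x" "(\<integral>\<^sup>+ x. ennreal (f x) \<partial>lborel) = 1"
  using assms by (auto simp: prob_density_def)

lemma prob_densityI:
  assumes "integrable lborel f" "\<And>x. 0 \<le> f x" "(\<integral>x. f x \<partial>lborel) = 1"
  shows "prob_density f"
  using assms borel_measurable_integrable[OF assms(1)]
  by (simp add: prob_density_def nn_integral_eq_integral)

lemma tv_dist_triangle: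
  assumes "integrable lborel f" "integrable lborel g" "integrable lborel h"
  shows "tv_dist f h \<le> tv_dist f g + tv_dist g h"
proof -
  have "(\<integral>x. \<bar>f x - h x\<bar> \<partial>lborel) \<le> (\<integral>x. \<bar>f x - g x\<bar> + \<bar>g x - h x\<bar> \<partial>lborel)"
    using assms by (intro integral_mono) auto
  then show ?thesis using assms by (simp add: tv_dist_def field_simps)
qed

lemma hellinger_dist_triangle:
  assumes "prob_density f" "prob_density g" "prob_density h"
  shows "hellinger_dist f h \<le> hellinger_dist f g + hellinger_dist g h"
proof -
  note [measurable] = assms[THEN prob_densityD(1)]
  have "sqrt (\<integral>x. ((sqrt (f x) - sqrt (g x)) + (sqrt (g x) - sqrt (h x)))\<^sup>2 \<partial>lborel)
      \<le> sqrt (\<integral>x. (sqrt (f x) - sqrt (g x))\<^sup>2 \<partial>lborel) + sqrt (\<integral>x. (sqrt (g x) - sqrt (h x))\<^sup>2 \<partial>lborel)"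
    using assms by (intro Minkowski_integral sqrt_affinity prob_density_integrable prob_densityD) auto
  then show ?thesis
    by (simp add: hellinger_dist_def real_sqrt_divide divide_right_mono flip: add_divide_distrib)
qed

lemma tv_dist_cong_AE:
  assumes "AE x in lborel. f x = f' x"
    and "f \<in> borel_measurable borel" "f' \<in> borel_measurable borel" "g \<in> borel_measurable borel"
  shows "tv_dist f g = tv_dist f' g"
  unfolding tv_dist_def using assms by (intro arg_cong2[where f="(*)"] integral_cong_AE) auto

lemma hellinger_dist_cong_AE:
  assumes "AE x in lborel. f x = f' x"
    and "f \<in> borel_measurable borel" "f' \<in> borel_measurable borel" "g \<in> borel_measurable borel"
  shows "hellinger_dist f g = hellinger_dist f' g"
  unfolding hellinger_dist_def using assms
  by (intro arg_cong[where f=sqrt] arg_cong2[where f="(*)"] integral_cong_AE) auto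

text \<open>Since both densities have mass one, the positive and the negative part of the difference
  carry the same mass.\<close>

lemma tv_dist_pos_part:
  assumes f: "prob_density f" and g: "prob_density g"
  shows "tv_dist f g = (\<integral>x. max 0 (f x - g x) \<partial>lborel)" "tv_dist f g = (\<integral>x. max 0 (g x - f x) \<partial>lborel)"
proof -
  note i = prob_density_integrable[OF f] prob_density_integrable[OF g]
  have int: "integrable lborel (\<lambda>x. max 0 (f x - g x))" "integrable lborel (\<lambda>x. max 0 (g x - f x))"
    using i by (auto intro!: integrable_max)
  have "(\<integral>x. max 0 (f x - g x) - max 0 (g x - f x) \<partial>lborel) = (\<integral>x. f x - g x \<partial>lborel)"
    by (intro Bochner_Integration.integral_cong) auto
  then have 1: "(\<integral>x. max 0 (f x - g x) \<partial>lborel) = (\<integral>x. max 0 (g x - f x) \<partial>lborel)"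
    using int i by simp
  have "(\<integral>x. \<bar>f x - g x\<bar> \<partial>lborel) = (\<integral>x. max 0 (f x - g x) + max 0 (g x - f x) \<partial>lborel)"
    by (intro Bochner_Integration.integral_cong) auto
  then show "tv_dist f g = (\<integral>x. max 0 (f x - g x) \<partial>lborel)" "tv_dist f g = (\<integral>x. max 0 (g x - f x) \<partial>lborel)"
    using int 1 by (auto simp: tv_dist_def)
qed

section \<open>Pinsker's inequality and its Hellinger analogue\<close>

lemma ln_ge_rational:
  fixes t :: real
  assumes "0 < t"
  shows "0 \<le> (t - 1) * ((t + 1) * ln t - 2 * (t - 1))"
proof -
  let ?p = "\<lambda>t::real. (t + 1) * ln t - 2 * (t - 1)"
  have d: "(?p has_real_derivative (ln x + 1 / x - 1)) (at x)" if "0 < x" for x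
    using that by (auto intro!: derivative_eq_intros simp: field_simps)
  have nn: "0 \<le> ln x + 1 / x - 1" if "0 < x" for x :: real
    using ln_le_minus_one[of "1 / x"] that by (simp add: ln_div)
  \<comment> \<open>Since \<open>?p\<close> increases and vanishes at 1, it has the sign of
    \<open>t - 1\<close>; the product form of the claim treats both sides of 1 at once.\<close>
  have mono: "?p a \<le> ?p b" if "0 < a" "a \<le> b" for a b :: real
    using that d nn by (intro DERIV_nonneg_imp_nondecreasing[OF \<open>a \<le> b\<close>]) (meson less_le_trans)
  show ?thesis
    using mono[of 1 t] mono[of t 1] assms by (cases "1 \<le> t") (auto intro: mult_nonneg_nonneg mult_nonpos_nonpos)
qed

text \<open>The classical pointwise inequality behind Pinsker's theorem: the difference of the two
  sides vanishes at 1, and its derivative \<open>?d\<close> changes sign only there, from negative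
  to positive.\<close>

lemma pinsker_pointwise_aux:
  fixes t :: real
  assumes "0 < t"
  shows "3 * (t - 1)\<^sup>2 \<le> (2 * t + 4) * (t * ln t - t + 1)"
proof -
  let ?p = "\<lambda>t::real. (2 * t + 4) * (t * ln t - t + 1) - 3 * (t - 1)\<^sup>2"
  let ?d = "\<lambda>t::real. 4 * ((t + 1) * ln t - 2 * (t - 1))"
  have d: "(?p has_real_derivative ?d x) (at x)" if "0 < x" for x
    using that by (auto intro!: derivative_eq_intros simp: field_simps power2_eq_square)
  have "?p 1 \<le> ?p t"
  proof (cases "1 \<le> t")
    case True
    \<comment> \<open>The product inequality of \<open>ln_ge_rational\<close> carries no sign
      information at the point 1, where instead the derivative is 0 by evaluation.\<close>
    have "\<exists>y. (?p has_real_derivative y) (at x) \<and> 0 \<le> y" if "1 \<le> x" for x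
      using d[of x] ln_ge_rational[of x] that
      by (intro exI[of _ "?d x"]) (cases "x = 1", auto simp: zero_le_mult_iff)
    then show ?thesis by (intro DERIV_nonneg_imp_nondecreasing[OF True]) auto
  next
    case False
    have "\<exists>y. (?p has_real_derivative y) (at x) \<and> y \<le> 0" if "t \<le> x" "x \<le> 1" for x
      using d[of x] ln_ge_rational[of x] that assms
      by (intro exI[of _ "?d x"]) (cases "x = 1", auto simp: zero_le_mult_iff)
    then show ?thesis using False by (intro DERIV_nonpos_imp_nonincreasing[of t 1]) auto
  qed
  then show ?thesis by simp
qed

text \<open>The Bregman divergence of x ln x. The two mass terms cancel on integrating probability
  densities and make the integrand nonnegative. For \<open>b = 0 < a\<close> the convention
  \<open>ln 0 = 0\<close> yields the meaningless value \<open>- a\<close>, whence the side condition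
  in the facts below.\<close>

definition KL_term :: "real \<Rightarrow> real \<Rightarrow> real" where
  "KL_term a b = a * ln (a / b) - a + b"

text \<open>This is \<open>ln x \<le> x - 1\<close> at x = sqrt (b / a), multiplied by
  \<open>2 * a\<close>.\<close>

lemma sqrt_diff_le_KL_term:
  assumes "0 \<le> a" "0 \<le> b" "b = 0 \<longrightarrow> a = 0"
  shows "(sqrt a - sqrt b)\<^sup>2 \<le> KL_term a b"
proof (cases "a = 0")
  case True
  then show ?thesis using assms by (simp add: KL_term_def)
next
  case False
  then have ab: "0 < a" "0 < b" using assms by auto
  have "ln (sqrt (b / a)) \<le> sqrt (b / a) - 1"
    using ab by (intro ln_le_minus_one) auto
  then have "2 * (1 - sqrt (b / a)) \<le> ln (a / b)"
    using ab by (simp add: ln_sqrt ln_div)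
  then have "a * (2 * (1 - sqrt (b / a))) \<le> a * ln (a / b)"
    using ab by (intro mult_left_mono) auto
  moreover have "a * sqrt (b / a) = sqrt a * sqrt b"
    using ab by (simp add: real_sqrt_divide field_simps flip: real_sqrt_mult) (metis abs_of_pos real_sqrt_abs2 real_sqrt_mult mult.assoc)
  ultimately show ?thesis
    using ab by (simp add: KL_term_def power2_diff algebra_simps)
qed

lemma KL_term_nonneg:
  assumes "0 \<le> a" "0 \<le> b" "b = 0 \<longrightarrow> a = 0"
  shows "0 \<le> KL_term a b"
  by (rule order_trans[OF zero_le_power2 sqrt_diff_le_KL_term[OF assms]])

text \<open>Scaling \<open>pinsker_pointwise_aux\<close> at \<open>a / b\<close> by the square of
  \<open>b\<close> bounds the squared difference by a product of \<open>w\<close> and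
  \<open>KL_term a b\<close>. The arithmetic-geometric mean inequality with weight \<open>s\<close>
  makes this a sum, which integrates term by term; the factor next to \<open>s\<close> has integral
  one for probability densities, and \<open>s\<close> is left to be optimised afterwards.\<close>

lemma abs_diff_le_KL_term:
  assumes "0 \<le> a" "0 \<le> b" "b = 0 \<longrightarrow> a = 0" "0 < s"
  shows "\<bar>a - b\<bar> \<le> s * ((a + 2 * b) / 3) + KL_term a b / (2 * s)"
proof -
  define w where "w = (2 * a + 4 * b) / 3"
  have K: "0 \<le> KL_term a b" using assms by (intro KL_term_nonneg)
  have "(a - b)\<^sup>2 \<le> w * KL_term a b"
  proof (cases "a = 0")
    case True
    then show ?thesis by (simp add: w_def KL_term_def power2_eq_square mult_nonneg_nonneg assms)
  next
    case False
    then have ab: "0 < a" "0 < b" using assms by auto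
    have "b\<^sup>2 * (3 * (a / b - 1)\<^sup>2) \<le> b\<^sup>2 * ((2 * (a / b) + 4) * (a / b * ln (a / b) - a / b + 1))"
      using ab by (intro mult_left_mono pinsker_pointwise_aux) auto
    also have "\<dots> = (b * (2 * (a / b) + 4)) * (b * (a / b * ln (a / b) - a / b + 1))"
      by (simp add: power2_eq_square)
    also have "b * (2 * (a / b) + 4) = 3 * w" using ab by (simp add: w_def field_simps)
    also have "b * (a / b * ln (a / b) - a / b + 1) = KL_term a b"
      using ab by (simp add: KL_term_def algebra_simps)
    also have "b\<^sup>2 * (3 * (a / b - 1)\<^sup>2) = 3 * (a - b)\<^sup>2"
      using ab by (simp add: field_simps power2_eq_square)
    finally show ?thesis by simp
  qed
  also have "4 * (w * KL_term a b) \<le> (s * w + KL_term a b / s)\<^sup>2"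
  proof -
    have "(s * w + KL_term a b / s)\<^sup>2 - 4 * (w * KL_term a b) = (s * w - KL_term a b / s)\<^sup>2"
      using assms by (simp add: power2_sum power2_diff)
    then show ?thesis using zero_le_power2[of "s * w - KL_term a b / s"] by linarith
  qed
  finally have "(2 * \<bar>a - b\<bar>)\<^sup>2 \<le> (s * w + KL_term a b / s)\<^sup>2" by simp
  then have "2 * \<bar>a - b\<bar> \<le> s * w + KL_term a b / s"
    by (rule power2_le_imp_le) (use assms K in \<open>auto simp: w_def\<close>)
  then show ?thesis using assms by (simp add: w_def field_simps)
qed

text \<open>The divergence is bounded as a nonnegative integral, so the hypothesis itself contains
  integrability of the integrand.\<close>

lemma distances_le_sqrt_KL:
  assumes f: "prob_density f" and g: "prob_density g"
    and ac: "AE x in lborel. g x = 0 \<longrightarrow> f x = 0"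
    and K: "(\<integral>\<^sup>+x. ennreal (KL_term (f x) (g x)) \<partial>lborel) \<le> ennreal K" "0 \<le> K"
  shows "tv_dist f g \<le> 1 / sqrt 2 * sqrt K" "hellinger_dist f g \<le> 1 / sqrt 2 * sqrt K"
proof -
  note [measurable] = prob_densityD(1)[OF f] prob_densityD(1)[OF g]
  note fi = prob_density_integrable[OF f] and gi = prob_density_integrable[OF g]
  note nn = prob_densityD(2)[OF f] prob_densityD(2)[OF g]
  have [measurable]: "(\<lambda>x. KL_term (f x) (g x)) \<in> borel_measurable lborel"
    unfolding KL_term_def by measurable
  have hnn: "AE x in lborel. 0 \<le> KL_term (f x) (g x)"
    using ac by eventually_elim (auto intro!: KL_term_nonneg nn)
  have hi: "integrable lborel (\<lambda>x. KL_term (f x) (g x))"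
  proof (rule integrableI_nn_integral_finite[where x="enn2real (\<integral>\<^sup>+x. ennreal (KL_term (f x) (g x)) \<partial>lborel)"])
    have "(\<integral>\<^sup>+x. ennreal (KL_term (f x) (g x)) \<partial>lborel) < \<top>" using K(1) by (rule le_less_trans) simp
    then show "(\<integral>\<^sup>+x. ennreal (KL_term (f x) (g x)) \<partial>lborel) = ennreal (enn2real (\<integral>\<^sup>+x. ennreal (KL_term (f x) (g x)) \<partial>lborel))"
      by simp
  qed (auto intro: hnn)
  have hK: "(\<integral>x. KL_term (f x) (g x) \<partial>lborel) \<le> K"
    using K hi hnn by (simp add: nn_integral_eq_integral)
  have "(\<integral>x. (sqrt (f x) - sqrt (g x))\<^sup>2 \<partial>lborel) \<le> (\<integral>x. KL_term (f x) (g x) \<partial>lborel)"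
    using ac by (intro integral_mono_AE sqrt_affinity fi gi nn hi) (auto intro: sqrt_diff_le_KL_term nn)
  with hK have "(\<integral>x. (sqrt (f x) - sqrt (g x))\<^sup>2 \<partial>lborel) \<le> K" by linarith
  then have "hellinger_dist f g \<le> sqrt (1 / 2 * K)"
    unfolding hellinger_dist_def by (intro real_sqrt_le_mono) simp
  then show "hellinger_dist f g \<le> 1 / sqrt 2 * sqrt K"
    by (simp add: real_sqrt_mult real_sqrt_divide)
  have tv: "tv_dist f g \<le> s / 2 + K / (4 * s)" if s: "0 < s" for s
  proof -
    have "(\<integral>x. \<bar>f x - g x\<bar> \<partial>lborel) \<le> (\<integral>x. s * ((f x + 2 * g x) / 3) + KL_term (f x) (g x) / (2 * s) \<partial>lborel)"
    proof (rule integral_mono_AE)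
      show "AE x in lborel. \<bar>f x - g x\<bar> \<le> s * ((f x + 2 * g x) / 3) + KL_term (f x) (g x) / (2 * s)"
        using ac by eventually_elim (intro abs_diff_le_KL_term nn s)
    qed (use fi gi hi in \<open>auto simp del: times_divide_eq_right\<close>)
    also have "\<dots> = s + (\<integral>x. KL_term (f x) (g x) \<partial>lborel) / (2 * s)"
      using fi gi hi by simp
    also have "\<dots> \<le> s + K / (2 * s)"
      using hK s by (intro add_left_mono divide_right_mono) auto
    finally show ?thesis by (simp add: tv_dist_def field_simps)
  qed
  show "tv_dist f g \<le> 1 / sqrt 2 * sqrt K"
  \<comment> \<open>The right side of \<open>tv\<close> is smallest at s = sqrt (K / 2); for
    \<open>K = 0\<close> this choice is not admissible and \<open>s\<close> tends to 0
    instead.\<close>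
  proof (cases "K = 0")
    case True
    have "tv_dist f g \<le> 0"
    proof (rule field_le_epsilon)
      fix e :: real assume "0 < e"
      then show "tv_dist f g \<le> 0 + e" using tv[of "2 * e"] True by simp
    qed
    then show ?thesis using True by simp
  next
    case False
    then have pos: "0 < sqrt (K / 2)" using K by simp
    have "K / (4 * sqrt (K / 2)) = sqrt (K / 2) / 2"
      using pos K by (simp add: field_simps flip: power2_eq_square)
    then have "tv_dist f g \<le> sqrt (K / 2)" using tv[OF pos] by simp
    then show ?thesis by (simp add: real_sqrt_divide)
  qed
qed

section \<open>Stability of prediction and Bayesian update\<close>

text \<open>\<open>P \<theta> x' x\<close> is the density of the next state \<open>x\<close> given the current state \<open>x'\<close>.\<close>

definition predict ::
  "('b \<Rightarrow> 'a \<Rightarrow> 'a \<Rightarrow> real) \<Rightarrow> ('a::euclidean_space \<times> 'b::euclidean_space \<Rightarrow> real) \<Rightarrow> 'a \<times> 'b \<Rightarrow> real" where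
  "predict P f = (\<lambda>(x, \<theta>). \<integral>x'. P \<theta> x' x * f (x', \<theta>) \<partial>lborel)"

definition bayes_update :: "('a::euclidean_space \<Rightarrow> real) \<Rightarrow> ('a \<Rightarrow> real) \<Rightarrow> 'a \<Rightarrow> real" where
  "bayes_update l f = (\<lambda>z. l z * f z / (\<integral>z. l z * f z \<partial>lborel))"

locale markov_density =
  fixes P :: "'b::euclidean_space \<Rightarrow> 'a::euclidean_space \<Rightarrow> 'a \<Rightarrow> real"
  assumes P_measurable: "(\<lambda>(\<theta>, x', x). P \<theta> x' x) \<in> borel_measurable borel"
    and P_nonneg: "0 \<le> P \<theta> x' x"
    and P_total: "(\<integral>\<^sup>+x. ennreal (P \<theta> x' x) \<partial>lborel) = 1"
begin

lemma P_measurable_comp [measurable (raw)]: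
  assumes "a \<in> borel_measurable M" "b \<in> borel_measurable M" "c \<in> borel_measurable M"
  shows "(\<lambda>w. P (a w) (b w) (c w)) \<in> borel_measurable M"
  using measurable_compose[OF borel_measurable_Pair[OF assms(1) borel_measurable_Pair[OF assms(2,3)]] P_measurable]
  by simp

text \<open>Integrating the new state first leaves the kernel with mass one. The Bochner statements
  on \<open>predict\<close> are all drawn from this one application of Tonelli.\<close>

lemma nn_integral_markov:
  assumes [measurable]: "u \<in> borel_measurable borel"
  shows "(\<integral>\<^sup>+(x, \<theta>). (\<integral>\<^sup>+x'. ennreal (P \<theta> x' x) * u (x', \<theta>) \<partial>lborel) \<partial>lborel) = (\<integral>\<^sup>+z. u z \<partial>lborel)"
proof -
  have "(\<integral>\<^sup>+(x, \<theta>). (\<integral>\<^sup>+x'. ennreal (P \<theta> x' x) * u (x', \<theta>) \<partial>lborel) \<partial>lborel)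
      = (\<integral>\<^sup>+\<theta>. \<integral>\<^sup>+x. \<integral>\<^sup>+x'. ennreal (P \<theta> x' x) * u (x', \<theta>) \<partial>lborel \<partial>lborel \<partial>lborel)"
    unfolding lborel_prod[symmetric] by (subst lborel_pair.nn_integral_snd[symmetric]) auto
  also have "\<dots> = (\<integral>\<^sup>+\<theta>. \<integral>\<^sup>+x'. \<integral>\<^sup>+x. ennreal (P \<theta> x' x) * u (x', \<theta>) \<partial>lborel \<partial>lborel \<partial>lborel)"
    by (subst lborel_pair.Fubini') auto
  also have "\<dots> = (\<integral>\<^sup>+\<theta>. \<integral>\<^sup>+x'. u (x', \<theta>) \<partial>lborel \<partial>lborel)"
    by (subst nn_integral_multc) (auto simp: P_total)
  also have "\<dots> = (\<integral>\<^sup>+z. u z \<partial>lborel)"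
    unfolding lborel_prod[symmetric] by (subst lborel_pair.nn_integral_snd) (auto simp: lborel_prod)
  finally show ?thesis .
qed

lemma predict_measurable [measurable]:
  assumes [measurable]: "f \<in> borel_measurable borel"
  shows "predict P f \<in> borel_measurable borel"
proof -
  have "(\<lambda>(x, \<theta>). \<integral>x'. P \<theta> x' x * f (x', \<theta>) \<partial>lborel) \<in> borel_measurable (borel \<Otimes>\<^sub>M borel)"
    by measurable
  then show ?thesis by (simp add: predict_def borel_prod)
qed

text \<open>\<open>predict\<close> is a Bochner integral and returns 0 wherever its integrand fails
  to be integrable; this confines such points to a null set.\<close>

lemma AE_integrable_markov:
  assumes f: "integrable lborel f" "\<And>z. 0 \<le> f z"
  shows "AE z in lborel. integrable lborel (\<lambda>x'. P (snd z) x' (fst z) * f (x', snd z))"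
proof -
  have [measurable]: "f \<in> borel_measurable borel" using f(1) by auto
  have "(\<integral>\<^sup>+z. (\<integral>\<^sup>+x'. ennreal (P (snd z) x' (fst z)) * ennreal (f (x', snd z)) \<partial>lborel) \<partial>lborel) \<noteq> \<infinity>"
    using f nn_integral_markov[of "\<lambda>z. ennreal (f z)"] by (simp add: nn_integral_eq_integral split_beta')
  then have "AE z in lborel. (\<integral>\<^sup>+x'. ennreal (P (snd z) x' (fst z)) * ennreal (f (x', snd z)) \<partial>lborel) \<noteq> \<infinity>"
    by (intro nn_integral_PInf_AE) (auto simp flip: borel_prod)
  then show ?thesis
  proof eventually_elim
    case (elim z)
    then show ?case
      using f P_nonneg by (intro integrableI_bounded) (auto simp: split_beta' ennreal_mult less_top)
  qed
qed

lemma nn_integral_predict: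
  assumes f: "integrable lborel f" "\<And>z. 0 \<le> f z"
  shows "(\<integral>\<^sup>+z. ennreal (predict P f z) \<partial>lborel) = (\<integral>\<^sup>+z. ennreal (f z) \<partial>lborel)"
proof -
  have [measurable]: "f \<in> borel_measurable borel" using f(1) by auto
  have "(\<integral>\<^sup>+z. ennreal (predict P f z) \<partial>lborel)
      = (\<integral>\<^sup>+z. (\<integral>\<^sup>+x'. ennreal (P (snd z) x' (fst z)) * ennreal (f (x', snd z)) \<partial>lborel) \<partial>lborel)"
    using AE_integrable_markov[OF f]
    by (intro nn_integral_cong_AE)
       (auto elim!: eventually_mono simp: predict_def nn_integral_eq_integral f P_nonneg split_beta' simp flip: ennreal_mult)
  also have "\<dots> = (\<integral>\<^sup>+z. ennreal (f z) \<partial>lborel)"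
    using nn_integral_markov[of "\<lambda>z. ennreal (f z)"] by (simp add: split_beta')
  finally show ?thesis .
qed

lemma prob_density_predict:
  assumes "prob_density f"
  shows "prob_density (predict P f)"
  using nn_integral_predict[OF prob_density_integrable(1)[OF assms]] assms
  by (auto simp: prob_density_def predict_def P_nonneg intro!: predict_measurable[unfolded predict_def])

text \<open>The common core of both contractions: the pointwise discrepancy after prediction is
  dominated by the kernel average of the discrepancy before, and averaging preserves total mass. The
  domination is asked for only where the average is a genuine integral.\<close>

lemma integral_le_markov:
  assumes [measurable]: "F \<in> borel_measurable borel" and u: "integrable lborel u"
    and nn: "\<And>z. 0 \<le> F z" "\<And>z. 0 \<le> u z"
    and le: "AE z in lborel. integrable lborel (\<lambda>x'. P (snd z) x' (fst z) * u (x', snd z)) \<longrightarrow>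
      F z \<le> (\<integral>x'. P (snd z) x' (fst z) * u (x', snd z) \<partial>lborel)"
  shows "(\<integral>z. F z \<partial>lborel) \<le> (\<integral>z. u z \<partial>lborel)"
proof -
  have [measurable]: "u \<in> borel_measurable borel" using u by auto
  have "(\<integral>\<^sup>+z. ennreal (F z) \<partial>lborel) \<le> (\<integral>\<^sup>+z. ennreal (predict P u z) \<partial>lborel)"
    using AE_integrable_markov[OF u nn(2)] le
    by (intro nn_integral_mono_AE) (auto elim!: eventually_elim2 simp: predict_def split_beta' ennreal_leI)
  also have "\<dots> = ennreal (\<integral>z. u z \<partial>lborel)"
    using u nn by (simp add: nn_integral_predict nn_integral_eq_integral)
  finally show ?thesis
    using nn by (simp add: integral_eq_nn_integral enn2real_leI)
qed

lemma tv_dist_predict: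
  assumes f: "prob_density f" and g: "prob_density g"
  shows "tv_dist (predict P f) (predict P g) \<le> tv_dist f g"
proof -
  note [measurable] = prob_densityD(1)[OF f] prob_densityD(1)[OF g]
  note fi = prob_density_integrable(1)[OF f] and gi = prob_density_integrable(1)[OF g]
  have "(\<integral>z. \<bar>predict P f z - predict P g z\<bar> \<partial>lborel) \<le> (\<integral>z. \<bar>f z - g z\<bar> \<partial>lborel)"
  proof (rule integral_le_markov)
    show "AE z in lborel. integrable lborel (\<lambda>x'. P (snd z) x' (fst z) * \<bar>f (x', snd z) - g (x', snd z)\<bar>) \<longrightarrow>
      \<bar>predict P f z - predict P g z\<bar> \<le> (\<integral>x'. P (snd z) x' (fst z) * \<bar>f (x', snd z) - g (x', snd z)\<bar> \<partial>lborel)"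
      using AE_integrable_markov[OF fi prob_densityD(2)[OF f]] AE_integrable_markov[OF gi prob_densityD(2)[OF g]]
    proof eventually_elim
      case (elim z)
      have "\<bar>predict P f z - predict P g z\<bar>
          = \<bar>\<integral>x'. P (snd z) x' (fst z) * f (x', snd z) - P (snd z) x' (fst z) * g (x', snd z) \<partial>lborel\<bar>"
        using elim by (simp add: predict_def split_beta')
      also have "\<dots> \<le> (\<integral>x'. \<bar>P (snd z) x' (fst z) * f (x', snd z) - P (snd z) x' (fst z) * g (x', snd z)\<bar> \<partial>lborel)"
        by (rule integral_abs_bound)
      also have "\<dots> = (\<integral>x'. P (snd z) x' (fst z) * \<bar>f (x', snd z) - g (x', snd z)\<bar> \<partial>lborel)"
        by (simp add: P_nonneg abs_mult flip: right_diff_distrib)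
      finally show ?case by simp
    qed
  qed (use fi gi in auto)
  then show ?thesis by (simp add: tv_dist_def)
qed

text \<open>The kernel weight is moved under the square roots, \<open>sqrt_integral_diff_le\<close>
  is applied to the slice in the old state, and the weight is pulled out again.\<close>

lemma hellinger_dist_predict:
  assumes f: "prob_density f" and g: "prob_density g"
  shows "hellinger_dist (predict P f) (predict P g) \<le> hellinger_dist f g"
proof -
  note [measurable] = prob_densityD(1)[OF f] prob_densityD(1)[OF g]
  note fi = prob_density_integrable(1)[OF f] and gi = prob_density_integrable(1)[OF g]
  note nn = prob_densityD(2)[OF f] prob_densityD(2)[OF g]
  have "(\<integral>z. (sqrt (predict P f z) - sqrt (predict P g z))\<^sup>2 \<partial>lborel) \<le> (\<integral>z. (sqrt (f z) - sqrt (g z))\<^sup>2 \<partial>lborel)"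
  proof (rule integral_le_markov)
    show "AE z in lborel. integrable lborel (\<lambda>x'. P (snd z) x' (fst z) * (sqrt (f (x', snd z)) - sqrt (g (x', snd z)))\<^sup>2) \<longrightarrow>
      (sqrt (predict P f z) - sqrt (predict P g z))\<^sup>2
      \<le> (\<integral>x'. P (snd z) x' (fst z) * (sqrt (f (x', snd z)) - sqrt (g (x', snd z)))\<^sup>2 \<partial>lborel)"
      using AE_integrable_markov[OF fi nn(1)] AE_integrable_markov[OF gi nn(2)]
    proof eventually_elim
      case (elim z)
      have "(sqrt (predict P f z) - sqrt (predict P g z))\<^sup>2
          \<le> (\<integral>x'. (sqrt (P (snd z) x' (fst z) * f (x', snd z)) - sqrt (P (snd z) x' (fst z) * g (x', snd z)))\<^sup>2 \<partial>lborel)"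
        using sqrt_integral_diff_le[OF elim] nn P_nonneg by (simp add: predict_def split_beta')
      also have "\<dots> = (\<integral>x'. P (snd z) x' (fst z) * (sqrt (f (x', snd z)) - sqrt (g (x', snd z)))\<^sup>2 \<partial>lborel)"
        by (simp add: P_nonneg real_sqrt_mult power_mult_distrib flip: right_diff_distrib)
      finally show ?case by simp
    qed
  qed (use fi gi nn in \<open>auto intro!: sqrt_affinity\<close>)
  then show ?thesis by (simp add: hellinger_dist_def)
qed

end

section \<open>Bayes update with a bounded positive likelihood\<close>

context
  fixes l f :: "'a::euclidean_space \<Rightarrow> real" and L :: real
  assumes l [measurable]: "l \<in> borel_measurable borel" and l_pos: "\<And>z. 0 < l z" and l_le: "\<And>z. l z \<le> L"
    and f: "prob_density f"
begin

lemma integrable_weighted: "integrable lborel (\<lambda>z. l z * f z)"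
proof (rule Bochner_Integration.integrable_bound)
  show "integrable lborel (\<lambda>z. L * f z)" using prob_density_integrable(1)[OF f] by simp
  show "AE z in lborel. norm (l z * f z) \<le> norm (L * f z)"
    using l_pos l_le prob_densityD(2)[OF f]
    by (auto simp: abs_mult less_imp_le intro!: mult_right_mono AE_I2 order_trans[OF l_le abs_ge_self])
qed (use prob_densityD(1)[OF f] in simp)

text \<open>A vanishing evidence would force \<open>f\<close> to vanish almost everywhere, because
  the likelihood is strictly positive. Every division in \<open>bayes_update\<close> is legitimate
  for this reason.\<close>

lemma evidence_pos: "0 < (\<integral>z. l z * f z \<partial>lborel)"
proof -
  have nn: "0 \<le> l z * f z" for z using l_pos[of z] prob_densityD(2)[OF f, of z] by simp
  have "(\<integral>z. l z * f z \<partial>lborel) \<noteq> 0"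
  proof
    assume "(\<integral>z. l z * f z \<partial>lborel) = 0"
    then have "AE z in lborel. l z * f z = 0"
      using integrable_weighted nn by (simp add: integral_nonneg_eq_0_iff_AE)
    then have "AE z in lborel. f z = 0" by eventually_elim (use l_pos in \<open>auto simp: less_le\<close>)
    then have "(\<integral>z. f z \<partial>lborel) = (\<integral>z. 0 \<partial>(lborel :: 'a measure))"
      using prob_densityD(1)[OF f] by (intro integral_cong_AE) auto
    then show False using prob_density_integrable(2)[OF f] by simp
  qed
  moreover have "0 \<le> (\<integral>z. l z * f z \<partial>lborel)" using nn by (rule Bochner_Integration.integral_nonneg)
  ultimately show ?thesis by linarith
qed

lemma prob_density_bayes_update: "prob_density (bayes_update l f)"
  using integrable_weighted evidence_pos l_pos prob_densityD(2)[OF f]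
  by (intro prob_densityI) (auto simp: bayes_update_def less_imp_le)

end

lemma tv_dist_commute: "tv_dist f g = tv_dist g f"
  by (simp add: tv_dist_def abs_minus_commute)

context
  fixes l f g :: "'a::euclidean_space \<Rightarrow> real" and L :: real
  assumes l [measurable]: "l \<in> borel_measurable borel" and l_pos: "\<And>z. 0 < l z" and l_le: "\<And>z. l z \<le> L"
    and f: "prob_density f" and g: "prob_density g"
begin

text \<open>The distance may be computed from the positive part of either difference. The sign is
  chosen so that replacing the evidence of \<open>f\<close> by that of \<open>g\<close> can only
  enlarge the difference; then both terms share a denominator and no separate estimate of the
  evidences is required.\<close>

lemma tv_dist_bayes_update:
  "tv_dist (bayes_update l f) (bayes_update l g) \<le> L / (\<integral>z. l z * g z \<partial>lborel) * tv_dist f g"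
proof -
  define Zf where "Zf = (\<integral>z. l z * f z \<partial>lborel)"
  define Zg where "Zg = (\<integral>z. l z * g z \<partial>lborel)"
  have Z: "0 < Zf" "0 < Zg"
    unfolding Zf_def Zg_def by (rule evidence_pos[OF l l_pos l_le]; fact)+
  note fi = prob_density_integrable(1)[OF f] and gi = prob_density_integrable(1)[OF g]
  note nn = prob_densityD(2)[OF f] prob_densityD(2)[OF g]
  have B: "prob_density (bayes_update l f)" "prob_density (bayes_update l g)"
    by (rule prob_density_bayes_update[OF l l_pos l_le]; fact)+
  note Bi = B[THEN prob_density_integrable(1)]
  have *: "max 0 w \<le> L / Zg * max 0 t" if "w \<le> l z / Zg * t" for w t z
  proof -
    note that
    also have "l z / Zg * t \<le> l z / Zg * max 0 t"
      using l_pos[of z] Z by (intro mult_left_mono) auto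
    also have "\<dots> \<le> L / Zg * max 0 t"
      using l_le[of z] Z by (intro mult_right_mono divide_right_mono) auto
    finally show ?thesis
      using Z l_pos[of z] l_le[of z] by (auto intro!: mult_nonneg_nonneg divide_nonneg_nonneg)
  qed
  have le: "l z * f z / z' \<le> l z * f z / z''" if "z'' \<le> z'" "0 < z''" for z z' z''
    using that l_pos[of z] nn(1)[of z] by (intro divide_left_mono) auto
  show ?thesis
  proof (cases "Zf \<le> Zg")
    case True
    have "tv_dist (bayes_update l f) (bayes_update l g)
        = (\<integral>z. max 0 (bayes_update l g z - bayes_update l f z) \<partial>lborel)"
      by (rule tv_dist_pos_part(2)[OF B])
    also have "\<dots> \<le> (\<integral>z. L / Zg * max 0 (g z - f z) \<partial>lborel)"
    proof (intro integral_mono)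
      show "integrable lborel (\<lambda>z. max 0 (bayes_update l g z - bayes_update l f z))"
        using Bi by (intro integrable_max) auto
      show "integrable lborel (\<lambda>z. L / Zg * max 0 (g z - f z))"
        using fi gi by (intro integrable_mult_right integrable_max) auto
      show "max 0 (bayes_update l g z - bayes_update l f z) \<le> L / Zg * max 0 (g z - f z)" for z
        using le[OF True Z(1), of z]
        by (intro *[of _ z]) (simp add: bayes_update_def right_diff_distrib diff_divide_distrib flip: Zf_def Zg_def)
    qed
    also have "\<dots> = L / Zg * tv_dist f g" by (simp add: tv_dist_pos_part(2)[OF f g])
    finally show ?thesis by (simp add: Zg_def)
  next
    case False
    have "tv_dist (bayes_update l f) (bayes_update l g)
        = (\<integral>z. max 0 (bayes_update l f z - bayes_update l g z) \<partial>lborel)"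
      by (rule tv_dist_pos_part(1)[OF B])
    also have "\<dots> \<le> (\<integral>z. L / Zg * max 0 (f z - g z) \<partial>lborel)"
    proof (intro integral_mono)
      show "integrable lborel (\<lambda>z. max 0 (bayes_update l f z - bayes_update l g z))"
        using Bi by (intro integrable_max) auto
      show "integrable lborel (\<lambda>z. L / Zg * max 0 (f z - g z))"
        using fi gi by (intro integrable_mult_right integrable_max) auto
      show "max 0 (bayes_update l f z - bayes_update l g z) \<le> L / Zg * max 0 (f z - g z)" for z
        using le[of Zg Zf z] Z False
        by (intro *[of _ z]) (simp add: bayes_update_def right_diff_distrib diff_divide_distrib flip: Zf_def Zg_def)
    qed
    also have "\<dots> = L / Zg * tv_dist f g" by (simp add: tv_dist_pos_part(1)[OF f g])
    finally show ?thesis by (simp add: Zg_def)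
  qed
qed

text \<open>With \<open>a\<close>, \<open>b\<close> the roots of the evidences and \<open>c\<close>
  the affinity of the weighted functions, the squared distances before and after normalisation are
  affine in \<open>c\<close>. This leaves an inequality between numbers with \<open>c\<close>
  between 0 and the product of \<open>a\<close> and \<open>b\<close>; the constant 4 in it becomes 2
  under the root.\<close>

lemma hellinger_dist_bayes_update:
  "hellinger_dist (bayes_update l f) (bayes_update l g)
    \<le> 2 * sqrt (L / (\<integral>z. l z * g z \<partial>lborel)) * hellinger_dist f g"
proof -
  define Zf where "Zf = (\<integral>z. l z * f z \<partial>lborel)"
  define Zg where "Zg = (\<integral>z. l z * g z \<partial>lborel)"
  have Z: "0 < Zf" "0 < Zg"
    unfolding Zf_def Zg_def by (rule evidence_pos[OF l l_pos l_le]; fact)+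
  note fi = prob_density_integrable(1)[OF f] and gi = prob_density_integrable(1)[OF g]
  note nn = prob_densityD(2)[OF f] prob_densityD(2)[OF g]
  have wi: "integrable lborel (\<lambda>z. l z * f z)" "integrable lborel (\<lambda>z. l z * g z)"
    by (rule integrable_weighted[OF l l_pos l_le]; fact)+
  have wnn: "0 \<le> l z * f z" "0 \<le> l z * g z" for z using nn l_pos[of z] by auto
  define a where "a = sqrt Zf"
  define b where "b = sqrt Zg"
  define c where "c = (\<integral>z. sqrt (l z * f z) * sqrt (l z * g z) \<partial>lborel)"
  have ab: "0 < a" "0 < b" "a\<^sup>2 = Zf" "b\<^sup>2 = Zg" using Z by (auto simp: a_def b_def)
  have c: "0 \<le> c" "c \<le> a * b"
    using sqrt_affinity(2)[OF wi wnn] wnn by (auto simp: c_def a_def b_def Zf_def Zg_def)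
  have D: "(\<integral>z. (sqrt (l z * f z) - sqrt (l z * g z))\<^sup>2 \<partial>lborel) = Zf + Zg - 2 * c"
    using sqrt_affinity(4)[OF wi wnn] by (simp add: c_def Zf_def Zg_def)
  have "(\<integral>z. (sqrt (bayes_update l f z) - sqrt (bayes_update l g z))\<^sup>2 \<partial>lborel)
      = (\<integral>z. l z * f z / Zf \<partial>lborel) + (\<integral>z. l z * g z / Zg \<partial>lborel)
        - 2 * (\<integral>z. sqrt (l z * f z / Zf) * sqrt (l z * g z / Zg) \<partial>lborel)"
    unfolding bayes_update_def Zf_def[symmetric] Zg_def[symmetric]
    using wi wnn Z by (intro sqrt_affinity) (auto simp: divide_nonneg_pos)
  also have "\<dots> = 2 - 2 * (c / (a * b))"
  proof -
    have "(\<integral>z. sqrt (l z * f z / Zf) * sqrt (l z * g z / Zg) \<partial>lborel)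
        = (\<integral>z. (sqrt (l z * f z) * sqrt (l z * g z)) / (a * b) \<partial>lborel)"
      by (simp add: real_sqrt_divide a_def b_def)
    also have "\<dots> = c / (a * b)" unfolding c_def by (rule integral_divide_zero)
    finally show ?thesis using Z by (simp flip: Zf_def Zg_def)
  qed
  also have "\<dots> \<le> 4 / Zg * (Zf + Zg - 2 * c)"
  proof -
    \<comment> \<open>This is the square of \<open>b\<close> times the difference of the two sides.
      If the slope in \<open>c\<close> is not positive, the extreme case is the Cauchy-Schwarz bound
      for \<open>c\<close>, where four times the square of \<open>a - b\<close> remains; otherwise
      the extreme case is \<open>c = 0\<close>.\<close>
    have "0 \<le> 4 * a\<^sup>2 + 2 * b\<^sup>2 + c * (2 * b / a - 8)"
    proof (cases "2 * b / a - 8 \<le> 0")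
      case True
      have "a * b * (2 * b / a - 8) \<le> c * (2 * b / a - 8)"
        by (rule mult_right_mono_neg[OF c(2) True])
      moreover have "4 * a\<^sup>2 + 2 * b\<^sup>2 + a * b * (2 * b / a - 8) = 4 * (a - b)\<^sup>2"
        using ab by (simp add: field_simps power2_eq_square)
      ultimately show ?thesis using zero_le_power2[of "a - b"] by linarith
    next
      case False
      then show ?thesis using c by simp
    qed
    moreover have "b\<^sup>2 * (4 / Zg * (Zf + Zg - 2 * c)) = 4 * (a\<^sup>2 + b\<^sup>2 - 2 * c)"
      using Z by (simp add: ab(3,4))
    moreover have "b\<^sup>2 * (2 - 2 * (c / (a * b))) = 2 * b\<^sup>2 - 2 * b / a * c"
      using ab(1,2) by (simp add: field_simps power2_eq_square)
    ultimately have "b\<^sup>2 * (2 - 2 * (c / (a * b))) \<le> b\<^sup>2 * (4 / Zg * (Zf + Zg - 2 * c))"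
      by (simp add: algebra_simps)
    then show ?thesis by (rule mult_left_le_imp_le) (use ab(2) in simp)
  qed
  also have "\<dots> \<le> 4 / Zg * (L * (\<integral>z. (sqrt (f z) - sqrt (g z))\<^sup>2 \<partial>lborel))"
  proof -
    have "(\<integral>z. (sqrt (l z * f z) - sqrt (l z * g z))\<^sup>2 \<partial>lborel) \<le> (\<integral>z. L * (sqrt (f z) - sqrt (g z))\<^sup>2 \<partial>lborel)"
    proof (intro integral_mono)
      fix z
      have "(sqrt (l z * f z) - sqrt (l z * g z))\<^sup>2 = l z * (sqrt (f z) - sqrt (g z))\<^sup>2"
        using l_pos[of z] by (simp add: real_sqrt_mult power_mult_distrib less_imp_le flip: right_diff_distrib)
      then show "(sqrt (l z * f z) - sqrt (l z * g z))\<^sup>2 \<le> L * (sqrt (f z) - sqrt (g z))\<^sup>2"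
        using l_le by (simp add: mult_right_mono)
    qed (use sqrt_affinity(3)[OF wi wnn] sqrt_affinity(3)[OF fi gi nn] in auto)
    then show ?thesis unfolding D using Z by (intro mult_left_mono) auto
  qed
  finally have "hellinger_dist (bayes_update l f) (bayes_update l g)
      \<le> sqrt (1 / 2 * (4 / Zg * (L * (\<integral>z. (sqrt (f z) - sqrt (g z))\<^sup>2 \<partial>lborel))))"
    unfolding hellinger_dist_def by (intro real_sqrt_le_mono mult_left_mono) auto
  also have "\<dots> = sqrt 4 * sqrt (L / Zg) * hellinger_dist f g"
    unfolding hellinger_dist_def real_sqrt_mult[symmetric] by (rule arg_cong[where f=sqrt]) simp
  finally show ?thesis by (simp add: Zg_def)
qed

end

section \<open>Measurability of matrix operations\<close>

lemma borel_measurable_vec_nth [measurable (raw)]: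
  fixes f :: "'a \<Rightarrow> 'b::euclidean_space^'n"
  assumes "f \<in> borel_measurable M"
  shows "(\<lambda>x. f x $ i) \<in> borel_measurable M"
  by (rule borel_measurable_continuous_on[OF _ assms]) (intro continuous_intros)

lemma borel_measurable_vecI:
  fixes f :: "'a \<Rightarrow> 'b::euclidean_space^'n"
  assumes "\<And>i. (\<lambda>x. f x $ i) \<in> borel_measurable M"
  shows "f \<in> borel_measurable M"
proof (subst borel_measurable_euclidean_space, intro ballI)
  fix b :: "'b^'n" assume "b \<in> Basis"
  then obtain i u where b: "b = axis i u" by (auto simp: Basis_vec_def)
  show "(\<lambda>x. f x \<bullet> b) \<in> borel_measurable M"
    unfolding b inner_axis using assms[of i] by measurable
qed

lemma borel_measurable_mv_mult [measurable (raw)]: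
  fixes A :: "'a \<Rightarrow> real^'n^'m"
  assumes [measurable]: "A \<in> borel_measurable M" "x \<in> borel_measurable M"
  shows "(\<lambda>w. A w *v x w) \<in> borel_measurable M"
  by (intro borel_measurable_vecI) (simp add: matrix_vector_mult_def)

lemma borel_measurable_mm_mult [measurable (raw)]:
  fixes A :: "'a \<Rightarrow> real^'n^'m" and B :: "'a \<Rightarrow> real^'l^'n"
  assumes [measurable]: "A \<in> borel_measurable M" "B \<in> borel_measurable M"
  shows "(\<lambda>w. A w ** B w) \<in> borel_measurable M"
  by (intro borel_measurable_vecI) (simp add: matrix_matrix_mult_def)

lemma borel_measurable_transpose [measurable (raw)]:
  fixes A :: "'a \<Rightarrow> real^'n^'m"
  assumes [measurable]: "A \<in> borel_measurable M"
  shows "(\<lambda>w. transpose (A w)) \<in> borel_measurable M"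
  by (intro borel_measurable_vecI) (simp add: transpose_def)

lemma borel_measurable_det [measurable (raw)]:
  fixes A :: "'a \<Rightarrow> real^'n^'n"
  assumes [measurable]: "A \<in> borel_measurable M"
  shows "(\<lambda>w. det (A w)) \<in> borel_measurable M"
  unfolding det_def by measurable

text \<open>Being defined by choice, \<open>matrix_inv\<close> offers no direct handle; Cramer's
  rule expresses its entries as quotients of determinants.\<close>

lemma borel_measurable_matrix_inv:
  fixes R :: "'a \<Rightarrow> real^'n^'n"
  assumes [measurable]: "R \<in> borel_measurable M" and R: "\<And>w. invertible (R w)"
  shows "(\<lambda>w. matrix_inv (R w)) \<in> borel_measurable M"
proof (intro borel_measurable_vecI)
  fix i j
  let ?D = "\<lambda>w. det ((\<chi> k l. if l = i then axis j 1 $ k else R w $ k $ l) :: real^'n^'n)"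
  have "matrix_inv (R w) $ i $ j = ?D w / det (R w)" for w
  proof -
    have "R w *v (matrix_inv (R w) *v axis j 1) = axis j 1"
      by (simp add: matrix_vector_mul_assoc matrix_inv_mult[OF R])
    then have "matrix_inv (R w) *v axis j 1 = (\<chi> i. det (\<chi> k l. if l = i then axis j 1 $ k else R w $ k $ l) / det (R w))"
      using R[of w] by (subst (asm) cramer) (auto simp: invertible_det_nz)
    then have "(matrix_inv (R w) *v axis j 1) $ i = ?D w / det (R w)" by simp
    then show ?thesis by (simp add: matrix_vector_mult_basis column_def)
  qed
  moreover have "(\<lambda>w. (\<chi> k l. if l = i then axis j 1 $ k else R w $ k $ l) :: real^'n^'n) \<in> borel_measurable M"
    by (intro borel_measurable_vecI) auto
  ultimately show "(\<lambda>w. matrix_inv (R w) $ i $ j) \<in> borel_measurable M" by simp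
qed

lemma borel_measurable_gauss_density:
  fixes R :: "'a \<Rightarrow> real^'n^'n"
  assumes [measurable]: "\<mu> \<in> borel_measurable M" "R \<in> borel_measurable M" "x \<in> borel_measurable M"
    and R: "\<And>w. pos_def (R w)"
  shows "(\<lambda>w. gauss_density (\<mu> w) (R w) (x w)) \<in> borel_measurable M"
proof -
  have [measurable]: "(\<lambda>w. matrix_inv (R w)) \<in> borel_measurable M"
    using R by (intro borel_measurable_matrix_inv pos_def_invertible) auto
  show ?thesis unfolding gauss_density_def by measurable
qed

section \<open>Extended expectations\<close>

lemma eintegral_ereal_integrable:
  fixes f :: "'a \<Rightarrow> real"
  assumes f: "integrable M f"
  shows "eintegral M (\<lambda>x. ereal (f x)) = ereal (\<integral>x. f x \<partial>M)"
proof -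
  have fin: "(\<integral>\<^sup>+x. ennreal (f x) \<partial>M) \<noteq> \<infinity>" "(\<integral>\<^sup>+x. ennreal (- f x) \<partial>M) \<noteq> \<infinity>"
    using f by (auto simp: real_integrable_def)
  have e: "x \<noteq> \<infinity> \<Longrightarrow> enn2ereal x = ereal (enn2real x)" for x
    by (cases x) (auto simp: enn2ereal_ennreal)
  show ?thesis
    using fin by (simp add: eintegral_def real_lebesgue_integral_def[OF f] e e2ennreal_ereal)
qed

text \<open>With a finite positive part, an infinite negative part would make the expectation minus
  infinity. This is how a lower bound on an extended expectation produces integrability.\<close>

lemma integrable_if_eintegral_bounded:
  fixes f :: "'a \<Rightarrow> real"
  assumes [measurable]: "f \<in> borel_measurable M"
    and pos: "(\<integral>\<^sup>+x. ennreal (f x) \<partial>M) < \<infinity>"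
    and ne: "eintegral M (\<lambda>x. ereal (f x)) \<noteq> - \<infinity>"
  shows "integrable M f"
proof -
  have "(\<integral>\<^sup>+x. ennreal (- f x) \<partial>M) \<noteq> \<infinity>"
  proof
    assume inf: "(\<integral>\<^sup>+x. ennreal (- f x) \<partial>M) = \<infinity>"
    obtain r where "(\<integral>\<^sup>+x. ennreal (f x) \<partial>M) = ennreal r" "0 \<le> r"
      using pos by (cases "\<integral>\<^sup>+x. ennreal (f x) \<partial>M") auto
    then have "eintegral M (\<lambda>x. ereal (f x)) = - \<infinity>"
      using inf by (simp add: eintegral_def e2ennreal_ereal enn2ereal_ennreal)
    with ne show False by simp
  qed
  then show ?thesis using pos by (auto simp: real_integrable_def)
qed

text \<open>By \<open>KL_term_nonneg\<close> the negative part of the integrand is at most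
  \<open>g\<close>, hence of mass at most one, and the difference defining the divergence is never
  infinity minus infinity. A value below infinity leaves an integrand that is finite almost
  everywhere, which means absolute continuity, and then ordinary integrability.\<close>

lemma KL_div_finite:
  assumes f: "prob_density f" and g: "prob_density g"
  shows "KL_div f g \<noteq> - \<infinity>"
    and "KL_div f g \<noteq> \<infinity> \<Longrightarrow> AE x in lborel. g x = 0 \<longrightarrow> f x = 0"
    and "KL_div f g \<noteq> \<infinity> \<Longrightarrow> integrable lborel (\<lambda>x. f x * ln (f x / g x))"
    and "KL_div f g \<noteq> \<infinity> \<Longrightarrow> KL_div f g = ereal (\<integral>x. f x * ln (f x / g x) \<partial>lborel)"
proof -
  note [measurable] = prob_densityD(1)[OF f] prob_densityD(1)[OF g]
  note nn = prob_densityD(2)[OF f] prob_densityD(2)[OF g]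
  define u where "u x = (if f x = 0 then 0 else if g x = 0 then \<infinity> else ereal (f x * ln (f x / g x)))" for x
  have [measurable]: "u \<in> borel_measurable borel" unfolding u_def by measurable
  have KL: "KL_div f g = enn2ereal (\<integral>\<^sup>+x. e2ennreal (u x) \<partial>lborel) - enn2ereal (\<integral>\<^sup>+x. e2ennreal (- u x) \<partial>lborel)"
    by (simp add: KL_div_def eintegral_def u_def)
  have "e2ennreal (- u x) \<le> ennreal (g x)" for x
  proof (cases "f x = 0 \<or> g x = 0")
    case True
    then show ?thesis using nn by (auto simp: u_def e2ennreal_neg)
  next
    case False
    then have "0 \<le> KL_term (f x) (g x)" using nn by (intro KL_term_nonneg) auto
    then have "- (f x * ln (f x / g x)) \<le> g x" using nn[of x] by (simp add: KL_term_def)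
    then show ?thesis using False by (simp add: u_def e2ennreal_ereal ennreal_leI)
  qed
  then have "(\<integral>\<^sup>+x. e2ennreal (- u x) \<partial>lborel) \<le> (\<integral>\<^sup>+x. ennreal (g x) \<partial>lborel)"
    by (intro nn_integral_mono) auto
  then have neg: "(\<integral>\<^sup>+x. e2ennreal (- u x) \<partial>lborel) < \<infinity>"
    using prob_densityD(3)[OF g] by (simp add: le_less_trans[of _ 1])
  then obtain n where n: "(\<integral>\<^sup>+x. e2ennreal (- u x) \<partial>lborel) = ennreal n" "0 \<le> n"
    by (cases "\<integral>\<^sup>+x. e2ennreal (- u x) \<partial>lborel") auto
  show "KL_div f g \<noteq> - \<infinity>"
    unfolding KL n(1) using n(2) by (cases "\<integral>\<^sup>+x. e2ennreal (u x) \<partial>lborel") (auto simp: enn2ereal_ennreal)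
  assume "KL_div f g \<noteq> \<infinity>"
  then have pos: "(\<integral>\<^sup>+x. e2ennreal (u x) \<partial>lborel) \<noteq> \<infinity>"
    unfolding KL n(1) using n(2) by (auto simp: enn2ereal_ennreal)
  have "AE x in lborel. e2ennreal (u x) \<noteq> \<infinity>"
    using pos by (intro nn_integral_PInf_AE) auto
  then show ac: "AE x in lborel. g x = 0 \<longrightarrow> f x = 0"
    by eventually_elim (auto simp: u_def e2ennreal_infty split: if_splits)
  have ueq: "AE x in lborel. u x = ereal (f x * ln (f x / g x))"
    using ac by eventually_elim (auto simp: u_def)
  have 1: "(\<integral>\<^sup>+x. e2ennreal (u x) \<partial>lborel) = (\<integral>\<^sup>+x. ennreal (f x * ln (f x / g x)) \<partial>lborel)"
    using ueq by (intro nn_integral_cong_AE) (auto elim!: eventually_mono simp: e2ennreal_ereal)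
  have 2: "(\<integral>\<^sup>+x. e2ennreal (- u x) \<partial>lborel) = (\<integral>\<^sup>+x. ennreal (- (f x * ln (f x / g x))) \<partial>lborel)"
    using ueq by (intro nn_integral_cong_AE) (auto elim!: eventually_mono simp: e2ennreal_ereal)
  show int: "integrable lborel (\<lambda>x. f x * ln (f x / g x))"
    using pos neg by (auto simp: real_integrable_def 1[symmetric] 2[symmetric])
  show "KL_div f g = ereal (\<integral>x. f x * ln (f x / g x) \<partial>lborel)"
    unfolding eintegral_ereal_integrable[OF int, symmetric] KL 1 2
    by (simp add: eintegral_def e2ennreal_ereal)
qed

lemma integral_law:
  fixes g :: "'a::euclidean_space \<Rightarrow> real"
  assumes "prob_density f" "g \<in> borel_measurable borel"
  shows "integrable (law f) g \<longleftrightarrow> integrable lborel (\<lambda>x. f x * g x)"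
    "(\<integral>x. g x \<partial>law f) = (\<integral>x. f x * g x \<partial>lborel)"
  unfolding law_def using assms prob_densityD[OF assms(1)]
  by (simp_all add: integrable_density integral_density)

lemma prob_space_law: "prob_density f \<Longrightarrow> prob_space (law f)"
  unfolding law_def by (intro prob_spaceI) (simp add: emeasure_density prob_density_def)

lemma sets_law [simp, measurable_cong]: "sets (law f) = sets borel"
  by (simp add: law_def)

lemma hellinger_dist_commute: "hellinger_dist f g = hellinger_dist g f"
  by (simp add: hellinger_dist_def power2_commute)

section \<open>One filtering step\<close>

definition trans_density ::
  "(real^'p \<Rightarrow> real^'n^'n) \<Rightarrow> (real^'p \<Rightarrow> real^'n^'n) \<Rightarrow> real^'p \<Rightarrow> real^'n \<Rightarrow> real^'n \<Rightarrow> real" where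
  "trans_density A S \<theta> x' x = gauss_density (A \<theta> *v x') (S \<theta>) x"

definition obs_lik ::
  "(real^'p \<Rightarrow> real^'n^'r) \<Rightarrow> (real^'p \<Rightarrow> real^'r^'r) \<Rightarrow> real^'r \<Rightarrow> (real^'n) \<times> (real^'p) \<Rightarrow> real" where
  "obs_lik H G y z = gauss_density (H (snd z) *v fst z) (G (snd z)) y"

text \<open>Coefficient functions without a probability space: the analysis of the approximations
  concerns densities alone.\<close>

locale ssm_coefficients =
  fixes A :: "real^'p \<Rightarrow> real^'n^'n"
    and H :: "real^'p \<Rightarrow> real^'n^'r"
    and S :: "real^'p \<Rightarrow> real^'n^'n"
    and G :: "real^'p \<Rightarrow> real^'r^'r"
    and c :: real
  assumes coeff_measurable [measurable]: "A \<in> borel_measurable borel" "H \<in> borel_measurable borel"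
      "S \<in> borel_measurable borel" "G \<in> borel_measurable borel"
    and S_pos: "\<And>\<theta>. pos_def (S \<theta>)"
    and G_pos: "\<And>\<theta>. pos_def (G \<theta>)"
    and c_pos: "0 < c"
    and c_le: "\<And>\<theta>. c \<le> det (G \<theta>)"
begin

text \<open>The peak value of a noise density whose covariance has determinant \<open>c\<close>; all
  powers of 2 pi and \<open>c\<close> in the two coefficients come from it.\<close>

definition lik_bound :: real where
  "lik_bound = (2 * pi) powr (- real CARD('r) / 2) * c powr (- 1 / 2)"

lemma lik_bound_pos: "0 < lik_bound"
  using c_pos by (simp add: lik_bound_def)

lemma ln_lik_bound: "ln lik_bound = - (real CARD('r) / 2 * ln (2 * pi)) - 1 / 2 * ln c"
  using c_pos by (simp add: lik_bound_def ln_mult ln_powr)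

lemma obs_lik_pos: "0 < obs_lik H G y z"
  by (simp add: obs_lik_def gauss_density_pos G_pos)

lemma gauss_density_le_lik_bound: "gauss_density \<mu> (G \<theta>) y \<le> lik_bound"
proof -
  have "0 \<le> (y - \<mu>) \<bullet> (matrix_inv (G \<theta>) *v (y - \<mu>))"
    by (rule pos_def_quadratic_nonneg[OF pos_def_matrix_inv[OF G_pos]])
  moreover have "det (G \<theta>) powr (- 1 / 2) \<le> c powr (- 1 / 2)"
    using c_le c_pos by (intro powr_mono2') auto
  ultimately show ?thesis
    unfolding gauss_density_def lik_bound_def mult.assoc
    using mult_mono[of "det (G \<theta>) powr (- 1 / 2)" "c powr (- 1 / 2)" "exp (- ((y - \<mu>) \<bullet> (matrix_inv (G \<theta>) *v (y - \<mu>))) / 2)" 1]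
    by (intro mult_left_mono) auto
qed

lemma obs_lik_le: "obs_lik H G y z \<le> lik_bound"
  unfolding obs_lik_def by (rule gauss_density_le_lik_bound)

lemma obs_lik_measurable [measurable (raw)]:
  assumes [measurable]: "y \<in> borel_measurable M" "z \<in> borel_measurable M"
  shows "(\<lambda>w. obs_lik H G (y w) (z w)) \<in> borel_measurable M"
proof -
  have [measurable]: "(\<lambda>w. fst (z w)) \<in> borel_measurable M" "(\<lambda>w. snd (z w)) \<in> borel_measurable M"
    using assms(2) by (auto simp flip: borel_prod)
  show ?thesis
    unfolding obs_lik_def by (intro borel_measurable_gauss_density G_pos) measurable
qed

lemma trans_density_measurable [measurable (raw)]:
  assumes [measurable]: "\<theta> \<in> borel_measurable M" "x \<in> borel_measurable M" "x' \<in> borel_measurable M"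
  shows "(\<lambda>w. trans_density A S (\<theta> w) (x w) (x' w)) \<in> borel_measurable M"
  unfolding trans_density_def by (intro borel_measurable_gauss_density S_pos) measurable

sublocale markov_density "trans_density A S"
proof
  show "(\<lambda>(\<theta>, x', x). trans_density A S \<theta> x' x) \<in> borel_measurable borel"
    unfolding split_beta' by (simp flip: borel_prod)
qed (auto simp: trans_density_def gauss_density_nonneg nn_integral_gauss_density S_pos)

end

locale approximation = ssm_coefficients A H S G c
  for A :: "real^'p \<Rightarrow> real^'n^'n"
    and H :: "real^'p \<Rightarrow> real^'n^'r"
    and S :: "real^'p \<Rightarrow> real^'n^'n"
    and G :: "real^'p \<Rightarrow> real^'r^'r"
    and c :: real +
  fixes m :: "real^'p \<Rightarrow> real^'n" and C :: "real^'p \<Rightarrow> real^'n^'n" and \<nu> :: "real^'p \<Rightarrow> real"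
  assumes approx_measurable [measurable]: "m \<in> borel_measurable borel" "C \<in> borel_measurable borel"
    and C_pos: "\<And>\<theta>. pos_def (C \<theta>)"
    and \<nu>: "prob_density \<nu>"
begin

lemma \<nu>_measurable [measurable]: "\<nu> \<in> borel_measurable borel"
  by (rule prob_densityD(1)[OF \<nu>])

lemma prob_density_approx: "prob_density (approx m C \<nu>)"
proof -
  have [measurable]: "(\<lambda>(x, \<theta>). gauss_density (m \<theta>) (C \<theta>) x) \<in> borel_measurable (borel \<Otimes>\<^sub>M borel)"
    unfolding split_beta' by (intro borel_measurable_gauss_density C_pos) measurable
  have meas: "approx m C \<nu> \<in> borel_measurable (borel \<Otimes>\<^sub>M borel)"
    unfolding approx_def by measurable
  have "(\<integral>\<^sup>+z. ennreal (approx m C \<nu> z) \<partial>lborel)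
      = (\<integral>\<^sup>+\<theta>. \<integral>\<^sup>+x. ennreal (gauss_density (m \<theta>) (C \<theta>) x) * ennreal (\<nu> \<theta>) \<partial>lborel \<partial>lborel)"
    unfolding lborel_prod[symmetric] using meas
    by (subst lborel_pair.nn_integral_snd[symmetric])
       (auto simp: approx_def ennreal_mult gauss_density_nonneg prob_densityD(2)[OF \<nu>])
  also have "\<dots> = 1"
    by (subst nn_integral_multc) (auto simp: nn_integral_gauss_density C_pos prob_densityD(3)[OF \<nu>])
  finally show ?thesis
    using meas by (auto simp: prob_density_def borel_prod approx_def gauss_density_nonneg prob_densityD(2)[OF \<nu>])
qed

text \<open>\<open>P\<close> marks predicted and \<open>U\<close> updated moments, as functions of
  the parameter.\<close>

definition P_cov where "P_cov \<theta> = pred_cov (A \<theta>) (S \<theta>) (C \<theta>)"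
definition P_mean where "P_mean \<theta> = pred_mean (A \<theta>) (m \<theta>)"
definition U_cov where "U_cov \<theta> = F_c (A \<theta>) (H \<theta>) (S \<theta>) (G \<theta>) (C \<theta>)"
definition U_mean where "U_mean y \<theta> = F_m (A \<theta>) (H \<theta>) (S \<theta>) (G \<theta>) y (m \<theta>) (C \<theta>)"
definition marg_lik where
  "marg_lik y \<theta> = gauss_density (H \<theta> *v P_mean \<theta>) (obs_cov (A \<theta>) (H \<theta>) (S \<theta>) (G \<theta>) (C \<theta>)) y"

lemma P_cov_pos: "pos_def (P_cov \<theta>)"
  unfolding P_cov_def pred_cov_def by (rule pos_def_congruence_add[OF C_pos S_pos])

lemma obs_cov_pos: "pos_def (obs_cov (A \<theta>) (H \<theta>) (S \<theta>) (G \<theta>) (C \<theta>))"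
  unfolding obs_cov_def using pos_def_congruence_add[OF P_cov_pos G_pos] by (simp add: P_cov_def)

lemma U_cov_pos: "pos_def (U_cov \<theta>)"
  using woodbury(2)[OF P_cov_pos G_pos] by (simp add: U_cov_def F_c_def P_cov_def obs_cov_def)

lemma mean_cov_measurable [measurable]:
  "P_mean \<in> borel_measurable borel" "P_cov \<in> borel_measurable borel"
  "U_mean y \<in> borel_measurable borel" "U_cov \<in> borel_measurable borel"
  "marg_lik y \<in> borel_measurable borel"
proof -
  show [measurable]: "P_mean \<in> borel_measurable borel" "P_cov \<in> borel_measurable borel"
    unfolding P_mean_def P_cov_def pred_mean_def pred_cov_def by measurable
  have O: "(\<lambda>\<theta>. obs_cov (A \<theta>) (H \<theta>) (S \<theta>) (G \<theta>) (C \<theta>)) \<in> borel_measurable borel"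
    unfolding obs_cov_def P_cov_def[symmetric] by measurable
  have [measurable]: "(\<lambda>\<theta>. matrix_inv (obs_cov (A \<theta>) (H \<theta>) (S \<theta>) (G \<theta>) (C \<theta>))) \<in> borel_measurable borel"
    by (intro borel_measurable_matrix_inv O pos_def_invertible obs_cov_pos)
  show "U_mean y \<in> borel_measurable borel" "U_cov \<in> borel_measurable borel"
    unfolding U_mean_def U_cov_def F_m_def F_c_def P_cov_def[symmetric] P_mean_def[symmetric] by measurable
  show "marg_lik y \<in> borel_measurable borel"
    unfolding marg_lik_def by (intro borel_measurable_gauss_density O obs_cov_pos) measurable
qed

lemma pred_density_eq: "pred_density (A \<theta>) (S \<theta>) (m \<theta>) (C \<theta>) x = gauss_density (P_mean \<theta>) (P_cov \<theta>) x"
  unfolding pred_density_def P_mean_def P_cov_def pred_mean_def pred_cov_def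
  by (rule gauss_density_predict(1)[OF C_pos S_pos])

lemma incr_lik_eq: "incr_lik (A \<theta>) (H \<theta>) (S \<theta>) (G \<theta>) y (m \<theta>) (C \<theta>) = marg_lik y \<theta>"
  unfolding incr_lik_def pred_density_eq marg_lik_def obs_cov_def P_cov_def[symmetric]
  by (rule gauss_density_predict(1)[OF P_cov_pos G_pos])

lemma predict_approx:
  "predict (trans_density A S) (approx m C \<nu>) (x, \<theta>) = gauss_density (P_mean \<theta>) (P_cov \<theta>) x * \<nu> \<theta>"
  unfolding pred_density_eq[symmetric]
  by (simp add: predict_def approx_def trans_density_def pred_density_def mult.assoc[symmetric])

text \<open>By conjugacy each slice at a fixed parameter stays Gaussian under prediction and update;
  the evidence of the slice splits off and reweights the parameter density.\<close>

lemma lik_predict_approx: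
  "obs_lik H G y (x, \<theta>) * predict (trans_density A S) (approx m C \<nu>) (x, \<theta>)
    = gauss_density (U_mean y \<theta>) (U_cov \<theta>) x * (marg_lik y \<theta> * \<nu> \<theta>)"
proof -
  have "gauss_density (H \<theta> *v x) (G \<theta>) y * gauss_density (P_mean \<theta>) (P_cov \<theta>) x
      = marg_lik y \<theta> * gauss_density (U_mean y \<theta>) (U_cov \<theta>) x"
    using gauss_density_update[OF P_cov_pos G_pos, where x=x and y=y]
    by (simp add: marg_lik_def U_mean_def U_cov_def F_m_def F_c_def obs_cov_def P_cov_def P_mean_def)
  then show ?thesis
    unfolding predict_approx by (simp add: obs_lik_def mult_ac)
qed

lemma marg_lik_pos: "0 < marg_lik y \<theta>"
  unfolding marg_lik_def by (rule gauss_density_pos[OF obs_cov_pos])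

text \<open>The marginal likelihood is an average of noise densities, each below the common peak
  value.\<close>

lemma marg_lik_le: "marg_lik y \<theta> \<le> lik_bound"
proof -
  have i: "integrable lborel (gauss_density (P_mean \<theta>) (P_cov \<theta>))"
    "(\<integral>x. gauss_density (P_mean \<theta>) (P_cov \<theta>) x \<partial>lborel) = 1"
    by (rule gauss_density_integral[OF P_cov_pos])+
  have "marg_lik y \<theta> = (\<integral>x. gauss_density (H \<theta> *v x) (G \<theta>) y * gauss_density (P_mean \<theta>) (P_cov \<theta>) x \<partial>lborel)"
    unfolding marg_lik_def obs_cov_def P_cov_def[symmetric]
    by (rule gauss_density_predict(1)[OF P_cov_pos G_pos, symmetric])
  also have "\<dots> \<le> (\<integral>x. lik_bound * gauss_density (P_mean \<theta>) (P_cov \<theta>) x \<partial>lborel)"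
    using i by (intro integral_mono gauss_density_predict P_cov_pos G_pos mult_right_mono
        gauss_density_le_lik_bound gauss_density_nonneg) auto
  finally show ?thesis by (simp add: i)
qed

lemma integrable_marg_lik: "integrable lborel (\<lambda>\<theta>. marg_lik y \<theta> * \<nu> \<theta>)"
  by (rule integrable_weighted[OF _ marg_lik_pos marg_lik_le \<nu>]) simp

lemma Z_eq: "Z A H S G y m C \<nu> = (\<integral>\<theta>. marg_lik y \<theta> * \<nu> \<theta> \<partial>lborel)"
proof -
  have "Z A H S G y m C \<nu> = (\<integral>\<theta>. marg_lik y \<theta> \<partial>law \<nu>)"
    by (simp add: Z_def marg_lik_def P_mean_def)
  then show ?thesis by (simp add: integral_law[OF \<nu>] mult.commute)
qed

text \<open>Integrating the state first removes the Gaussian factor of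
  \<open>lik_predict_approx\<close>, so the normaliser of the update is the computable
  \<open>Z\<close>.\<close>

lemma evidence_eq_Z:
  "(\<integral>z. obs_lik H G y z * predict (trans_density A S) (approx m C \<nu>) z \<partial>lborel) = Z A H S G y m C \<nu>"
proof -
  note PA = prob_density_predict[OF prob_density_approx]
  have [measurable]: "predict (trans_density A S) (approx m C \<nu>) \<in> borel_measurable borel"
    by (rule prob_densityD(1)[OF PA])
  have int: "integrable (lborel \<Otimes>\<^sub>M lborel) (\<lambda>z. obs_lik H G y z * predict (trans_density A S) (approx m C \<nu>) z)"
    unfolding lborel_prod by (rule integrable_weighted[OF _ obs_lik_pos obs_lik_le PA]) measurable
  have "(\<integral>z. obs_lik H G y z * predict (trans_density A S) (approx m C \<nu>) z \<partial>lborel)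
      = (\<integral>\<theta>. \<integral>x. obs_lik H G y (x, \<theta>) * predict (trans_density A S) (approx m C \<nu>) (x, \<theta>) \<partial>lborel \<partial>lborel)"
    unfolding lborel_prod[symmetric]
    using lborel_pair.integral_snd[of "\<lambda>x \<theta>. obs_lik H G y (x, \<theta>) * predict (trans_density A S) (approx m C \<nu>) (x, \<theta>)"] int
    by (simp add: split_beta')
  also have "\<dots> = (\<integral>\<theta>. marg_lik y \<theta> * \<nu> \<theta> \<partial>lborel)"
    unfolding lik_predict_approx by (simp add: gauss_density_integral U_cov_pos)
  finally show ?thesis by (simp add: Z_eq)
qed

lemma Z_pos: "0 < Z A H S G y m C \<nu>"
  unfolding Z_eq by (rule evidence_pos[OF _ marg_lik_pos marg_lik_le \<nu>]) simp

text \<open>Through its logarithm this bound supplies the constants in \<open>r\<close> and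
  \<open>c\<close> under the square roots of the error estimate.\<close>

lemma Z_le: "Z A H S G y m C \<nu> \<le> lik_bound"
proof -
  have "(\<integral>\<theta>. marg_lik y \<theta> * \<nu> \<theta> \<partial>lborel) \<le> (\<integral>\<theta>. lik_bound * \<nu> \<theta> \<partial>lborel)"
    by (intro integral_mono integrable_marg_lik mult_right_mono marg_lik_le)
       (auto intro: prob_density_integrable prob_densityD(2)[OF \<nu>] \<nu>)
  then show ?thesis by (simp add: Z_eq prob_density_integrable[OF \<nu>])
qed

lemma update_approx:
  "bayes_update (obs_lik H G y) (predict (trans_density A S) (approx m C \<nu>)) (x, \<theta>)
    = gauss_density (U_mean y \<theta>) (U_cov \<theta>) x * (marg_lik y \<theta> * \<nu> \<theta> / Z A H S G y m C \<nu>)"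
  unfolding bayes_update_def evidence_eq_Z lik_predict_approx by simp

lemma prob_density_update_approx:
  "prob_density (bayes_update (obs_lik H G y) (predict (trans_density A S) (approx m C \<nu>)))"
  by (rule prob_density_bayes_update[OF _ obs_lik_pos obs_lik_le prob_density_predict[OF prob_density_approx]]) measurable

end

lemma esqrt_infinity: "esqrt \<infinity> = \<infinity>"
  by (simp only: infinity_ereal_def esqrt.simps)

section \<open>Divergence of the re-fitted density from the updated one\<close>

context approximation
begin

context
  fixes m' :: "real^'p \<Rightarrow> real^'n" and C' :: "real^'p \<Rightarrow> real^'n^'n" and \<nu>' :: "real^'p \<Rightarrow> real"
    and y :: "real^'r" and \<epsilon> :: real
  assumes new: "approximation A H S G c m' C' \<nu>'"
    and elbo: "ereal \<epsilon> \<le> eintegral (law \<nu>')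
        (\<lambda>\<theta>. ereal (ln (incr_lik (A \<theta>) (H \<theta>) (S \<theta>) (G \<theta>) y (m \<theta>) (C \<theta>)))) - KL_div \<nu>' \<nu>"
begin

interpretation new: approximation A H S G c m' C' \<nu>' by (rule new)

text \<open>By \<open>gain_eq\<close> this is the divergence, at a fixed parameter, from the
  re-fitted to the updated conditional Gaussian.\<close>

definition gain where
  "gain \<theta> = \<Psi> (A \<theta>) (H \<theta>) (S \<theta>) (G \<theta>) y (C' \<theta>) (m' \<theta>) (C \<theta>) (m \<theta>)"

lemma gain_eq:
  defines "g \<equiv> \<lambda>\<theta> x. gauss_density (m' \<theta>) (C' \<theta>) x
      * ln (gauss_density (m' \<theta>) (C' \<theta>) x / gauss_density (U_mean y \<theta>) (U_cov \<theta>) x)"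
  shows "integrable lborel (g \<theta>)" "(\<integral>x. g \<theta> x \<partial>lborel) = gain \<theta>" "gain \<in> borel_measurable borel"
proof -
  show i: "integrable lborel (g \<theta>)" for \<theta>
    unfolding g_def by (rule gauss_density_KL(1)[OF new.C_pos U_cov_pos])
  show eq: "(\<integral>x. g \<theta> x \<partial>lborel) = gain \<theta>" for \<theta>
    unfolding g_def gauss_density_KL(2)[OF new.C_pos U_cov_pos]
    by (simp add: gain_def \<Psi>_def Let_def U_cov_def U_mean_def)
  have [measurable]: "(\<lambda>(\<theta>, x). gauss_density (m' \<theta>) (C' \<theta>) x) \<in> borel_measurable (borel \<Otimes>\<^sub>M borel)"
    unfolding split_beta' by (intro borel_measurable_gauss_density new.C_pos) measurable
  have [measurable]: "(\<lambda>(\<theta>, x). gauss_density (U_mean y \<theta>) (U_cov \<theta>) x) \<in> borel_measurable (borel \<Otimes>\<^sub>M borel)"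
    unfolding split_beta' by (intro borel_measurable_gauss_density U_cov_pos) measurable
  \<comment> \<open>Measurability in the parameter is read off this integral instead of the explicit
    formula with its inverses and traces.\<close>
  have "(\<lambda>\<theta>. \<integral>x. g \<theta> x \<partial>lborel) \<in> borel_measurable borel"
    unfolding g_def by measurable
  then show "gain \<in> borel_measurable borel" by (simp add: eq)
qed

text \<open>The chain rule for the divergence at a fixed parameter: the logarithm of a product of
  ratios splits, and both conditional densities have mass one. As a nonnegative integral it can be
  inserted directly into Tonelli.\<close>

lemma KL_term_slice:
  assumes a: "0 \<le> a" and b: "0 \<le> b" and ab: "b = 0 \<longrightarrow> a = 0"
  shows "(\<integral>\<^sup>+x. ennreal (KL_term (gauss_density (m' \<theta>) (C' \<theta>) x * a) (gauss_density (U_mean y \<theta>) (U_cov \<theta>) x * b)) \<partial>lborel)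
      = ennreal (a * gain \<theta> + (a * ln (a / b) - a + b))"
proof -
  let ?r = "gauss_density (m' \<theta>) (C' \<theta>)" and ?n = "gauss_density (U_mean y \<theta>) (U_cov \<theta>)"
  have pos: "0 < ?r x" "0 < ?n x" for x
    by (auto intro: gauss_density_pos new.C_pos U_cov_pos)
  have eq: "KL_term (?r x * a) (?n x * b) = a * (?r x * ln (?r x / ?n x)) + (a * ln (a / b) - a) * ?r x + b * ?n x" for x
  proof (cases "a = 0")
    case True
    then show ?thesis by (simp add: KL_term_def)
  next
    case False
    then have "0 < a" "0 < b" using a b ab by auto
    moreover have "?r x * a / (?n x * b) = (?r x / ?n x) * (a / b)" by simp
    ultimately have "ln (?r x * a / (?n x * b)) = ln (?r x / ?n x) + ln (a / b)"
      using pos[of x] by (simp only: ln_mult_pos divide_pos_pos)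
    then show ?thesis by (simp add: KL_term_def algebra_simps)
  qed
  note i = gain_eq(1,2)[of \<theta>] gauss_density_integral[OF new.C_pos, of "m' \<theta>" \<theta>] gauss_density_integral[OF U_cov_pos, of "U_mean y \<theta>" \<theta>]
  have int: "integrable lborel (\<lambda>x. KL_term (?r x * a) (?n x * b))"
    unfolding eq using i by (intro Bochner_Integration.integrable_add integrable_mult_right)
  have "(\<integral>x. KL_term (?r x * a) (?n x * b) \<partial>lborel) = a * gain \<theta> + (a * ln (a / b) - a) + b"
    unfolding eq using i by simp
  moreover have "0 \<le> KL_term (?r x * a) (?n x * b)" for x
    using pos[of x] a b ab by (intro KL_term_nonneg) auto
  ultimately show ?thesis
    using int by (simp add: nn_integral_eq_integral add.assoc)
qed

text \<open>The mass terms of \<open>KL_term\<close> cancel between two probability densities. Hence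
  the expectation of \<Psi> has no negative part and is meaningful even when infinite.\<close>

lemma gain_nonneg: "0 \<le> gain \<theta>"
proof -
  have pos: "0 < gauss_density (m' \<theta>) (C' \<theta>) x" "0 < gauss_density (U_mean y \<theta>) (U_cov \<theta>) x" for x
    by (auto intro: gauss_density_pos new.C_pos U_cov_pos)
  note i = gain_eq(1,2)[of \<theta>] gauss_density_integral[OF new.C_pos, of "m' \<theta>" \<theta>] gauss_density_integral[OF U_cov_pos, of "U_mean y \<theta>" \<theta>]
  have "0 \<le> (\<integral>x. KL_term (gauss_density (m' \<theta>) (C' \<theta>) x) (gauss_density (U_mean y \<theta>) (U_cov \<theta>) x) \<partial>lborel)"
    using pos by (intro Bochner_Integration.integral_nonneg KL_term_nonneg) (auto simp: less_imp_le less_imp_neq[symmetric])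
  also have "\<dots> = gain \<theta>" unfolding KL_term_def using i by simp
  finally show ?thesis .
qed

text \<open>The logarithm of the marginal likelihood is bounded above, so its expectation is below
  infinity. The finite lower bound then excludes minus infinity for this expectation, and once the
  expectation is a real number it excludes infinity for the divergence.\<close>

lemma elbo_finite:
  "AE \<theta> in lborel. \<nu> \<theta> = 0 \<longrightarrow> \<nu>' \<theta> = 0"
  "integrable lborel (\<lambda>\<theta>. \<nu>' \<theta> * ln (\<nu>' \<theta> / \<nu> \<theta>))"
  "integrable lborel (\<lambda>\<theta>. \<nu>' \<theta> * ln (marg_lik y \<theta>))"
  "\<epsilon> \<le> (\<integral>\<theta>. \<nu>' \<theta> * ln (marg_lik y \<theta>) \<partial>lborel) - (\<integral>\<theta>. \<nu>' \<theta> * ln (\<nu>' \<theta> / \<nu> \<theta>) \<partial>lborel)"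
proof -
  interpret N: prob_space "law \<nu>'" by (rule prob_space_law[OF new.\<nu>])
  let ?E = "eintegral (law \<nu>') (\<lambda>\<theta>. ereal (ln (marg_lik y \<theta>)))"
  have el: "ereal \<epsilon> \<le> ?E - KL_div \<nu>' \<nu>" using elbo by (simp add: incr_lik_eq)
  have "(\<integral>\<^sup>+\<theta>. ennreal (ln (marg_lik y \<theta>)) \<partial>law \<nu>') \<le> (\<integral>\<^sup>+\<theta>. ennreal (ln lik_bound) \<partial>law \<nu>')"
    using marg_lik_pos marg_lik_le lik_bound_pos by (intro nn_integral_mono ennreal_leI) simp
  also have "\<dots> < \<infinity>" by (simp add: N.emeasure_space_1)
  finally have pos: "(\<integral>\<^sup>+\<theta>. ennreal (ln (marg_lik y \<theta>)) \<partial>law \<nu>') < \<infinity>" .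
  \<comment> \<open>Knowing \<open>KL_div \<nu>' \<nu> \<noteq> - \<infinity>\<close> matters: in
    \<open>ereal\<close> the difference of minus infinity and minus infinity is plus infinity, and
    the lower bound would say nothing.\<close>
  have "?E \<noteq> - \<infinity>" using el KL_div_finite(1)[OF new.\<nu> \<nu>] by (cases "KL_div \<nu>' \<nu>") auto
  then have i: "integrable (law \<nu>') (\<lambda>\<theta>. ln (marg_lik y \<theta>))"
    by (intro integrable_if_eintegral_bounded pos) auto
  then show "integrable lborel (\<lambda>\<theta>. \<nu>' \<theta> * ln (marg_lik y \<theta>))"
    by (simp add: integral_law[OF new.\<nu>])
  have E: "?E = ereal (\<integral>\<theta>. \<nu>' \<theta> * ln (marg_lik y \<theta>) \<partial>lborel)"
    by (simp add: eintegral_ereal_integrable[OF i] integral_law[OF new.\<nu>])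
  then have K: "KL_div \<nu>' \<nu> \<noteq> \<infinity>" using el by auto
  note KL = KL_div_finite(2,3,4)[OF new.\<nu> \<nu> K]
  show "AE \<theta> in lborel. \<nu> \<theta> = 0 \<longrightarrow> \<nu>' \<theta> = 0" "integrable lborel (\<lambda>\<theta>. \<nu>' \<theta> * ln (\<nu>' \<theta> / \<nu> \<theta>))"
    by (rule KL)+
  show "\<epsilon> \<le> (\<integral>\<theta>. \<nu>' \<theta> * ln (marg_lik y \<theta>) \<partial>lborel) - (\<integral>\<theta>. \<nu>' \<theta> * ln (\<nu>' \<theta> / \<nu> \<theta>) \<partial>lborel)"
    using el unfolding E KL(3) by simp
qed

text \<open>The parameter part of the chain rule compares \<open>\<nu>'\<close> with the reweighted
  density \<open>b\<close>, not with \<open>\<nu>\<close>; splitting the logarithm of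
  \<open>b\<close> is what brings in the marginal likelihood and \<open>ln Z0\<close>. Nonnegativity
  of \<open>K\<close> is inherited from the integral and gives the later square root its
  meaning.\<close>

lemma one_step_KL:
  assumes e: "integrable lborel (\<lambda>\<theta>. \<nu>' \<theta> * gain \<theta>)"
  defines "\<phi> \<equiv> bayes_update (obs_lik H G y) (predict (trans_density A S) (approx m C \<nu>))"
    and "K \<equiv> (\<integral>\<theta>. \<nu>' \<theta> * gain \<theta> \<partial>lborel) - real CARD('r) / 2 * ln (2 * pi) - 1 / 2 * ln c - \<epsilon>"
  shows "(\<integral>\<^sup>+z. ennreal (KL_term (approx m' C' \<nu>' z) (\<phi> z)) \<partial>lborel) \<le> ennreal K" "0 \<le> K"
    "AE z in lborel. \<phi> z = 0 \<longrightarrow> approx m' C' \<nu>' z = 0"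
proof -
  note ef = elbo_finite
  define Z0 where "Z0 = Z A H S G y m C \<nu>"
  define b where "b \<theta> = marg_lik y \<theta> * \<nu> \<theta> / Z0" for \<theta>
  have Z0: "0 < Z0" "Z0 \<le> lik_bound" using Z_pos Z_le by (auto simp: Z0_def)
  note nn = prob_densityD(2)[OF \<nu>] prob_densityD(2)[OF new.\<nu>]
  have b_nn: "0 \<le> b \<theta>" for \<theta> using nn Z0 marg_lik_pos[of y \<theta>] by (simp add: b_def)
  have b0: "b \<theta> = 0 \<longleftrightarrow> \<nu> \<theta> = 0" for \<theta> using Z0 marg_lik_pos[of y \<theta>] by (simp add: b_def)
  have bi: "integrable lborel b" "(\<integral>\<theta>. b \<theta> \<partial>lborel) = 1"
    unfolding b_def using integrable_marg_lik[of y] Z0 by (auto simp: Z0_def Z_eq)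
  have phi: "\<phi> (x, \<theta>) = gauss_density (U_mean y \<theta>) (U_cov \<theta>) x * b \<theta>" for x \<theta>
    by (simp add: \<phi>_def update_approx b_def Z0_def)
  have app: "approx m' C' \<nu>' (x, \<theta>) = gauss_density (m' \<theta>) (C' \<theta>) x * \<nu>' \<theta>" for x \<theta>
    by (simp add: approx_def)
  have pd: "prob_density \<phi>" "prob_density (approx m' C' \<nu>')"
    unfolding \<phi>_def by (rule prob_density_update_approx new.prob_density_approx)+
  note [measurable] = pd[THEN prob_densityD(1)]
  have [measurable]: "(\<lambda>z. KL_term (approx m' C' \<nu>' z) (\<phi> z)) \<in> borel_measurable borel"
    unfolding KL_term_def by measurable
  \<comment> \<open>The logarithm is split so that every summand is integrable by itself. The split
    is valid almost everywhere because \<open>\<nu>'\<close> vanishes where \<open>\<nu>\<close>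
    does; where \<open>\<nu>'\<close> is 0, both expressions reduce to \<open>b\<close>.\<close>
  define w where "w \<theta> = \<nu>' \<theta> * ln (\<nu>' \<theta> / \<nu> \<theta>) - \<nu>' \<theta> * ln (marg_lik y \<theta>) + ln Z0 * \<nu>' \<theta> - \<nu>' \<theta> + b \<theta>" for \<theta>
  have w: "AE \<theta> in lborel. \<nu>' \<theta> * ln (\<nu>' \<theta> / b \<theta>) - \<nu>' \<theta> + b \<theta> = w \<theta>"
    using ef(1)
  proof eventually_elim
    case (elim \<theta>)
    show ?case
    proof (cases "\<nu>' \<theta> = 0")
      case True then show ?thesis by (simp add: w_def)
    next
      case False
      then have "0 < \<nu>' \<theta>" "0 < \<nu> \<theta>" using elim nn by (auto simp: less_le)
      then have "ln (\<nu>' \<theta> / b \<theta>) = ln (\<nu>' \<theta> / \<nu> \<theta>) - ln (marg_lik y \<theta>) + ln Z0"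
        using Z0 marg_lik_pos[of y \<theta>] by (simp add: b_def ln_div ln_mult)
      then show ?thesis by (simp only: w_def) (simp add: algebra_simps)
    qed
  qed
  note \<nu>i = prob_density_integrable[OF new.\<nu>]
  have wi: "integrable lborel w"
    unfolding w_def using ef bi \<nu>i by (intro Bochner_Integration.integrable_add Bochner_Integration.integrable_diff integrable_mult_right)
  have W: "(\<integral>\<theta>. w \<theta> \<partial>lborel) = (\<integral>\<theta>. \<nu>' \<theta> * ln (\<nu>' \<theta> / \<nu> \<theta>) \<partial>lborel) - (\<integral>\<theta>. \<nu>' \<theta> * ln (marg_lik y \<theta>) \<partial>lborel) + ln Z0"
    unfolding w_def using ef bi \<nu>i by simp
  have tot_nn: "AE \<theta> in lborel. 0 \<le> \<nu>' \<theta> * gain \<theta> + w \<theta>"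
    using w ef(1)
  proof eventually_elim
    case (elim \<theta>)
    have "0 \<le> KL_term (\<nu>' \<theta>) (b \<theta>)" using elim nn b_nn b0 by (intro KL_term_nonneg) auto
    then show ?case
      using elim nn gain_nonneg[of \<theta>] by (simp add: KL_term_def)
  qed
  have "(\<integral>\<^sup>+z. ennreal (KL_term (approx m' C' \<nu>' z) (\<phi> z)) \<partial>lborel)
      = (\<integral>\<^sup>+\<theta>. \<integral>\<^sup>+x. ennreal (KL_term (approx m' C' \<nu>' (x, \<theta>)) (\<phi> (x, \<theta>))) \<partial>lborel \<partial>lborel)"
    unfolding lborel_prod[symmetric] by (subst lborel_pair.nn_integral_snd) (auto simp: lborel_prod)
  also have "\<dots> = (\<integral>\<^sup>+\<theta>. ennreal (\<nu>' \<theta> * gain \<theta> + w \<theta>) \<partial>lborel)"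
    using ef(1) w
    by (intro nn_integral_cong_AE, eventually_elim) (simp add: app phi KL_term_slice nn b_nn b0)
  also have "\<dots> = ennreal (\<integral>\<theta>. \<nu>' \<theta> * gain \<theta> + w \<theta> \<partial>lborel)"
    using e wi tot_nn by (intro nn_integral_eq_integral) auto
  finally have eq: "(\<integral>\<^sup>+z. ennreal (KL_term (approx m' C' \<nu>' z) (\<phi> z)) \<partial>lborel) = ennreal (\<integral>\<theta>. \<nu>' \<theta> * gain \<theta> + w \<theta> \<partial>lborel)" .
  \<comment> \<open>Here the unknown evidence is traded for the constants of
    \<open>ln_lik_bound\<close>.\<close>
  have "ln Z0 \<le> ln lik_bound" using Z0 by simp
  then have le: "(\<integral>\<theta>. \<nu>' \<theta> * gain \<theta> + w \<theta> \<partial>lborel) \<le> K"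
    using ef(4) e wi W unfolding K_def ln_lik_bound by simp
  show "(\<integral>\<^sup>+z. ennreal (KL_term (approx m' C' \<nu>' z) (\<phi> z)) \<partial>lborel) \<le> ennreal K"
    unfolding eq by (rule ennreal_leI[OF le])
  have "0 \<le> (\<integral>\<theta>. \<nu>' \<theta> * gain \<theta> + w \<theta> \<partial>lborel)" using tot_nn by (rule integral_nonneg_AE)
  then show "0 \<le> K" using le by linarith
  have *: "{z. \<phi> z = 0 \<longrightarrow> approx m' C' \<nu>' z = 0} \<in> sets (borel \<Otimes>\<^sub>M borel)"
    unfolding borel_prod by measurable
  have "AE \<theta> in lborel. AE x in lborel. \<phi> (x, \<theta>) = 0 \<longrightarrow> approx m' C' \<nu>' (x, \<theta>) = 0"
    using ef(1)
  proof eventually_elim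
    case (elim \<theta>)
    have "0 < gauss_density (U_mean y \<theta>) (U_cov \<theta>) x" for x by (rule gauss_density_pos[OF U_cov_pos])
    then show ?case using elim b0 by (auto simp: phi app less_imp_neq[symmetric])
  qed
  \<comment> \<open>\<open>AE_pair_measure\<close> iterates with the state outside, whereas absolute
    continuity is available with the parameter outside.\<close>
  then have "AE x in lborel. AE \<theta> in lborel. \<phi> (x, \<theta>) = 0 \<longrightarrow> approx m' C' \<nu>' (x, \<theta>) = 0"
    by (subst lborel_pair.AE_commute) (auto simp: space_pair_measure *)
  then show "AE z in lborel. \<phi> z = 0 \<longrightarrow> approx m' C' \<nu>' z = 0"
    unfolding lborel_prod[symmetric] by (intro lborel_pair.AE_pair_measure) (auto simp: space_pair_measure *)
qed

text \<open>An infinite expectation of \<Psi> leaves nothing to prove. Otherwise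
  \<open>one_step_KL\<close> applies; the divergence starts from the re-fitted density while the
  triangle inequality wants the updated one first, which symmetry of the distances permits. The sign
  of \<open>E\<close> is recorded for sums in \<open>ereal\<close>.\<close>

lemma one_step_distance:
  defines "\<phi> \<equiv> bayes_update (obs_lik H G y) (predict (trans_density A S) (approx m C \<nu>))"
    and "E \<equiv> esqrt (eintegral (law \<nu>') (\<lambda>\<theta>. ereal (\<Psi> (A \<theta>) (H \<theta>) (S \<theta>) (G \<theta>) y (C' \<theta>) (m' \<theta>) (C \<theta>) (m \<theta>)))
      - ereal (real CARD('r) / 2 * ln (2 * pi)) - ereal (1 / 2 * ln c) - ereal \<epsilon>)"
  shows "ereal (tv_dist \<phi> (approx m' C' \<nu>')) \<le> ereal (1 / sqrt 2) * E"
    "ereal (hellinger_dist \<phi> (approx m' C' \<nu>')) \<le> ereal (1 / sqrt 2) * E"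
    "0 \<le> E"
proof -
  have [measurable]: "gain \<in> borel_measurable borel" by (rule gain_eq(3))
  let ?I = "eintegral (law \<nu>') (\<lambda>\<theta>. ereal (gain \<theta>))"
  have E: "E = esqrt (?I - ereal (real CARD('r) / 2 * ln (2 * pi)) - ereal (1 / 2 * ln c) - ereal \<epsilon>)"
    by (simp add: E_def gain_def)
  have I: "?I = enn2ereal (\<integral>\<^sup>+\<theta>. ennreal (gain \<theta>) \<partial>law \<nu>')"
    by (simp add: eintegral_def e2ennreal_ereal ennreal_neg gain_nonneg zero_ennreal.rep_eq)
  have *: "ereal (tv_dist \<phi> (approx m' C' \<nu>')) \<le> ereal (1 / sqrt 2) * E
    \<and> ereal (hellinger_dist \<phi> (approx m' C' \<nu>')) \<le> ereal (1 / sqrt 2) * E \<and> 0 \<le> E"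
  proof (cases "(\<integral>\<^sup>+\<theta>. ennreal (gain \<theta>) \<partial>law \<nu>') = \<infinity>")
    case True
    then have "E = \<infinity>" by (simp add: E I esqrt_infinity)
    then show ?thesis by simp
  next
    case False
    then have i: "integrable (law \<nu>') gain"
      by (intro integrableI_bounded) (auto simp: gain_nonneg less_top)
    then have e: "integrable lborel (\<lambda>\<theta>. \<nu>' \<theta> * gain \<theta>)" by (simp add: integral_law[OF new.\<nu>])
    define K where "K = (\<integral>\<theta>. \<nu>' \<theta> * gain \<theta> \<partial>lborel) - real CARD('r) / 2 * ln (2 * pi) - 1 / 2 * ln c - \<epsilon>"
    have EK: "E = ereal (sqrt K)"
      unfolding E eintegral_ereal_integrable[OF i] by (simp add: integral_law[OF new.\<nu>] K_def)
    note KL = one_step_KL[OF e, folded \<phi>_def K_def]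
    have pd: "prob_density \<phi>" "prob_density (approx m' C' \<nu>')"
      unfolding \<phi>_def by (rule prob_density_update_approx new.prob_density_approx)+
    show ?thesis
      using distances_le_sqrt_KL[OF pd(2,1) KL(3,1,2)] KL(2)
      by (simp add: EK tv_dist_commute[of \<phi>] hellinger_dist_commute[of \<phi>])
  qed
  then show "ereal (tv_dist \<phi> (approx m' C' \<nu>')) \<le> ereal (1 / sqrt 2) * E"
    "ereal (hellinger_dist \<phi> (approx m' C' \<nu>')) \<le> ereal (1 / sqrt 2) * E" "0 \<le> E" by auto
qed

end

end

section \<open>The joint law of state, parameter and observations\<close>

lemma measure_eqI_rectangles:
  assumes sets: "sets \<mu> = sets (M1 \<Otimes>\<^sub>M M2)" "sets \<mu>' = sets (M1 \<Otimes>\<^sub>M M2)"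
    and eq: "\<And>E B. E \<in> sets M1 \<Longrightarrow> B \<in> sets M2 \<Longrightarrow> emeasure \<mu> (E \<times> B) = emeasure \<mu>' (E \<times> B)"
    and fin: "emeasure \<mu> (space M1 \<times> space M2) \<noteq> \<infinity>"
  shows "\<mu> = \<mu>'"
proof (rule measure_eqI_generator_eq)
  let ?E = "{a \<times> b | a b. a \<in> sets M1 \<and> b \<in> sets M2}"
  show "Int_stable ?E" by (rule Int_stable_pair_measure_generator)
  show "?E \<subseteq> Pow (space M1 \<times> space M2)" by (rule pair_measure_closed)
  show "sets \<mu> = sigma_sets (space M1 \<times> space M2) ?E" "sets \<mu>' = sigma_sets (space M1 \<times> space M2) ?E"
    using sets by (simp_all add: sets_pair_measure)
  show "range (\<lambda>_::nat. space M1 \<times> space M2) \<subseteq> ?E" by blast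
qed (use eq fin in auto)

text \<open>State and observation equations mix old variables with new noise, so rectangles have to
  be extended to arbitrary Borel sets \<open>F\<close>. The event \<open>Q\<close> carries along
  everything else that the induction keeps track of.\<close>

lemma (in finite_measure) joint_law_of_rectangles:
  fixes Z :: "'a \<Rightarrow> 'z::euclidean_space" and N :: "'a \<Rightarrow> 'n::euclidean_space"
    and u :: "'z \<Rightarrow> ennreal" and k :: "'z \<Rightarrow> 'n \<Rightarrow> ennreal"
  assumes [measurable]: "Z \<in> borel_measurable M" "N \<in> borel_measurable M" "Q \<in> sets M"
      "u \<in> borel_measurable borel" "(\<lambda>(z, n). k z n) \<in> borel_measurable (borel \<Otimes>\<^sub>M borel)"
    and eq: "\<And>E B. E \<in> sets borel \<Longrightarrow> B \<in> sets borel \<Longrightarrow>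
        emeasure M {\<omega>\<in>space M. Z \<omega> \<in> E \<and> N \<omega> \<in> B \<and> \<omega> \<in> Q}
        = (\<integral>\<^sup>+z. u z * indicator E z * (\<integral>\<^sup>+n. k z n * indicator B n \<partial>lborel) \<partial>lborel)"
    and F [measurable]: "F \<in> sets (borel \<Otimes>\<^sub>M borel)"
  shows "emeasure M {\<omega>\<in>space M. (Z \<omega>, N \<omega>) \<in> F \<and> \<omega> \<in> Q}
    = (\<integral>\<^sup>+z. u z * (\<integral>\<^sup>+n. k z n * indicator F (z, n) \<partial>lborel) \<partial>lborel)"
proof -
  define \<mu> where "\<mu> = distr (density M (indicator Q)) (borel \<Otimes>\<^sub>M borel) (\<lambda>\<omega>. (Z \<omega>, N \<omega>))"
  define \<mu>' where "\<mu>' = density (lborel \<Otimes>\<^sub>M lborel) (\<lambda>(z, n). u z * k z n)"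
  have \<mu>: "emeasure \<mu> F = emeasure M {\<omega>\<in>space M. (Z \<omega>, N \<omega>) \<in> F \<and> \<omega> \<in> Q}"
    if [measurable]: "F \<in> sets (borel \<Otimes>\<^sub>M borel)" for F
  proof -
    have "emeasure \<mu> F = (\<integral>\<^sup>+\<omega>. indicator Q \<omega> * indicator ((\<lambda>\<omega>. (Z \<omega>, N \<omega>)) -` F \<inter> space M) \<omega> \<partial>M)"
      unfolding \<mu>_def by (subst emeasure_distr) (auto simp: emeasure_density)
    also have "\<dots> = (\<integral>\<^sup>+\<omega>. indicator {\<omega>\<in>space M. (Z \<omega>, N \<omega>) \<in> F \<and> \<omega> \<in> Q} \<omega> \<partial>M)"
      by (intro nn_integral_cong) (auto simp: indicator_def)
    finally show ?thesis by simp
  qed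
  have \<mu>': "emeasure \<mu>' F = (\<integral>\<^sup>+z. u z * (\<integral>\<^sup>+n. k z n * indicator F (z, n) \<partial>lborel) \<partial>lborel)"
    if [measurable]: "F \<in> sets (borel \<Otimes>\<^sub>M borel)" for F
  proof -
    have "emeasure \<mu>' F = (\<integral>\<^sup>+p. (case p of (z, n) \<Rightarrow> u z * k z n) * indicator F p \<partial>(lborel \<Otimes>\<^sub>M lborel))"
      unfolding \<mu>'_def by (subst emeasure_density) auto
    also have "\<dots> = (\<integral>\<^sup>+z. \<integral>\<^sup>+n. u z * (k z n * indicator F (z, n)) \<partial>lborel \<partial>lborel)"
      by (subst lborel.nn_integral_fst[symmetric]) (auto simp: mult.assoc)
    also have "\<dots> = (\<integral>\<^sup>+z. u z * (\<integral>\<^sup>+n. k z n * indicator F (z, n) \<partial>lborel) \<partial>lborel)"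
      by (subst nn_integral_cmult) auto
    finally show ?thesis .
  qed
  have "\<mu> = \<mu>'"
  proof (rule measure_eqI_rectangles[where ?M1.0=borel and ?M2.0=borel])
    fix E B assume [measurable]: "E \<in> sets (borel :: 'z measure)" "B \<in> sets (borel :: 'n measure)"
    have "emeasure \<mu> (E \<times> B) = emeasure M {\<omega>\<in>space M. Z \<omega> \<in> E \<and> N \<omega> \<in> B \<and> \<omega> \<in> Q}"
      by (subst \<mu>) (auto intro!: arg_cong[where f="emeasure M"])
    also have "\<dots> = emeasure \<mu>' (E \<times> B)"
      by (subst eq) (auto simp: \<mu>' indicator_times nn_integral_cmult[symmetric] mult_ac intro!: nn_integral_cong)
    finally show "emeasure \<mu> (E \<times> B) = emeasure \<mu>' (E \<times> B)" .
  next
    show "emeasure \<mu> (space borel \<times> space borel) \<noteq> \<infinity>"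
      using \<mu>[OF sets.top] by (simp add: space_pair_measure emeasure_eq_measure)
  qed (simp_all add: \<mu>_def \<mu>'_def)
  then show ?thesis using \<mu>[OF F] \<mu>'[OF F] by simp
qed

text \<open>The density of \<open>(X j, \<Theta>)\<close> restricted to the event that \<open>Y i \<in> D i\<close> for \<open>i = 1, \<dots>, j\<close>.\<close>

primrec obs_event_density ::
  "(real^'p \<Rightarrow> real^'n^'n) \<Rightarrow> (real^'p \<Rightarrow> real^'n^'r) \<Rightarrow> (real^'p \<Rightarrow> real^'n^'n) \<Rightarrow> (real^'p \<Rightarrow> real^'r^'r)
    \<Rightarrow> (nat \<Rightarrow> (real^'r) set) \<Rightarrow> ((real^'n) \<times> (real^'p) \<Rightarrow> ennreal) \<Rightarrow> nat \<Rightarrow> (real^'n) \<times> (real^'p) \<Rightarrow> ennreal" where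
  "obs_event_density A H S G D q 0 = q"
| "obs_event_density A H S G D q (Suc j) = (\<lambda>z.
    (\<integral>\<^sup>+v. ennreal (obs_lik H G v z) * indicator (D (Suc j)) v \<partial>lborel) *
    (\<integral>\<^sup>+x'. ennreal (trans_density A S (snd z) x' (fst z)) * obs_event_density A H S G D q j (x', snd z) \<partial>lborel))"

locale bounded_ssm = linear_gaussian_ssm M A H S G m0 C0 \<nu>0 \<Theta> X Y W V
  for M :: "'w measure"
    and A :: "real^'p \<Rightarrow> real^'n^'n"
    and H :: "real^'p \<Rightarrow> real^'n^'r"
    and S :: "real^'p \<Rightarrow> real^'n^'n"
    and G :: "real^'p \<Rightarrow> real^'r^'r"
    and m0 :: "real^'p \<Rightarrow> real^'n"
    and C0 :: "real^'p \<Rightarrow> real^'n^'n"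
    and \<nu>0 :: "real^'p \<Rightarrow> real"
    and \<Theta> :: "'w \<Rightarrow> real^'p"
    and X :: "nat \<Rightarrow> 'w \<Rightarrow> real^'n"
    and Y :: "nat \<Rightarrow> 'w \<Rightarrow> real^'r"
    and W :: "nat \<Rightarrow> 'w \<Rightarrow> real^'n"
    and V :: "nat \<Rightarrow> 'w \<Rightarrow> real^'r" +
  fixes c :: real
  assumes bound: "0 < c" "\<And>\<theta>. c \<le> det (G \<theta>)"
begin

sublocale prior: approximation A H S G c m0 C0 \<nu>0
  by unfold_locales
     (rule A_measurable H_measurable S_measurable G_measurable S_pos_def G_pos_def bound
        m0_measurable C0_measurable C0_pos_def prior_density)+

declare X0_measurable [measurable] W_measurable [measurable]

lemma V_measurable' [measurable (raw)]: "1 \<le> i \<Longrightarrow> V i \<in> borel_measurable M"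
  by (rule V_measurable)

lemma Theta_measurable [measurable]: "\<Theta> \<in> borel_measurable M"
  using distributed_measurable[OF parameter_prior] by simp

lemma X_measurable [measurable]: "X i \<in> borel_measurable M"
proof (induction i)
  case (Suc i)
  note [measurable] = Suc
  have "(\<lambda>\<omega>. A (\<Theta> \<omega>) *v X i \<omega> + W i \<omega>) \<in> borel_measurable M" by measurable
  then show ?case by (rule measurable_cong[THEN iffD2, rotated]) (simp add: state_eq)
qed simp

lemma Y_measurable [measurable (raw)]:
  assumes "1 \<le> i"
  shows "Y i \<in> borel_measurable M"
proof -
  note [measurable] = V_measurable[OF assms]
  have "(\<lambda>\<omega>. H (\<Theta> \<omega>) *v X i \<omega> + V i \<omega>) \<in> borel_measurable M" by measurable
  then show ?thesis by (rule measurable_cong[THEN iffD2, rotated]) (rule obs_eq[OF _ assms])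
qed

lemma emeasure_gauss_measure:
  "B \<in> sets borel \<Longrightarrow> emeasure (gauss_measure \<mu> R) B = (\<integral>\<^sup>+w. ennreal (gauss_density \<mu> R w) * indicator B w \<partial>lborel)"
  by (simp add: gauss_measure_def emeasure_density)

lemma emeasure_gauss_measure_measurable:
  fixes R :: "real^'p \<Rightarrow> real^'i^'i"
  assumes [measurable]: "\<mu> \<in> borel_measurable borel" "R \<in> borel_measurable borel" "B \<in> sets borel"
    and R: "\<And>\<theta>. pos_def (R \<theta>)"
  shows "(\<lambda>\<theta>. emeasure (gauss_measure (\<mu> \<theta>) (R \<theta>)) B) \<in> borel_measurable borel"
proof -
  have [measurable]: "(\<lambda>(\<theta>, w). gauss_density (\<mu> \<theta>) (R \<theta>) w) \<in> borel_measurable (borel \<Otimes>\<^sub>M borel)"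
    unfolding split_beta' by (intro borel_measurable_gauss_density R) measurable
  show ?thesis by (simp add: emeasure_gauss_measure)
qed

context
  fixes K :: nat and D :: "nat \<Rightarrow> (real^'r) set"
  assumes D [measurable]: "\<And>i. D i \<in> sets borel"
begin

text \<open>The conditional probability, given the parameter, that the noises not yet used lie in
  prescribed sets. The separate indices \<open>i\<close> and \<open>j\<close> allow for half a step,
  when \<open>W j\<close> has been used and \<open>V (Suc j)\<close> has not.\<close>

definition future_weight :: "nat \<Rightarrow> (nat \<Rightarrow> (real^'n) set) \<Rightarrow> nat \<Rightarrow> (nat \<Rightarrow> (real^'r) set) \<Rightarrow> real^'p \<Rightarrow> ennreal" where
  "future_weight i B j D' \<theta> = (\<Prod>i\<in>{i..<K}. emeasure (gauss_measure 0 (S \<theta>)) (B i))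
    * (\<Prod>i\<in>{j<..K}. emeasure (gauss_measure 0 (G \<theta>)) (D' i))"

lemma future_weight_measurable [measurable]:
  assumes "\<And>i. B i \<in> sets borel" "\<And>i. D' i \<in> sets borel"
  shows "future_weight i B j D' \<in> borel_measurable borel"
  unfolding future_weight_def using assms
  by (intro borel_measurable_times_ennreal borel_measurable_prod_ennreal emeasure_gauss_measure_measurable)
     (auto simp: S_pos_def G_pos_def S_measurable G_measurable)

abbreviation obs_density where
  "obs_density \<equiv> obs_event_density A H S G D (\<lambda>z. ennreal (approx m0 C0 \<nu>0 z))"

lemma obs_density_measurable [measurable]: "obs_density j \<in> borel_measurable borel"
proof (induction j)
  case 0
  then show ?case using prob_densityD(1)[OF prior.prob_density_approx] by simp
next
  case (Suc j)
  note [measurable] = Suc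
  have "(\<lambda>z. \<integral>\<^sup>+v. ennreal (obs_lik H G v z) * indicator (D (Suc j)) v \<partial>lborel) \<in> borel_measurable borel"
    by measurable
  moreover have "(\<lambda>z. \<integral>\<^sup>+x'. ennreal (trans_density A S (snd z) x' (fst z)) * obs_density j (x', snd z) \<partial>lborel) \<in> borel_measurable (borel \<Otimes>\<^sub>M borel)"
    by measurable
  ultimately show ?case by (simp add: borel_prod)
qed

text \<open>The conditional law of the model enters here: integrating the conditional probability
  over the event that \<open>\<Theta>\<close> lies in \<open>T\<close> gives the probability of the
  intersection, and the law of \<open>\<Theta>\<close> makes this an integral over
  parameters.\<close>

lemma prior_rectangle:
  assumes [measurable]: "\<And>i. B i \<in> sets borel" "\<And>i. D' i \<in> sets borel" "T \<in> sets borel" "B0 \<in> sets borel"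
  shows "emeasure M {\<omega>\<in>space M. \<Theta> \<omega> \<in> T \<and> X 0 \<omega> \<in> B0 \<and> \<omega> \<in>
      {\<omega>\<in>space M. (\<forall>i\<in>{0..<K}. W i \<omega> \<in> B i) \<and> (\<forall>i\<in>{0<..K}. V i \<omega> \<in> D' i)}}
    = (\<integral>\<^sup>+\<theta>. ennreal (\<nu>0 \<theta>) * future_weight 0 B 0 D' \<theta> * indicator T \<theta>
        * (\<integral>\<^sup>+x. ennreal (gauss_density (m0 \<theta>) (C0 \<theta>) x) * indicator B0 x \<partial>lborel) \<partial>lborel)"
proof -
  let ?F = "vimage_algebra (space M) \<Theta> borel"
  have sub: "subalgebra M ?F"
    using Theta_measurable by (auto simp: subalgebra_def sets_vimage_algebra2 dest: measurable_sets)
  interpret F: finite_measure_subalgebra M ?F by unfold_locales (rule sub)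
  define Q where "Q = {\<omega>\<in>space M. X 0 \<omega> \<in> B0 \<and> (\<forall>i\<in>{..<K}. W i \<omega> \<in> B i) \<and> (\<forall>i\<in>{1..K}. V i \<omega> \<in> D' i)}"
  define A0 where "A0 = \<Theta> -` T \<inter> space M"
  have A0: "A0 \<in> sets ?F" unfolding A0_def by (rule in_vimage_algebra) simp
  have [measurable]: "Q \<in> sets M" "A0 \<in> sets M" unfolding Q_def A0_def by measurable
  define p where "p \<theta> = measure (gauss_measure (m0 \<theta>) (C0 \<theta>)) B0
    * (\<Prod>i\<in>{..<K}. measure (gauss_measure 0 (S \<theta>)) (B i))
    * (\<Prod>i\<in>{1..K}. measure (gauss_measure 0 (G \<theta>)) (D' i))" for \<theta>
  have em: "ennreal (measure (gauss_measure \<mu> R) U) = emeasure (gauss_measure \<mu> R) U" if "pos_def R" for \<mu> :: "real^'i" and R U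
    using prob_space.finite_measure[OF prob_space_gauss_measure[OF that, of \<mu>]] by (simp add: finite_measure.emeasure_eq_measure)
  have ep: "ennreal (p \<theta>) = emeasure (gauss_measure (m0 \<theta>) (C0 \<theta>)) B0 * future_weight 0 B 0 D' \<theta>" for \<theta>
  proof -
    have "{0<..K} = {1..K}" by auto
    then show ?thesis
      unfolding p_def future_weight_def
      by (simp add: ennreal_mult prod_nonneg em S_pos_def G_pos_def C0_pos_def atLeast0LessThan mult.assoc flip: prod_ennreal)
  qed
  have p_nn: "0 \<le> p \<theta>" for \<theta> by (simp add: p_def prod_nonneg)
  have mC: "(\<lambda>\<theta>. emeasure (gauss_measure (m0 \<theta>) (C0 \<theta>)) B0) \<in> borel_measurable borel"
    by (rule emeasure_gauss_measure_measurable) (auto simp: m0_measurable C0_measurable C0_pos_def)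
  have [measurable]: "p \<in> borel_measurable borel"
  proof -
    have "p = (\<lambda>\<theta>. enn2real (emeasure (gauss_measure (m0 \<theta>) (C0 \<theta>)) B0 * future_weight 0 B 0 D' \<theta>))"
      by (simp add: fun_eq_iff ep[symmetric] p_nn)
    also have "\<dots> \<in> borel_measurable borel" using mC by measurable
    finally show ?thesis .
  qed
  \<comment> \<open>The defining property of the conditional expectation, on an event of the
    sub-algebra generated by \<open>\<Theta>\<close>.\<close>
  have "measure M (A0 \<inter> Q) = (\<integral>\<omega>\<in>A0. indicator Q \<omega> \<partial>M)"
    by (simp add: set_lebesgue_integral_def indicator_inter_arith[symmetric])
  also have "\<dots> = (\<integral>\<omega>\<in>A0. real_cond_exp M ?F (indicator Q) \<omega> \<partial>M)"
    by (rule F.real_cond_exp_intA[OF _ A0]) (simp add: emeasure_eq_measure)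
  also have "\<dots> = (\<integral>\<omega>\<in>A0. p (\<Theta> \<omega>) \<partial>M)"
    unfolding set_lebesgue_integral_def
  proof (rule integral_cong_AE)
    show "AE \<omega> in M. indicator A0 \<omega> *\<^sub>R real_cond_exp M ?F (indicator Q) \<omega> = indicator A0 \<omega> *\<^sub>R p (\<Theta> \<omega>)"
      using cond_law[of B0 B D' K] by (simp add: Q_def p_def) (auto elim: eventually_mono)
  qed auto
  finally have 1: "measure M (A0 \<inter> Q) = (\<integral>\<omega>. indicator T (\<Theta> \<omega>) * p (\<Theta> \<omega>) \<partial>M)"
    by (simp add: set_lebesgue_integral_def A0_def indicator_def cong: Bochner_Integration.integral_cong)
  have p_le: "indicator T \<theta> * p \<theta> \<le> 1" for \<theta>
  proof -
    have "p \<theta> \<le> 1"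
      unfolding p_def
      by (intro mult_le_one mult_nonneg_nonneg prod_le_1 prod_nonneg)
         (auto intro!: prob_space.prob_le_1 prob_space_gauss_measure C0_pos_def S_pos_def G_pos_def)
    then show ?thesis by (simp add: indicator_def)
  qed
  have int: "integrable M (\<lambda>\<omega>. indicator T (\<Theta> \<omega>) * p (\<Theta> \<omega>))"
    using p_le p_nn by (intro integrable_const_bound[where B=1]) auto
  have "emeasure M (A0 \<inter> Q) = (\<integral>\<^sup>+\<omega>. ennreal (indicator T (\<Theta> \<omega>) * p (\<Theta> \<omega>)) \<partial>M)"
    using int p_nn by (simp add: emeasure_eq_measure 1 nn_integral_eq_integral)
  also have "\<dots> = (\<integral>\<^sup>+\<theta>. ennreal (\<nu>0 \<theta>) * ennreal (indicator T \<theta> * p \<theta>) \<partial>lborel)"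
    by (rule distributed_nn_integral[OF parameter_prior, symmetric]) simp
  also have "\<dots> = (\<integral>\<^sup>+\<theta>. ennreal (\<nu>0 \<theta>) * future_weight 0 B 0 D' \<theta> * indicator T \<theta>
        * (\<integral>\<^sup>+x. ennreal (gauss_density (m0 \<theta>) (C0 \<theta>) x) * indicator B0 x \<partial>lborel) \<partial>lborel)"
    by (intro nn_integral_cong) (simp add: ennreal_mult p_nn ep emeasure_gauss_measure mult_ac ennreal_indicator)
  also have "A0 \<inter> Q = {\<omega>\<in>space M. \<Theta> \<omega> \<in> T \<and> X 0 \<omega> \<in> B0 \<and> \<omega> \<in>
      {\<omega>\<in>space M. (\<forall>i\<in>{0..<K}. W i \<omega> \<in> B i) \<and> (\<forall>i\<in>{0<..K}. V i \<omega> \<in> D' i)}}"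
    by (auto simp: A0_def Q_def)
  finally show ?thesis .
qed

text \<open>The first \<open>l\<close> observations are already absorbed, the later noises are held
  in reserve. Independence is available for whole rectangles of noises, and this form allows it to
  be spent one noise at a time.\<close>

definition past_future :: "nat \<Rightarrow> nat \<Rightarrow> (nat \<Rightarrow> (real^'n) set) \<Rightarrow> nat \<Rightarrow> (nat \<Rightarrow> (real^'r) set) \<Rightarrow> 'w set" where
  "past_future l i B j D' = {\<omega>\<in>space M. (\<forall>t\<in>{1..l}. Y t \<omega> \<in> D t) \<and> (\<forall>t\<in>{i..<K}. W t \<omega> \<in> B t)
    \<and> (\<forall>t\<in>{j<..K}. V t \<omega> \<in> D' t)}"

lemma past_future_measurable [measurable]:
  assumes [measurable]: "\<And>i. B i \<in> sets borel" "\<And>i. D' i \<in> sets borel"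
  shows "past_future l i B j D' \<in> sets M"
proof -
  have [measurable]: "Measurable.pred M (\<lambda>\<omega>. Y t \<omega> \<in> D t)" if "t \<in> {1..l}" for t
    using Y_measurable[of t] that by simp
  have [measurable]: "Measurable.pred M (\<lambda>\<omega>. V t \<omega> \<in> D' t)" if "t \<in> {j<..K}" for t
    using V_measurable[of t] that by simp
  show ?thesis unfolding past_future_def by measurable
qed

definition predicted_density :: "nat \<Rightarrow> (real^'n) \<times> (real^'p) \<Rightarrow> ennreal" where
  "predicted_density j z = (\<integral>\<^sup>+x'. ennreal (trans_density A S (snd z) x' (fst z)) * obs_density j (x', snd z) \<partial>lborel)"

lemma predicted_density_measurable [measurable]: "predicted_density j \<in> borel_measurable borel"
proof -
  have "predicted_density j \<in> borel_measurable (borel \<Otimes>\<^sub>M borel)"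
    unfolding predicted_density_def by measurable
  then show ?thesis by (simp add: borel_prod)
qed

lemma noise_density_measurable [measurable]:
  "(\<lambda>(z, n). ennreal (gauss_density 0 (S (snd z)) n)) \<in> borel_measurable ((borel :: ((real^'n) \<times> (real^'p)) measure) \<Otimes>\<^sub>M borel)"
  "(\<lambda>(z, n). ennreal (gauss_density 0 (G (snd z)) n)) \<in> borel_measurable ((borel :: ((real^'n) \<times> (real^'p)) measure) \<Otimes>\<^sub>M borel)"
proof -
  have [measurable]: "snd \<in> borel_measurable (borel :: ((real^'n) \<times> (real^'p)) measure)"
    unfolding borel_prod[symmetric] by measurable
  show "(\<lambda>(z, n). ennreal (gauss_density 0 (S (snd z)) n)) \<in> borel_measurable ((borel :: ((real^'n) \<times> (real^'p)) measure) \<Otimes>\<^sub>M borel)"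
    "(\<lambda>(z, n). ennreal (gauss_density 0 (G (snd z)) n)) \<in> borel_measurable ((borel :: ((real^'n) \<times> (real^'p)) measure) \<Otimes>\<^sub>M borel)"
    unfolding split_beta'
    by (intro measurable_compose[OF _ measurable_ennreal] borel_measurable_gauss_density S_pos_def G_pos_def; measurable)+
qed

lemma snd_weight_measurable [measurable]:
  assumes [measurable]: "\<And>i. B i \<in> sets borel" "\<And>i. D' i \<in> sets borel"
  shows "(\<lambda>z :: (real^'n) \<times> (real^'p). future_weight i B j D' (snd z)) \<in> borel_measurable borel"
  unfolding borel_prod[symmetric] by measurable

text \<open>\<open>X 0\<close> plays the part of the noise and \<open>\<Theta>\<close> that of the
  known variable, which is why pairs appear swapped and \<open>E\<close> is reflected.\<close>

lemma joint_event_prior: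
  assumes [measurable]: "\<And>i. B i \<in> sets borel" "\<And>i. D' i \<in> sets borel" "E \<in> sets borel"
  shows "emeasure M {\<omega>\<in>space M. (X 0 \<omega>, \<Theta> \<omega>) \<in> E \<and> \<omega> \<in> past_future 0 0 B 0 D'}
    = (\<integral>\<^sup>+z. obs_density 0 z * future_weight 0 B 0 D' (snd z) * indicator E z \<partial>lborel)"
proof -
  let ?Q = "{\<omega>\<in>space M. (\<forall>i\<in>{0..<K}. W i \<omega> \<in> B i) \<and> (\<forall>i\<in>{0<..K}. V i \<omega> \<in> D' i)}"
  have Q: "?Q = past_future 0 0 B 0 D'" by (simp add: past_future_def)
  have mk: "(\<lambda>(\<theta>, x). ennreal (gauss_density (m0 \<theta>) (C0 \<theta>) x)) \<in> borel_measurable (borel \<Otimes>\<^sub>M borel)"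
    unfolding split_beta' using m0_measurable C0_measurable
    by (intro measurable_compose[OF _ measurable_ennreal] borel_measurable_gauss_density C0_pos_def) measurable
  have E': "E \<in> sets (borel \<Otimes>\<^sub>M borel)" using assms(3) by (simp only: borel_prod)
  have F: "{p. (snd p, fst p) \<in> E} \<in> sets (borel \<Otimes>\<^sub>M borel)"
  proof -
    have "(\<lambda>p :: (real^'p) \<times> (real^'n). (snd p, fst p)) \<in> borel \<Otimes>\<^sub>M borel \<rightarrow>\<^sub>M borel \<Otimes>\<^sub>M borel"
      by measurable
    from measurable_sets[OF this E'] show ?thesis by (simp add: vimage_def space_pair_measure)
  qed
  have "emeasure M {\<omega>\<in>space M. (\<Theta> \<omega>, X 0 \<omega>) \<in> {p. (snd p, fst p) \<in> E} \<and> \<omega> \<in> ?Q}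
      = (\<integral>\<^sup>+\<theta>. (ennreal (\<nu>0 \<theta>) * future_weight 0 B 0 D' \<theta>)
          * (\<integral>\<^sup>+x. ennreal (gauss_density (m0 \<theta>) (C0 \<theta>) x) * indicator {p. (snd p, fst p) \<in> E} (\<theta>, x) \<partial>lborel) \<partial>lborel)"
    by (rule joint_law_of_rectangles[OF _ _ _ _ mk prior_rectangle F]) (simp_all add: Q)
  also have "\<dots> = (\<integral>\<^sup>+\<theta>. \<integral>\<^sup>+x. obs_density 0 (x, \<theta>) * future_weight 0 B 0 D' \<theta> * indicator E (x, \<theta>) \<partial>lborel \<partial>lborel)"
  proof (intro nn_integral_cong)
    fix \<theta>
    show "ennreal (\<nu>0 \<theta>) * future_weight 0 B 0 D' \<theta>
          * (\<integral>\<^sup>+x. ennreal (gauss_density (m0 \<theta>) (C0 \<theta>) x) * indicator {p. (snd p, fst p) \<in> E} (\<theta>, x) \<partial>lborel)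
        = (\<integral>\<^sup>+x. obs_density 0 (x, \<theta>) * future_weight 0 B 0 D' \<theta> * indicator E (x, \<theta>) \<partial>lborel)"
      using F by (subst nn_integral_cmult[symmetric])
        (auto simp: approx_def ennreal_mult gauss_density_nonneg prob_densityD(2)[OF prior_density] mult_ac indicator_def
          intro!: nn_integral_cong)
  qed
  also have "\<dots> = (\<integral>\<^sup>+z. obs_density 0 z * future_weight 0 B 0 D' (snd z) * indicator E z \<partial>lborel)"
  proof -
    have "(\<lambda>z. obs_density 0 z * future_weight 0 B 0 D' (snd z) * indicator E z) \<in> borel_measurable (lborel \<Otimes>\<^sub>M lborel)"
      unfolding lborel_prod by measurable
    from lborel_pair.nn_integral_snd[OF this] show ?thesis by (simp add: lborel_prod)
  qed
  finally show ?thesis by (simp add: Q)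
qed

text \<open>Varying the set reserved at index \<open>j\<close> releases \<open>W j\<close> and gives
  its joint law with the old state and the parameter. The state equation maps this law to the new
  one, and a translation turns the noise density into the transition density.\<close>

lemma joint_event_predict:
  assumes j: "j < K"
    and IH: "\<And>B D' E. (\<And>i. B i \<in> sets borel) \<Longrightarrow> (\<And>i. D' i \<in> sets borel) \<Longrightarrow> E \<in> sets borel \<Longrightarrow>
      emeasure M {\<omega>\<in>space M. (X j \<omega>, \<Theta> \<omega>) \<in> E \<and> \<omega> \<in> past_future j j B j D'}
      = (\<integral>\<^sup>+z. obs_density j z * future_weight j B j D' (snd z) * indicator E z \<partial>lborel)"
    and [measurable]: "\<And>i. B i \<in> sets borel" "\<And>i. D' i \<in> sets borel" "E \<in> sets borel"
  shows "emeasure M {\<omega>\<in>space M. (X (Suc j) \<omega>, \<Theta> \<omega>) \<in> E \<and> \<omega> \<in> past_future j (Suc j) B j D'}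
    = (\<integral>\<^sup>+z. predicted_density j z * future_weight (Suc j) B j D' (snd z) * indicator E z \<partial>lborel)"
proof -
  have ins: "{j..<K} = insert j {Suc j..<K}" using j by auto
  let ?Q = "past_future j (Suc j) B j D'"
  let ?u = "\<lambda>z. obs_density j z * future_weight (Suc j) B j D' (snd z)"
  let ?k = "\<lambda>z n. ennreal (gauss_density 0 (S (snd z)) n)"
  have E': "E \<in> sets (borel \<Otimes>\<^sub>M borel)" using assms(5) by (simp only: borel_prod)
  have [measurable]: "snd \<in> borel_measurable (borel :: ((real^'n) \<times> (real^'p)) measure)"
      "fst \<in> borel_measurable (borel :: ((real^'n) \<times> (real^'p)) measure)"
    unfolding borel_prod[symmetric] by measurable
  define F where "F = {p :: ((real^'n) \<times> (real^'p)) \<times> (real^'n). (A (snd (fst p)) *v fst (fst p) + snd p, snd (fst p)) \<in> E}"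
  have F: "F \<in> sets (borel \<Otimes>\<^sub>M borel)"
  proof -
    have "(\<lambda>p :: ((real^'n) \<times> (real^'p)) \<times> (real^'n). (A (snd (fst p)) *v fst (fst p) + snd p, snd (fst p)))
        \<in> borel \<Otimes>\<^sub>M borel \<rightarrow>\<^sub>M borel \<Otimes>\<^sub>M borel" by measurable
    from measurable_sets[OF this E'] show ?thesis by (simp add: F_def vimage_def space_pair_measure)
  qed
  have eq: "emeasure M {\<omega>\<in>space M. (X j \<omega>, \<Theta> \<omega>) \<in> E0 \<and> W j \<omega> \<in> B0 \<and> \<omega> \<in> ?Q}
      = (\<integral>\<^sup>+z. ?u z * indicator E0 z * (\<integral>\<^sup>+n. ?k z n * indicator B0 n \<partial>lborel) \<partial>lborel)"
    if [measurable]: "E0 \<in> sets borel" "B0 \<in> sets borel" for E0 B0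
  proof -
    \<comment> \<open>Overwriting the reserved set at index \<open>j\<close> splits one Gaussian
      factor off the weight and leaves the others untouched.\<close>
    have w: "future_weight j (B(j := B0)) j D' \<theta> = (\<integral>\<^sup>+n. ennreal (gauss_density 0 (S \<theta>) n) * indicator B0 n \<partial>lborel)
        * future_weight (Suc j) B j D' \<theta>" for \<theta>
      by (simp add: future_weight_def ins emeasure_gauss_measure mult.assoc)
    have ev: "{\<omega>\<in>space M. (X j \<omega>, \<Theta> \<omega>) \<in> E0 \<and> W j \<omega> \<in> B0 \<and> \<omega> \<in> ?Q}
        = {\<omega>\<in>space M. (X j \<omega>, \<Theta> \<omega>) \<in> E0 \<and> \<omega> \<in> past_future j j (B(j := B0)) j D'}"
      by (auto simp: past_future_def ins)
    show ?thesis
      by (subst ev, subst IH) (auto simp: w mult_ac intro!: nn_integral_cong)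
  qed
  have "emeasure M {\<omega>\<in>space M. ((X j \<omega>, \<Theta> \<omega>), W j \<omega>) \<in> F \<and> \<omega> \<in> ?Q}
      = (\<integral>\<^sup>+z. ?u z * (\<integral>\<^sup>+n. ?k z n * indicator F (z, n) \<partial>lborel) \<partial>lborel)"
    by (rule joint_law_of_rectangles[OF _ _ _ _ noise_density_measurable(1) eq F])
       (auto intro!: borel_measurable_Pair borel_measurable_times_ennreal obs_density_measurable
          snd_weight_measurable past_future_measurable)
  also have "\<dots> = (\<integral>\<^sup>+z. ?u z * (\<integral>\<^sup>+x'. ennreal (trans_density A S (snd z) (fst z) x') * indicator E (x', snd z) \<partial>lborel) \<partial>lborel)"
  proof (rule nn_integral_cong, rule arg_cong2[where f="(*)", OF refl])
    fix z :: "(real^'n) \<times> (real^'p)"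
    let ?a = "A (snd z) *v fst z"
    have [measurable]: "(\<lambda>x'. indicator E (x', snd z) :: ennreal) \<in> borel_measurable borel"
      using E' by measurable
    have "(\<integral>\<^sup>+n. ?k z n * indicator F (z, n) \<partial>lborel)
        = (\<integral>\<^sup>+n. ennreal (gauss_density 0 (S (snd z)) ((?a + n) - ?a)) * indicator E (?a + n, snd z) \<partial>lborel)"
      by (intro nn_integral_cong) (auto simp: F_def indicator_def)
    also have "\<dots> = (\<integral>\<^sup>+x'. ennreal (gauss_density 0 (S (snd z)) (x' - ?a)) * indicator E (x', snd z) \<partial>lborel)"
      by (rule nn_integral_lborel_translate) measurable
    finally show "(\<integral>\<^sup>+n. ?k z n * indicator F (z, n) \<partial>lborel)
        = (\<integral>\<^sup>+x'. ennreal (trans_density A S (snd z) (fst z) x') * indicator E (x', snd z) \<partial>lborel)"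
      by (simp add: trans_density_def gauss_density_def)
  qed
  also have "\<dots> = (\<integral>\<^sup>+\<theta>. \<integral>\<^sup>+x. ?u (x, \<theta>) * (\<integral>\<^sup>+x'. ennreal (trans_density A S \<theta> x x') * indicator E (x', \<theta>) \<partial>lborel) \<partial>lborel \<partial>lborel)"
  proof -
    have "(\<lambda>z. ?u z * (\<integral>\<^sup>+x'. ennreal (trans_density A S (snd z) (fst z) x') * indicator E (x', snd z) \<partial>lborel)) \<in> borel_measurable (lborel \<Otimes>\<^sub>M lborel)"
    proof -
      have "(\<lambda>(z, x'). ennreal (trans_density A S (snd z) (fst z) x') * indicator E (x', snd z)) \<in> borel_measurable (borel \<Otimes>\<^sub>M borel)"
        using E' by measurable
      then have "(\<lambda>z. \<integral>\<^sup>+x'. ennreal (trans_density A S (snd z) (fst z) x') * indicator E (x', snd z) \<partial>lborel) \<in> borel_measurable borel"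
        by measurable
      then show ?thesis unfolding lborel_prod by measurable
    qed
    from lborel_pair.nn_integral_snd[OF this] show ?thesis by (simp add: lborel_prod)
  qed
  also have "\<dots> = (\<integral>\<^sup>+\<theta>. \<integral>\<^sup>+x'. predicted_density j (x', \<theta>) * future_weight (Suc j) B j D' \<theta> * indicator E (x', \<theta>) \<partial>lborel \<partial>lborel)"
  proof (rule nn_integral_cong)
    fix \<theta>
    have [measurable]: "(\<lambda>x'. indicator E (x', \<theta>) :: ennreal) \<in> borel_measurable borel"
      "(\<lambda>x. obs_density j (x, \<theta>)) \<in> borel_measurable borel"
      using E' by measurable
    have "(\<integral>\<^sup>+x. ?u (x, \<theta>) * (\<integral>\<^sup>+x'. ennreal (trans_density A S \<theta> x x') * indicator E (x', \<theta>) \<partial>lborel) \<partial>lborel)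
        = (\<integral>\<^sup>+x. \<integral>\<^sup>+x'. ?u (x, \<theta>) * (ennreal (trans_density A S \<theta> x x') * indicator E (x', \<theta>)) \<partial>lborel \<partial>lborel)"
      by (subst nn_integral_cmult) auto
    also have "\<dots> = (\<integral>\<^sup>+x'. \<integral>\<^sup>+x. ?u (x, \<theta>) * (ennreal (trans_density A S \<theta> x x') * indicator E (x', \<theta>)) \<partial>lborel \<partial>lborel)"
      by (rule lborel_pair.Fubini'[symmetric]) measurable
    also have "\<dots> = (\<integral>\<^sup>+x'. (\<integral>\<^sup>+x. ennreal (trans_density A S \<theta> x x') * obs_density j (x, \<theta>) \<partial>lborel)
        * (future_weight (Suc j) B j D' \<theta> * indicator E (x', \<theta>)) \<partial>lborel)"
      by (intro nn_integral_cong, subst nn_integral_multc[symmetric]) (auto simp: mult_ac)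
    finally show "(\<integral>\<^sup>+x. ?u (x, \<theta>) * (\<integral>\<^sup>+x'. ennreal (trans_density A S \<theta> x x') * indicator E (x', \<theta>) \<partial>lborel) \<partial>lborel)
        = (\<integral>\<^sup>+x'. predicted_density j (x', \<theta>) * future_weight (Suc j) B j D' \<theta> * indicator E (x', \<theta>) \<partial>lborel)"
      by (simp add: predicted_density_def mult.assoc)
  qed
  also have "\<dots> = (\<integral>\<^sup>+z. predicted_density j z * future_weight (Suc j) B j D' (snd z) * indicator E z \<partial>lborel)"
  proof -
    have "(\<lambda>z. predicted_density j z * future_weight (Suc j) B j D' (snd z) * indicator E z) \<in> borel_measurable (lborel \<Otimes>\<^sub>M lborel)"
      unfolding lborel_prod by measurable
    from lborel_pair.nn_integral_snd[OF this] show ?thesis by (simp add: lborel_prod)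
  qed
  also have "{\<omega>\<in>space M. ((X j \<omega>, \<Theta> \<omega>), W j \<omega>) \<in> F \<and> \<omega> \<in> ?Q} = {\<omega>\<in>space M. (X (Suc j) \<omega>, \<Theta> \<omega>) \<in> E \<and> \<omega> \<in> ?Q}"
    by (auto simp: F_def state_eq)
  finally show ?thesis .
qed

text \<open>The same mechanism with \<open>V (Suc j)\<close>: the state is kept, and
  \<open>F\<close> also records that the observation falls into \<open>D (Suc j)\<close>, so
  integrating out the noise leaves the likelihood integrated over that set.\<close>

lemma joint_event_observe:
  assumes j: "j < K"
    and IH: "\<And>B D' E. (\<And>i. B i \<in> sets borel) \<Longrightarrow> (\<And>i. D' i \<in> sets borel) \<Longrightarrow> E \<in> sets borel \<Longrightarrow>
      emeasure M {\<omega>\<in>space M. (X (Suc j) \<omega>, \<Theta> \<omega>) \<in> E \<and> \<omega> \<in> past_future j (Suc j) B j D'}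
      = (\<integral>\<^sup>+z. predicted_density j z * future_weight (Suc j) B j D' (snd z) * indicator E z \<partial>lborel)"
    and [measurable]: "\<And>i. B i \<in> sets borel" "\<And>i. D' i \<in> sets borel" "E \<in> sets borel"
  shows "emeasure M {\<omega>\<in>space M. (X (Suc j) \<omega>, \<Theta> \<omega>) \<in> E \<and> \<omega> \<in> past_future (Suc j) (Suc j) B (Suc j) D'}
    = (\<integral>\<^sup>+z. obs_density (Suc j) z * future_weight (Suc j) B (Suc j) D' (snd z) * indicator E z \<partial>lborel)"
proof -
  have ins: "{j<..K} = insert (Suc j) {Suc j<..K}" using j by auto
  let ?Q = "past_future j (Suc j) B (Suc j) D'"
  let ?u = "\<lambda>z. predicted_density j z * future_weight (Suc j) B (Suc j) D' (snd z)"
  let ?k = "\<lambda>z n. ennreal (gauss_density 0 (G (snd z)) n)"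
  have [measurable]: "snd \<in> borel_measurable (borel :: ((real^'n) \<times> (real^'p)) measure)"
      "fst \<in> borel_measurable (borel :: ((real^'n) \<times> (real^'p)) measure)"
    unfolding borel_prod[symmetric] by measurable
  define F where "F = {p :: ((real^'n) \<times> (real^'p)) \<times> (real^'r). fst p \<in> E \<and> H (snd (fst p)) *v fst (fst p) + snd p \<in> D (Suc j)}"
  have F: "F \<in> sets (borel \<Otimes>\<^sub>M borel)"
  proof -
    have "{p \<in> space (borel \<Otimes>\<^sub>M borel :: (((real^'n) \<times> (real^'p)) \<times> (real^'r)) measure).
        fst p \<in> E \<and> H (snd (fst p)) *v fst (fst p) + snd p \<in> D (Suc j)} \<in> sets (borel \<Otimes>\<^sub>M borel)" by measurable
    then show ?thesis by (simp add: F_def space_pair_measure)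
  qed
  have eq: "emeasure M {\<omega>\<in>space M. (X (Suc j) \<omega>, \<Theta> \<omega>) \<in> E0 \<and> V (Suc j) \<omega> \<in> B0 \<and> \<omega> \<in> ?Q}
      = (\<integral>\<^sup>+z. ?u z * indicator E0 z * (\<integral>\<^sup>+n. ?k z n * indicator B0 n \<partial>lborel) \<partial>lborel)"
    if [measurable]: "E0 \<in> sets borel" "B0 \<in> sets borel" for E0 B0
  proof -
    have w: "future_weight (Suc j) B j (D'(Suc j := B0)) \<theta> = (\<integral>\<^sup>+n. ennreal (gauss_density 0 (G \<theta>) n) * indicator B0 n \<partial>lborel)
        * future_weight (Suc j) B (Suc j) D' \<theta>" for \<theta>
      by (simp add: future_weight_def ins emeasure_gauss_measure mult_ac)
    have ev: "{\<omega>\<in>space M. (X (Suc j) \<omega>, \<Theta> \<omega>) \<in> E0 \<and> V (Suc j) \<omega> \<in> B0 \<and> \<omega> \<in> ?Q}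
        = {\<omega>\<in>space M. (X (Suc j) \<omega>, \<Theta> \<omega>) \<in> E0 \<and> \<omega> \<in> past_future j (Suc j) B j (D'(Suc j := B0))}"
      by (auto simp: past_future_def ins)
    show ?thesis
      by (subst ev, subst IH) (auto simp: w mult_ac intro!: nn_integral_cong)
  qed
  have "emeasure M {\<omega>\<in>space M. ((X (Suc j) \<omega>, \<Theta> \<omega>), V (Suc j) \<omega>) \<in> F \<and> \<omega> \<in> ?Q}
      = (\<integral>\<^sup>+z. ?u z * (\<integral>\<^sup>+n. ?k z n * indicator F (z, n) \<partial>lborel) \<partial>lborel)"
    by (rule joint_law_of_rectangles[OF _ _ _ _ noise_density_measurable(2) eq F])
       (auto intro!: borel_measurable_Pair borel_measurable_times_ennreal predicted_density_measurable
          snd_weight_measurable past_future_measurable V_measurable)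
  also have "\<dots> = (\<integral>\<^sup>+z. obs_density (Suc j) z * future_weight (Suc j) B (Suc j) D' (snd z) * indicator E z \<partial>lborel)"
  proof (intro nn_integral_cong)
    fix z :: "(real^'n) \<times> (real^'p)"
    let ?a = "H (snd z) *v fst z"
    have "(\<integral>\<^sup>+n. ?k z n * indicator F (z, n) \<partial>lborel)
        = (\<integral>\<^sup>+n. indicator E z * (ennreal (gauss_density 0 (G (snd z)) ((?a + n) - ?a)) * indicator (D (Suc j)) (?a + n)) \<partial>lborel)"
      by (intro nn_integral_cong) (auto simp: F_def indicator_def)
    also have "\<dots> = indicator E z * (\<integral>\<^sup>+n. ennreal (gauss_density 0 (G (snd z)) ((?a + n) - ?a)) * indicator (D (Suc j)) (?a + n) \<partial>lborel)"
      by (rule nn_integral_cmult) measurable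
    also have "(\<integral>\<^sup>+n. ennreal (gauss_density 0 (G (snd z)) ((?a + n) - ?a)) * indicator (D (Suc j)) (?a + n) \<partial>lborel)
        = (\<integral>\<^sup>+v. ennreal (gauss_density 0 (G (snd z)) (v - ?a)) * indicator (D (Suc j)) v \<partial>lborel)"
      by (rule nn_integral_lborel_translate) measurable
    also have "\<dots> = (\<integral>\<^sup>+v. ennreal (obs_lik H G v z) * indicator (D (Suc j)) v \<partial>lborel)"
      by (simp add: obs_lik_def gauss_density_def)
    finally show "?u z * (\<integral>\<^sup>+n. ?k z n * indicator F (z, n) \<partial>lborel)
        = obs_density (Suc j) z * future_weight (Suc j) B (Suc j) D' (snd z) * indicator E z"
      by (simp add: predicted_density_def mult_ac)
  qed
  also have "{\<omega>\<in>space M. ((X (Suc j) \<omega>, \<Theta> \<omega>), V (Suc j) \<omega>) \<in> F \<and> \<omega> \<in> ?Q}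
      = {\<omega>\<in>space M. (X (Suc j) \<omega>, \<Theta> \<omega>) \<in> E \<and> \<omega> \<in> past_future (Suc j) (Suc j) B (Suc j) D'}"
    by (auto simp: F_def obs_eq past_future_def atLeastAtMostSuc_conv)
  finally show ?thesis .
qed

lemma joint_event:
  assumes "j \<le> K" "\<And>i. B i \<in> sets borel" "\<And>i. D' i \<in> sets borel" "E \<in> sets borel"
  shows "emeasure M {\<omega>\<in>space M. (X j \<omega>, \<Theta> \<omega>) \<in> E \<and> \<omega> \<in> past_future j j B j D'}
    = (\<integral>\<^sup>+z. obs_density j z * future_weight j B j D' (snd z) * indicator E z \<partial>lborel)"
  using assms
proof (induction j arbitrary: B D' E)
  case 0
  then show ?case by (intro joint_event_prior)
next
  case (Suc j)
  then have j: "j < K" by simp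
  show ?case
    by (rule joint_event_observe[OF j joint_event_predict[OF j Suc.IH] Suc.prems(2,3,4)]) (use j in auto)
qed

text \<open>At \<open>j = K\<close> no noise is left in reserve, so the weight consists of empty
  products.\<close>

lemma joint_event_final:
  assumes "E \<in> sets borel"
  shows "emeasure M {\<omega>\<in>space M. (X K \<omega>, \<Theta> \<omega>) \<in> E \<and> (\<forall>i\<in>{1..K}. Y i \<omega> \<in> D i)}
    = (\<integral>\<^sup>+z. obs_density K z * indicator E z \<partial>lborel)"
proof -
  have "{\<omega>\<in>space M. (X K \<omega>, \<Theta> \<omega>) \<in> E \<and> (\<forall>i\<in>{1..K}. Y i \<omega> \<in> D i)}
      = {\<omega>\<in>space M. (X K \<omega>, \<Theta> \<omega>) \<in> E \<and> \<omega> \<in> past_future K K (\<lambda>_. UNIV) K (\<lambda>_. UNIV)}"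
    by (auto simp: past_future_def)
  then show ?thesis
    using joint_event[of K "\<lambda>_. UNIV" "\<lambda>_. UNIV" E] assms by (simp add: future_weight_def)
qed

end

end

section \<open>The unnormalised posterior\<close>

context bounded_ssm
begin

text \<open>Without normalisation no denominator depends on the data. This is the candidate for the
  joint density, and its continuity in the data can be proved directly.\<close>

primrec unnormalised :: "nat \<Rightarrow> (nat \<Rightarrow> real^'r) \<Rightarrow> (real^'n) \<times> (real^'p) \<Rightarrow> real" where
  "unnormalised 0 y = approx m0 C0 \<nu>0"
| "unnormalised (Suc j) y = (\<lambda>z. obs_lik H G (y (Suc j)) z * predict (trans_density A S) (unnormalised j y) z)"

primrec state_mean :: "nat \<Rightarrow> real^'p \<Rightarrow> real^'n" where
  "state_mean 0 = m0"
| "state_mean (Suc j) = (\<lambda>\<theta>. A \<theta> *v state_mean j \<theta>)"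

primrec state_cov :: "nat \<Rightarrow> real^'p \<Rightarrow> real^'n^'n" where
  "state_cov 0 = C0"
| "state_cov (Suc j) = (\<lambda>\<theta>. A \<theta> ** state_cov j \<theta> ** transpose (A \<theta>) + S \<theta>)"

text \<open>Bounding every likelihood factor leaves the Gaussian law of the state without observations.\<close>

definition majorant :: "nat \<Rightarrow> (real^'n) \<times> (real^'p) \<Rightarrow> real" where
  "majorant j z = prior.lik_bound ^ j * gauss_density (state_mean j (snd z)) (state_cov j (snd z)) (fst z) * \<nu>0 (snd z)"

lemma state_cov_pos: "pos_def (state_cov j \<theta>)"
  by (induction j) (auto simp: C0_pos_def intro: pos_def_congruence_add S_pos_def)

lemma majorant_nonneg: "0 \<le> majorant j z"
  using prior.lik_bound_pos prob_densityD(2)[OF prior_density]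
  by (simp add: majorant_def gauss_density_nonneg less_imp_le)

text \<open>Both facts hold at every point and not only almost everywhere, so prediction of
  \<open>unnormalised\<close> never meets the default value of a divergent Bochner integral.\<close>

lemma majorant_integrable:
  "integrable lborel (\<lambda>x'. trans_density A S \<theta> x' x * majorant j (x', \<theta>))"
  "prior.lik_bound * (\<integral>x'. trans_density A S \<theta> x' x * majorant j (x', \<theta>) \<partial>lborel) = majorant (Suc j) (x, \<theta>)"
proof -
  have eq: "trans_density A S \<theta> x' x * majorant j (x', \<theta>)
      = (prior.lik_bound ^ j * \<nu>0 \<theta>) * (gauss_density (A \<theta> *v x') (S \<theta>) x * gauss_density (state_mean j \<theta>) (state_cov j \<theta>) x')" for x'
    by (simp add: trans_density_def majorant_def)
  note p = gauss_density_predict[OF state_cov_pos[of j \<theta>] S_pos_def[of \<theta>], of "A \<theta>" x "state_mean j \<theta>"]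
  show "integrable lborel (\<lambda>x'. trans_density A S \<theta> x' x * majorant j (x', \<theta>))"
    unfolding eq using p(2) by (intro integrable_mult_right)
  show "prior.lik_bound * (\<integral>x'. trans_density A S \<theta> x' x * majorant j (x', \<theta>) \<partial>lborel) = majorant (Suc j) (x, \<theta>)"
    unfolding eq by (simp add: p(1) majorant_def)
qed

lemma unnormalised_measurable [measurable]: "unnormalised j y \<in> borel_measurable borel"
proof (induction j)
  case 0
  then show ?case using prob_densityD(1)[OF prior.prob_density_approx] by simp
next
  case (Suc j)
  note [measurable] = prior.predict_measurable[OF Suc]
  show ?case by simp
qed

lemma unnormalised_bounds: "0 \<le> unnormalised j y z \<and> unnormalised j y z \<le> majorant j z"
proof (induction j arbitrary: z)
  case 0
  then show ?case
    by (simp add: majorant_def approx_def split_beta gauss_density_nonneg prob_densityD(2)[OF prior_density])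
next
  case (Suc j)
  obtain x \<theta> where z: "z = (x, \<theta>)" by (cases z)
  have nn: "0 \<le> predict (trans_density A S) (unnormalised j y) (x, \<theta>)"
    using Suc by (simp add: predict_def prior.P_nonneg)
  have le: "predict (trans_density A S) (unnormalised j y) (x, \<theta>)
      \<le> (\<integral>x'. trans_density A S \<theta> x' x * majorant j (x', \<theta>) \<partial>lborel)"
    unfolding predict_def prod.case
  proof (rule integral_mono_AE')
    show "integrable lborel (\<lambda>x'. trans_density A S \<theta> x' x * majorant j (x', \<theta>))"
      by (rule majorant_integrable)
    show "AE x' in lborel. trans_density A S \<theta> x' x * unnormalised j y (x', \<theta>) \<le> trans_density A S \<theta> x' x * majorant j (x', \<theta>)"
      using Suc by (auto intro!: AE_I2 mult_left_mono simp: prior.P_nonneg)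
    show "AE x' in lborel. 0 \<le> trans_density A S \<theta> x' x * majorant j (x', \<theta>)"
      by (auto intro!: AE_I2 simp: prior.P_nonneg majorant_nonneg)
  qed
  have "obs_lik H G (y (Suc j)) z * predict (trans_density A S) (unnormalised j y) z
      \<le> prior.lik_bound * (\<integral>x'. trans_density A S \<theta> x' x * majorant j (x', \<theta>) \<partial>lborel)"
    unfolding z using le nn prior.lik_bound_pos by (intro mult_mono prior.obs_lik_le) auto
  then show ?case
    using nn prior.obs_lik_pos[of "y (Suc j)" z] by (simp add: majorant_integrable(2) z)
qed

lemma integrable_unnormalised_slice:
  "integrable lborel (\<lambda>x'. trans_density A S \<theta> x' x * unnormalised j y (x', \<theta>))"
proof (rule Bochner_Integration.integrable_bound[OF majorant_integrable(1)[of \<theta> x j]])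
  show "(\<lambda>x'. trans_density A S \<theta> x' x * unnormalised j y (x', \<theta>)) \<in> borel_measurable lborel" by measurable
  show "AE x' in lborel. norm (trans_density A S \<theta> x' x * unnormalised j y (x', \<theta>))
      \<le> norm (trans_density A S \<theta> x' x * majorant j (x', \<theta>))"
    using unnormalised_bounds by (intro AE_I2) (auto simp: abs_mult prior.P_nonneg majorant_nonneg intro!: mult_left_mono)
qed

text \<open>Dominated convergence, with the majorant as a bound that does not involve the
  observations.\<close>

lemma unnormalised_tendsto:
  assumes "\<And>i. i \<in> {1..j} \<Longrightarrow> (\<lambda>n. yn n i) \<longlonglongrightarrow> y i"
  shows "(\<lambda>n. unnormalised j (yn n) z) \<longlonglongrightarrow> unnormalised j y z"
  using assms
proof (induction j arbitrary: z)
  case (Suc j)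
  obtain x \<theta> where z: "z = (x, \<theta>)" by (cases z)
  have IH: "(\<lambda>n. unnormalised j (yn n) z) \<longlonglongrightarrow> unnormalised j y z" for z
    by (rule Suc.IH) (use Suc.prems in auto)
  have "(\<lambda>n. gauss_density (H \<theta> *v x) (G \<theta>) (yn n (Suc j))) \<longlonglongrightarrow> gauss_density (H \<theta> *v x) (G \<theta>) (y (Suc j))"
  proof -
    have l: "(\<lambda>n. yn n (Suc j) - H \<theta> *v x) \<longlonglongrightarrow> y (Suc j) - H \<theta> *v x"
      using Suc.prems[of "Suc j"] by (intro tendsto_diff) auto
    have "(\<lambda>n. matrix_inv (G \<theta>) *v (yn n (Suc j) - H \<theta> *v x)) \<longlonglongrightarrow> matrix_inv (G \<theta>) *v (y (Suc j) - H \<theta> *v x)"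
      by (rule bounded_linear.tendsto[OF matrix_vector_mul_bounded_linear l])
    then show ?thesis unfolding gauss_density_def using l Suc.prems[of "Suc j"] by (intro tendsto_intros) auto
  qed
  then have 1: "(\<lambda>n. obs_lik H G (yn n (Suc j)) z) \<longlonglongrightarrow> obs_lik H G (y (Suc j)) z"
    by (simp add: obs_lik_def z)
  have 2: "(\<lambda>n. predict (trans_density A S) (unnormalised j (yn n)) z) \<longlonglongrightarrow> predict (trans_density A S) (unnormalised j y) z"
    unfolding predict_def z prod.case
  proof (rule integral_dominated_convergence)
      show "(\<lambda>x'. trans_density A S \<theta> x' x * unnormalised j y (x', \<theta>)) \<in> borel_measurable lborel"
      "\<And>n. (\<lambda>x'. trans_density A S \<theta> x' x * unnormalised j (yn n) (x', \<theta>)) \<in> borel_measurable lborel"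
      by measurable
    show "integrable lborel (\<lambda>x'. trans_density A S \<theta> x' x * majorant j (x', \<theta>))" by (rule majorant_integrable)
    show "AE x' in lborel. (\<lambda>n. trans_density A S \<theta> x' x * unnormalised j (yn n) (x', \<theta>))
        \<longlonglongrightarrow> trans_density A S \<theta> x' x * unnormalised j y (x', \<theta>)"
      by (intro AE_I2 tendsto_mult tendsto_const IH)
    show "AE x' in lborel. norm (trans_density A S \<theta> x' x * unnormalised j (yn n) (x', \<theta>))
        \<le> trans_density A S \<theta> x' x * majorant j (x', \<theta>)" for n
      using unnormalised_bounds by (intro AE_I2) (auto simp: abs_mult prior.P_nonneg intro!: mult_left_mono)
  qed
  show ?case using tendsto_mult[OF 1 2] by simp
qed simp

lemma unnormalised_cong: "(\<And>i. i \<in> {1..j} \<Longrightarrow> y i = y' i) \<Longrightarrow> unnormalised j y = unnormalised j y'"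
proof (induction j)
  case (Suc j)
  have "unnormalised j y = unnormalised j y'" by (rule Suc.IH) (use Suc.prems in auto)
  moreover have "y (Suc j) = y' (Suc j)" using Suc.prems by auto
  ultimately show ?case by simp
qed simp

text \<open>Tonelli between data and states needs joint measurability. The data space keeps the
  fixed index set up to \<open>k\<close>, so the induction on \<open>j\<close> does not change
  it.\<close>

lemma unnormalised_joint_measurable:
  assumes "j \<le> k"
  shows "(\<lambda>(z, y). unnormalised j y z) \<in> borel_measurable (borel \<Otimes>\<^sub>M (\<Pi>\<^sub>M i\<in>{1..k}. borel))"
  using assms
proof (induction j)
  case 0
  have [measurable]: "approx m0 C0 \<nu>0 \<in> borel_measurable borel"
    by (rule prob_densityD(1)[OF prior.prob_density_approx])
  show ?case by simp
next
  case (Suc j)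
  let ?N = "(borel :: ((real^'n) \<times> (real^'p)) measure) \<Otimes>\<^sub>M (\<Pi>\<^sub>M i\<in>{1..k}. (borel :: (real^'r) measure))"
  have IH: "(\<lambda>(z, y). unnormalised j y z) \<in> borel_measurable ?N" using Suc by simp
  have [measurable]: "snd \<in> borel_measurable (borel :: ((real^'n) \<times> (real^'p)) measure)"
      "fst \<in> borel_measurable (borel :: ((real^'n) \<times> (real^'p)) measure)"
    unfolding borel_prod[symmetric] by measurable
  have "(\<lambda>(w, x'). ((x', snd (fst w)), snd w)) \<in> ?N \<Otimes>\<^sub>M lborel \<rightarrow>\<^sub>M ?N"
    unfolding split_beta' by (intro measurable_Pair borel_measurable_Pair) measurable
  from measurable_compose[OF this IH]
  have [measurable]: "(\<lambda>(w, x'). unnormalised j (snd w) (x', snd (fst w))) \<in> borel_measurable (?N \<Otimes>\<^sub>M lborel)"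
    by (simp add: split_beta')
  have "(\<lambda>w. \<integral>x'. trans_density A S (snd (fst w)) x' (fst (fst w)) * unnormalised j (snd w) (x', snd (fst w)) \<partial>lborel)
      \<in> borel_measurable ?N"
    by measurable
  then have [measurable]: "(\<lambda>w. predict (trans_density A S) (unnormalised j (snd w)) (fst w)) \<in> borel_measurable ?N"
    by (simp add: predict_def split_beta')
  have "Suc j \<in> {1..k}" using Suc by simp
  then have [measurable]: "(\<lambda>w. snd w (Suc j)) \<in> borel_measurable ?N"
    by (intro measurable_compose[OF measurable_snd measurable_component_singleton])
  show ?case unfolding split_beta' unnormalised.simps by measurable
qed

text \<open>Only the newest likelihood factor depends on the last observation. Once that is
  integrated out and the remaining data integral is moved inside the prediction, both sides obey the
  same recursion.\<close>

lemma nn_integral_unnormalised: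
  assumes D [measurable]: "\<And>i. D i \<in> sets borel"
  shows "(\<integral>\<^sup>+y. ennreal (unnormalised j y z) * (\<Prod>i\<in>{1..j}. indicator (D i) (y i)) \<partial>(\<Pi>\<^sub>M i\<in>{1..j}. lborel))
    = obs_event_density A H S G D (\<lambda>z. ennreal (approx m0 C0 \<nu>0 z)) j z"
proof (induction j arbitrary: z)
  case 0
  interpret product_sigma_finite "\<lambda>_. lborel :: (real^'r) measure" ..
  show ?case by (simp add: PiM_empty)
next
  case (Suc j)
  interpret product_sigma_finite "\<lambda>_. lborel :: (real^'r) measure" ..
  let ?P = "\<Pi>\<^sub>M i\<in>{1..j}. (lborel :: (real^'r) measure)"
  interpret P: finite_product_sigma_finite "\<lambda>_. lborel :: (real^'r) measure" "{1..j}" by standard simp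
  interpret Q: pair_sigma_finite ?P "lborel :: (real^'n) measure" ..
  obtain x \<theta> where z: "z = (x, \<theta>)" by (cases z)
  let ?f = "\<lambda>y. ennreal (unnormalised (Suc j) y z) * (\<Prod>i\<in>{1..Suc j}. indicator (D i) (y i))"
  let ?d = "\<lambda>y. (\<Prod>i\<in>{1..j}. indicator (D i) (y i)) :: ennreal"
  have setsP: "sets (\<Pi>\<^sub>M i\<in>I. (lborel :: (real^'r) measure)) = sets (\<Pi>\<^sub>M i\<in>I. borel)" for I :: "nat set"
    by (intro sets_PiM_cong) auto
  have ins: "{1..Suc j} = insert (Suc j) {1..j}" by (auto simp: atLeastAtMostSuc_conv)
  have m: "(\<lambda>y. unnormalised (Suc j) y z) \<in> borel_measurable (\<Pi>\<^sub>M i\<in>{1..Suc j}. lborel)"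
  proof -
    have "(\<lambda>y. unnormalised (Suc j) y z) \<in> borel_measurable (\<Pi>\<^sub>M i\<in>{1..Suc j}. borel)"
      using measurable_compose[OF measurable_Pair1'[of z borel] unnormalised_joint_measurable[of "Suc j" "Suc j"]] by simp
    then show ?thesis unfolding measurable_cong_sets[OF setsP refl] .
  qed
  then have f: "?f \<in> borel_measurable (\<Pi>\<^sub>M i\<in>insert (Suc j) {1..j}. lborel)"
    unfolding ins[symmetric] by measurable
  have slice: "(\<lambda>(y, x'). unnormalised j y (x', \<theta>)) \<in> borel_measurable (?P \<Otimes>\<^sub>M lborel)"
  proof -
    have "(\<lambda>(y, x' :: real^'n). ((x', \<theta>), y)) \<in> (\<Pi>\<^sub>M i\<in>{1..j}. borel) \<Otimes>\<^sub>M borel \<rightarrow>\<^sub>M borel \<Otimes>\<^sub>M (\<Pi>\<^sub>M i\<in>{1..j}. (borel :: (real^'r) measure))"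
      unfolding split_beta' by (intro measurable_Pair borel_measurable_Pair) measurable
    from measurable_compose[OF this unnormalised_joint_measurable[of j j]]
    have "(\<lambda>(y, x'). unnormalised j y (x', \<theta>)) \<in> borel_measurable ((\<Pi>\<^sub>M i\<in>{1..j}. borel) \<Otimes>\<^sub>M borel)"
      by (simp add: split_beta')
    then show ?thesis by (subst measurable_cong_sets[OF sets_pair_measure_cong[OF setsP sets_lborel] refl])
  qed
  note [measurable] = slice
  \<comment> \<open>The slices are integrable at every point, so the Bochner integral in
    \<open>predict\<close> may be exchanged for a nonnegative one.\<close>
  have pred: "ennreal (predict (trans_density A S) (unnormalised j y) z)
      = (\<integral>\<^sup>+x'. ennreal (trans_density A S \<theta> x' x) * ennreal (unnormalised j y (x', \<theta>)) \<partial>lborel)" for y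
    using unnormalised_bounds integrable_unnormalised_slice[of \<theta> x j y]
    by (simp add: z predict_def nn_integral_eq_integral prior.P_nonneg flip: ennreal_mult)
  have mp [measurable]: "(\<lambda>y. ennreal (predict (trans_density A S) (unnormalised j y) z)) \<in> borel_measurable ?P"
    unfolding pred by measurable
  have "(\<integral>\<^sup>+y. ?f y \<partial>(\<Pi>\<^sub>M i\<in>{1..Suc j}. lborel)) = (\<integral>\<^sup>+y. \<integral>\<^sup>+v. ?f (y(Suc j := v)) \<partial>lborel \<partial>?P)"
    by (rule product_nn_integral_insert[OF finite_atLeastAtMost _ f, folded ins]) simp
  also have "\<dots> = (\<integral>\<^sup>+y. \<integral>\<^sup>+v. (ennreal (obs_lik H G v z) * indicator (D (Suc j)) v)
      * (ennreal (predict (trans_density A S) (unnormalised j y) z) * ?d y) \<partial>lborel \<partial>?P)"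
  proof (intro nn_integral_cong)
    fix y :: "nat \<Rightarrow> real^'r" and v
    have "unnormalised j (y(Suc j := v)) = unnormalised j y" by (rule unnormalised_cong) auto
    moreover have "?d (y(Suc j := v)) = ?d y" by (intro prod.cong) auto
    ultimately show "?f (y(Suc j := v)) = (ennreal (obs_lik H G v z) * indicator (D (Suc j)) v)
      * (ennreal (predict (trans_density A S) (unnormalised j y) z) * ?d y)"
      unfolding ins using prior.obs_lik_pos[of v z] by (simp add: ennreal_mult' less_imp_le mult_ac)
  qed
  also have "\<dots> = (\<integral>\<^sup>+v. ennreal (obs_lik H G v z) * indicator (D (Suc j)) v \<partial>lborel)
      * (\<integral>\<^sup>+y. ennreal (predict (trans_density A S) (unnormalised j y) z) * ?d y \<partial>?P)"
    by (subst nn_integral_multc, measurable, rule nn_integral_cmult, measurable)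
  also have "(\<integral>\<^sup>+y. ennreal (predict (trans_density A S) (unnormalised j y) z) * ?d y \<partial>?P)
      = (\<integral>\<^sup>+y. \<integral>\<^sup>+x'. ennreal (trans_density A S \<theta> x' x) * (ennreal (unnormalised j y (x', \<theta>)) * ?d y) \<partial>lborel \<partial>?P)"
  proof (rule nn_integral_cong)
    fix y assume y: "y \<in> space ?P"
    have [measurable]: "(\<lambda>x'. unnormalised j y (x', \<theta>)) \<in> borel_measurable borel"
      by measurable
    show "ennreal (predict (trans_density A S) (unnormalised j y) z) * ?d y
      = (\<integral>\<^sup>+x'. ennreal (trans_density A S \<theta> x' x) * (ennreal (unnormalised j y (x', \<theta>)) * ?d y) \<partial>lborel)"
      unfolding pred by (subst nn_integral_multc[symmetric]) (auto simp: mult.assoc)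
  qed
  also have "\<dots> = (\<integral>\<^sup>+x'. \<integral>\<^sup>+y. ennreal (trans_density A S \<theta> x' x) * (ennreal (unnormalised j y (x', \<theta>)) * ?d y) \<partial>?P \<partial>lborel)"
    by (rule Q.Fubini'[symmetric]) measurable
  also have "\<dots> = (\<integral>\<^sup>+x'. ennreal (trans_density A S \<theta> x' x) * obs_event_density A H S G D (\<lambda>z. ennreal (approx m0 C0 \<nu>0 z)) j (x', \<theta>) \<partial>lborel)"
    unfolding Suc.IH[symmetric] by (intro nn_integral_cong nn_integral_cmult) measurable
  finally show ?case by (simp add: z)
qed

end

section \<open>Identification of the posterior\<close>

text \<open>A basic neighbourhood in the product topology restricts finitely many coordinates, so
  finitely many eventual statements are combined.\<close>

lemma tendsto_fun_componentwise:
  fixes y :: "'i \<Rightarrow> 'a::topological_space"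
  assumes "\<And>i. ((\<lambda>n. yn n i) \<longlongrightarrow> y i) F"
  shows "(yn \<longlongrightarrow> y) F"
proof (rule topological_tendstoI)
  fix U assume "open U" "y \<in> U"
  then obtain X where X: "y \<in> (\<Pi>\<^sub>E i\<in>UNIV. X i)" "\<And>i. open (X i)" "finite {i. X i \<noteq> UNIV}"
      "(\<Pi>\<^sub>E i\<in>UNIV. X i) \<subseteq> U"
    using product_topology_open_contains_basis[of "\<lambda>_. euclidean" UNIV U y] by (auto simp: open_fun_def)
  have "\<forall>\<^sub>F n in F. \<forall>i\<in>{i. X i \<noteq> UNIV}. yn n i \<in> X i"
  proof (rule eventually_ball_finite[OF X(3)], intro ballI)
    fix i show "\<forall>\<^sub>F n in F. yn n i \<in> X i"
      using X(1) by (intro topological_tendstoD[OF assms X(2)]) (auto simp: PiE_iff)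
  qed
  then show "\<forall>\<^sub>F n in F. yn n \<in> U"
    by eventually_elim (use X(4) in \<open>auto simp: subset_iff PiE_iff\<close>, metis UNIV_I)
qed

context bounded_ssm
begin

text \<open>Uniqueness on generators is used twice: boxes determine the law of the data on a fixed
  event \<open>E\<close> of state and parameter, and products of such events with arbitrary data
  sets determine the joint law.\<close>

lemma joint_law_density:
  "distr M (lborel \<Otimes>\<^sub>M (\<Pi>\<^sub>M i\<in>{1..k}. lborel)) (\<lambda>\<omega>. ((X k \<omega>, \<Theta> \<omega>), \<lambda>i\<in>{1..k}. Y i \<omega>))
    = density (lborel \<Otimes>\<^sub>M (\<Pi>\<^sub>M i\<in>{1..k}. lborel)) (\<lambda>(z, y). ennreal (unnormalised k y z))"
  "(\<lambda>(z, y). ennreal (unnormalised k y z)) \<in> borel_measurable (lborel \<Otimes>\<^sub>M (\<Pi>\<^sub>M i\<in>{1..k}. lborel))"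
proof -
  note [simp del] = One_nat_def
  let ?I = "{1..k}"
  let ?P = "\<Pi>\<^sub>M i\<in>?I. (lborel :: (real^'r) measure)"
  let ?Y = "\<lambda>\<omega>. \<lambda>i\<in>?I. Y i \<omega>"
  interpret P: finite_product_sigma_finite "\<lambda>_. lborel :: (real^'r) measure" ?I by standard simp
  interpret Q: pair_sigma_finite "lborel :: ((real^'n) \<times> (real^'p)) measure" ?P ..
  have setsP: "sets ?P = sets (\<Pi>\<^sub>M i\<in>?I. borel)" by (intro sets_PiM_cong) auto
  have "(\<lambda>(z, y). unnormalised k y z) \<in> borel_measurable (lborel \<Otimes>\<^sub>M ?P)"
    using unnormalised_joint_measurable[of k k]
    by (subst measurable_cong_sets[OF sets_pair_measure_cong[OF sets_lborel setsP] refl]) simp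
  then show m [measurable]: "(\<lambda>(z, y). ennreal (unnormalised k y z)) \<in> borel_measurable (lborel \<Otimes>\<^sub>M ?P)"
    by (simp add: split_beta')
  have m' [measurable]: "(\<lambda>(y, z). ennreal (unnormalised k y z)) \<in> borel_measurable (?P \<Otimes>\<^sub>M lborel)"
    using measurable_compose[OF measurable_pair_swap' m] by (simp add: split_beta')
  have Yi: "Y i \<in> borel_measurable M" if "i \<in> ?I" for i using that by (intro Y_measurable) simp
  have Ym [measurable]: "?Y \<in> M \<rightarrow>\<^sub>M ?P"
    by (rule measurable_restrict) (simp add: Yi)
  have Zm [measurable]: "(\<lambda>\<omega>. (X k \<omega>, \<Theta> \<omega>)) \<in> borel_measurable M" by (intro borel_measurable_Pair) measurable
  have rect: "emeasure M {\<omega>\<in>space M. (X k \<omega>, \<Theta> \<omega>) \<in> E \<and> ?Y \<omega> \<in> F}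
      = (\<integral>\<^sup>+y. (\<integral>\<^sup>+z. ennreal (unnormalised k y z) * indicator E z \<partial>lborel) * indicator F y \<partial>?P)"
    if E [measurable]: "E \<in> sets borel" and F [measurable]: "F \<in> sets ?P" for E F
  proof -
    define QE where "QE = {\<omega>\<in>space M. (X k \<omega>, \<Theta> \<omega>) \<in> E}"
    have [measurable]: "QE \<in> sets M" unfolding QE_def by measurable
    define \<rho> where "\<rho> = distr (density M (indicator QE)) ?P ?Y"
    define \<rho>' where "\<rho>' = density ?P (\<lambda>y. \<integral>\<^sup>+z. ennreal (unnormalised k y z) * indicator E z \<partial>lborel)"
    have \<rho>: "emeasure \<rho> F = emeasure M {\<omega>\<in>space M. (X k \<omega>, \<Theta> \<omega>) \<in> E \<and> ?Y \<omega> \<in> F}"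
      if [measurable]: "F \<in> sets ?P" for F
    proof -
      have "emeasure \<rho> F = (\<integral>\<^sup>+\<omega>. indicator QE \<omega> * indicator (?Y -` F \<inter> space M) \<omega> \<partial>M)"
        unfolding \<rho>_def by (subst emeasure_distr) (auto simp: emeasure_density)
      also have "\<dots> = (\<integral>\<^sup>+\<omega>. indicator {\<omega>\<in>space M. (X k \<omega>, \<Theta> \<omega>) \<in> E \<and> ?Y \<omega> \<in> F} \<omega> \<partial>M)"
        by (intro nn_integral_cong) (auto simp: indicator_def QE_def)
      also have "\<dots> = emeasure M {\<omega>\<in>space M. (X k \<omega>, \<Theta> \<omega>) \<in> E \<and> ?Y \<omega> \<in> F}"
        by (rule nn_integral_indicator) measurable
      finally show ?thesis .
    qed
    have \<rho>': "emeasure \<rho>' F = (\<integral>\<^sup>+y. (\<integral>\<^sup>+z. ennreal (unnormalised k y z) * indicator E z \<partial>lborel) * indicator F y \<partial>?P)"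
      if [measurable]: "F \<in> sets ?P" for F
      unfolding \<rho>'_def by (rule emeasure_density) measurable
    have "\<rho> = \<rho>'"
    proof (rule measure_eqI_PiM_finite)
      show "finite ?I" "sets \<rho> = sets ?P" "sets \<rho>' = sets ?P" by (simp_all add: \<rho>_def \<rho>'_def)
      show "range (\<lambda>_::nat. \<Pi>\<^sub>E i\<in>?I. UNIV) \<subseteq> prod_algebra ?I (\<lambda>_. lborel :: (real^'r) measure)"
        by (auto intro!: prod_algebraI_finite)
      show "(\<Union>i::nat. \<Pi>\<^sub>E i\<in>?I. UNIV) = space ?P" by (simp add: space_PiM)
      show "emeasure \<rho> (\<Pi>\<^sub>E i\<in>?I. UNIV) \<noteq> \<infinity>" 
        using \<rho>[OF sets.top] by (simp add: space_PiM emeasure_eq_measure)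
      fix D0 :: "nat \<Rightarrow> (real^'r) set" assume D0: "\<And>i. i \<in> ?I \<Longrightarrow> D0 i \<in> sets lborel"
      \<comment> \<open>\<open>joint_event_final\<close> expects a measurable set at every natural
        number, so the family is padded outside the index set.\<close>
      define D where "D i = (if i \<in> ?I then D0 i else UNIV)" for i
      have D [measurable]: "D i \<in> sets borel" for i using D0 by (simp add: D_def)
      have PE: "Pi\<^sub>E ?I D0 = Pi\<^sub>E ?I D" by (auto simp: D_def intro!: PiE_cong)
      have DP [measurable]: "Pi\<^sub>E ?I D \<in> sets ?P" by (rule sets_PiM_I_finite) auto
      have "emeasure \<rho> (Pi\<^sub>E ?I D) = emeasure M {\<omega>\<in>space M. (X k \<omega>, \<Theta> \<omega>) \<in> E \<and> (\<forall>i\<in>?I. Y i \<omega> \<in> D i)}"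
        unfolding \<rho>[OF DP] by (rule arg_cong[where f="emeasure M"]) (auto simp: PiE_iff)
      also have "\<dots> = (\<integral>\<^sup>+z. obs_event_density A H S G D (\<lambda>z. ennreal (approx m0 C0 \<nu>0 z)) k z * indicator E z \<partial>lborel)"
        by (rule joint_event_final[OF D E])
      also have "\<dots> = (\<integral>\<^sup>+z. \<integral>\<^sup>+y. ennreal (unnormalised k y z) * (\<Prod>i\<in>?I. indicator (D i) (y i)) * indicator E z \<partial>?P \<partial>lborel)"
      proof (rule nn_integral_cong)
        fix z
        have [measurable]: "(\<lambda>y. ennreal (unnormalised k y z)) \<in> borel_measurable ?P"
          using measurable_compose[OF measurable_Pair1'[of z lborel] m] by simp
        show "obs_event_density A H S G D (\<lambda>z. ennreal (approx m0 C0 \<nu>0 z)) k z * indicator E z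
          = (\<integral>\<^sup>+y. ennreal (unnormalised k y z) * (\<Prod>i\<in>?I. indicator (D i) (y i)) * indicator E z \<partial>?P)"
          unfolding nn_integral_unnormalised[OF D, symmetric] by (rule nn_integral_multc[symmetric]) measurable
      qed
      also have "\<dots> = (\<integral>\<^sup>+y. \<integral>\<^sup>+z. ennreal (unnormalised k y z) * (\<Prod>i\<in>?I. indicator (D i) (y i)) * indicator E z \<partial>lborel \<partial>?P)"
        by (rule Q.Fubini'[symmetric]) measurable
      also have "\<dots> = (\<integral>\<^sup>+y. (\<integral>\<^sup>+z. ennreal (unnormalised k y z) * indicator E z \<partial>lborel) * indicator (Pi\<^sub>E ?I D) y \<partial>?P)"
      proof (rule nn_integral_cong)
        fix y assume y: "y \<in> space ?P"
        have ind: "(\<Prod>i\<in>?I. indicator (D i) (y i)) = (indicator (Pi\<^sub>E ?I D) y :: ennreal)"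
        proof (cases "y \<in> Pi\<^sub>E ?I D")
          case False
          then obtain i where i: "i \<in> ?I" "y i \<notin> D i" using y by (auto simp: space_PiM PiE_iff)
          have "(\<Prod>i\<in>?I. indicator (D i) (y i)) = (0 :: ennreal)"
            by (rule prod_zero[OF finite_atLeastAtMost bexI[OF _ i(1)]]) (simp add: i(2))
          then show ?thesis using False by simp
        qed (auto simp: PiE_iff intro!: prod.neutral)
        have my: "(\<lambda>z. ennreal (unnormalised k y z) * indicator E z) \<in> borel_measurable lborel"
          by measurable
        show "(\<integral>\<^sup>+z. ennreal (unnormalised k y z) * (\<Prod>i\<in>?I. indicator (D i) (y i)) * indicator E z \<partial>lborel)
          = (\<integral>\<^sup>+z. ennreal (unnormalised k y z) * indicator E z \<partial>lborel) * indicator (Pi\<^sub>E ?I D) y"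
          unfolding ind nn_integral_multc[OF my, symmetric] by (simp only: mult_ac)
      qed
      also have "\<dots> = emeasure \<rho>' (Pi\<^sub>E ?I D)" by (rule \<rho>'[OF DP, symmetric])
      finally show "emeasure \<rho> (Pi\<^sub>E ?I D0) = emeasure \<rho>' (Pi\<^sub>E ?I D0)" unfolding PE .
    qed
    then show ?thesis using \<rho>[OF F] \<rho>'[OF F] by simp
  qed
  show "distr M (lborel \<Otimes>\<^sub>M ?P) (\<lambda>\<omega>. ((X k \<omega>, \<Theta> \<omega>), ?Y \<omega>)) = density (lborel \<Otimes>\<^sub>M ?P) (\<lambda>(z, y). ennreal (unnormalised k y z))"
  proof (rule measure_eqI_rectangles[where ?M1.0=lborel and ?M2.0="?P"])
    fix E F assume "E \<in> sets (lborel :: ((real^'n) \<times> (real^'p)) measure)" and F [measurable]: "F \<in> sets ?P"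
    then have E [measurable]: "E \<in> sets borel" by simp
    have "emeasure (distr M (lborel \<Otimes>\<^sub>M ?P) (\<lambda>\<omega>. ((X k \<omega>, \<Theta> \<omega>), ?Y \<omega>))) (E \<times> F)
        = emeasure M {\<omega>\<in>space M. (X k \<omega>, \<Theta> \<omega>) \<in> E \<and> ?Y \<omega> \<in> F}"
      by (subst emeasure_distr) (auto intro!: arg_cong[where f="emeasure M"])
    also have "\<dots> = (\<integral>\<^sup>+y. \<integral>\<^sup>+z. ennreal (unnormalised k y z) * indicator (E \<times> F) (z, y) \<partial>lborel \<partial>?P)"
      unfolding rect[OF E F]
    proof (rule nn_integral_cong)
      fix y assume "y \<in> space ?P"
      show "(\<integral>\<^sup>+z. ennreal (unnormalised k y z) * indicator E z \<partial>lborel) * indicator F y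
          = (\<integral>\<^sup>+z. ennreal (unnormalised k y z) * indicator (E \<times> F) (z, y) \<partial>lborel)"
        by (subst nn_integral_multc[symmetric]) (auto simp: indicator_times mult_ac)
    qed
    also have "\<dots> = (\<integral>\<^sup>+p. (case p of (z, y) \<Rightarrow> ennreal (unnormalised k y z)) * indicator (E \<times> F) p \<partial>(lborel \<Otimes>\<^sub>M ?P))"
      by (subst Q.nn_integral_snd[symmetric]) auto
    also have "\<dots> = emeasure (density (lborel \<Otimes>\<^sub>M ?P) (\<lambda>(z, y). ennreal (unnormalised k y z))) (E \<times> F)"
      by (rule emeasure_density[symmetric]) auto
    finally show "emeasure (distr M (lborel \<Otimes>\<^sub>M ?P) (\<lambda>\<omega>. ((X k \<omega>, \<Theta> \<omega>), ?Y \<omega>))) (E \<times> F)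
        = emeasure (density (lborel \<Otimes>\<^sub>M ?P) (\<lambda>(z, y). ennreal (unnormalised k y z))) (E \<times> F)" .
  next
    show "emeasure (distr M (lborel \<Otimes>\<^sub>M ?P) (\<lambda>\<omega>. ((X k \<omega>, \<Theta> \<omega>), ?Y \<omega>))) (space lborel \<times> space ?P) \<noteq> \<infinity>"
      unfolding infinity_ennreal_def
      by (intro finite_measure.emeasure_finite finite_measure_distr) measurable
  qed simp_all
qed

text \<open>Both versions of the density are continuous in the observations, and they agree for almost
  every data record, hence on a dense set of records.\<close>

lemma joint_density_eq_unnormalised:
  assumes f: "joint_density M \<Theta> X Y k f"
  shows "AE z in lborel. \<forall>y. f z (restrict y {1..k}) = unnormalised k y z"
    "\<And>y. (\<lambda>z. f z (restrict y {1..k})) \<in> borel_measurable borel"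
proof -
  note [simp del] = One_nat_def
  let ?I = "{1..k}"
  let ?P = "\<Pi>\<^sub>M i\<in>?I. (lborel :: (real^'r) measure)"
  interpret P: finite_product_sigma_finite "\<lambda>_. lborel :: (real^'r) measure" ?I by standard simp
  interpret Q: pair_sigma_finite "lborel :: ((real^'n) \<times> (real^'p)) measure" ?P ..
  have fnn: "0 \<le> f z y" for z y using f unfolding joint_density_def by blast
  have fc: "continuous_on (PiE ?I (\<lambda>_. UNIV)) (f z)" for z using f unfolding joint_density_def by blast
  have fd: "distributed M (lborel \<Otimes>\<^sub>M ?P) (\<lambda>\<omega>. ((X k \<omega>, \<Theta> \<omega>), \<lambda>i\<in>?I. Y i \<omega>)) (\<lambda>(z, y). ennreal (f z y))"
    using f unfolding joint_density_def by blast
  have fm: "(\<lambda>(z, y). ennreal (f z y)) \<in> borel_measurable (lborel \<Otimes>\<^sub>M ?P)"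
    using fd by (rule distributed_borel_measurable)
  show "(\<lambda>z. f z (restrict y ?I)) \<in> borel_measurable borel" for y
  proof -
    have "restrict y ?I \<in> space ?P" by (simp add: space_PiM)
    \<comment> \<open>Measurability is given for the \<open>ennreal\<close> version of the density
      only; nonnegativity carries it back to \<open>f\<close>.\<close>
    from measurable_compose[OF measurable_Pair2'[OF this] fm]
    have "(\<lambda>z. enn2real (ennreal (f z (restrict y ?I)))) \<in> borel_measurable lborel" by simp
    then show ?thesis by (simp add: fnn)
  qed
  have "density (lborel \<Otimes>\<^sub>M ?P) (\<lambda>(z, y). ennreal (f z y)) = density (lborel \<Otimes>\<^sub>M ?P) (\<lambda>(z, y). ennreal (unnormalised k y z))"
    using fd joint_law_density(1)[of k] by (simp add: distributed_def)
  then have "AE p in lborel \<Otimes>\<^sub>M ?P. (case p of (z, y) \<Rightarrow> ennreal (f z y)) = (case p of (z, y) \<Rightarrow> ennreal (unnormalised k y z))"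
    by (rule Q.density_unique[OF fm joint_law_density(2)])
  then have "AE p in lborel \<Otimes>\<^sub>M ?P. f (fst p) (snd p) = unnormalised k (snd p) (fst p)"
    by eventually_elim (use fnn unnormalised_bounds in \<open>auto simp: split_beta'\<close>)
  from Q.AE_pair[OF this]
  have "AE z in lborel. AE y in ?P. f z y = unnormalised k y z" by simp
  then show "AE z in lborel. \<forall>y. f z (restrict y ?I) = unnormalised k y z"
  proof eventually_elim
    case (elim z)
    show ?case
    proof
      fix y :: "nat \<Rightarrow> real^'r"
      define y0 where "y0 = restrict y ?I"
      have y0: "y0 \<in> PiE ?I (\<lambda>_. UNIV)" by (simp add: y0_def)
      \<comment> \<open>Positive volume keeps each box from lying inside the exceptional null set,
        and the shrinking radii make the chosen records converge coordinatewise; outside the index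
        set extensionality makes them equal to \<open>y0\<close>.\<close>
      define Bx where "Bx n = (\<Pi>\<^sub>E i\<in>?I. ball (y0 i) (inverse (real (Suc n))))" for n
      have "\<exists>w. w \<in> Bx n \<and> f z w = unnormalised k w z" for n
      proof (rule ccontr)
        assume "\<not> ?thesis"
        with elim have "AE w in ?P. w \<notin> Bx n" by (auto elim: eventually_mono)
        moreover have sB: "Bx n \<in> sets ?P" unfolding Bx_def by (rule sets_PiM_I_finite) auto
        ultimately have "emeasure ?P (Bx n) = 0"
          using AE_iff_measurable[OF sB, of "\<lambda>w. w \<notin> Bx n"] sets.sets_into_space[OF sB] by auto
        moreover have "emeasure ?P (Bx n) = (\<Prod>i\<in>?I. emeasure lborel (ball (y0 i) (inverse (real (Suc n)))))"
          unfolding Bx_def by (rule P.emeasure_PiM) auto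
        moreover have "emeasure lborel (ball (y0 i) (inverse (real (Suc n)))) \<noteq> 0" for i
        proof -
          have "0 < measure lborel (ball (y0 i) (inverse (real (Suc n))))"
            by (rule content_ball_pos) simp
          then show ?thesis by (metis measure_eq_emeasure_eq_ennreal ennreal_0 le_less less_irrefl measure_def enn2real_0)
        qed
        ultimately show False by (simp add: prod_zero_iff)
      qed
      then obtain w where w: "\<And>n. w n \<in> Bx n" "\<And>n. f z (w n) = unnormalised k (w n) z" by metis
      have wI: "w n \<in> PiE ?I (\<lambda>_. UNIV)" for n
        using w(1)[of n] unfolding Bx_def by (rule subsetD[OF PiE_mono, rotated]) simp
      have lim: "(\<lambda>n. w n i) \<longlonglongrightarrow> y0 i" for i
      proof (cases "i \<in> ?I")
        case True
        have "dist (w n i) (y0 i) \<le> inverse (real (Suc n))" for n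
          using w(1)[of n] True by (auto simp: Bx_def PiE_iff dist_commute less_imp_le)
        then show ?thesis
          by (subst tendsto_dist_iff) (intro tendsto_sandwich[OF _ _ tendsto_const LIMSEQ_inverse_real_of_nat] always_eventually allI; simp)
      next
        case False
        then have "w n i = y0 i" for n
          using w(1)[of n] by (auto simp: Bx_def PiE_iff extensional_def y0_def)
        then show ?thesis by simp
      qed
      have "(\<lambda>n. f z (w n)) \<longlonglongrightarrow> f z y0"
        by (rule continuous_on_tendsto_compose[OF fc tendsto_fun_componentwise[OF lim] y0])
           (simp only: wI eventually_True)
      moreover have "(\<lambda>n. f z (w n)) \<longlonglongrightarrow> unnormalised k y0 z"
        unfolding w(2) by (rule unnormalised_tendsto[OF lim])
      ultimately have "f z y0 = unnormalised k y0 z" by (rule LIMSEQ_unique)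
      also have "unnormalised k y0 = unnormalised k y" by (rule unnormalised_cong) (simp add: y0_def)
      finally show "f z (restrict y ?I) = unnormalised k y z" unfolding y0_def .
    qed
  qed
qed

section \<open>The exact filter as a sequence of normalised densities\<close>

primrec filter_density :: "nat \<Rightarrow> (nat \<Rightarrow> real^'r) \<Rightarrow> (real^'n) \<times> (real^'p) \<Rightarrow> real" where
  "filter_density 0 y = approx m0 C0 \<nu>0"
| "filter_density (Suc j) y =
    bayes_update (obs_lik H G (y (Suc j))) (predict (trans_density A S) (filter_density j y))"

lemma prob_density_filter: "prob_density (filter_density j y)"
proof (induction j)
  case 0
  then show ?case by (simp add: prior.prob_density_approx)
next
  case (Suc j)
  then show ?case
    by (simp, intro prob_density_bayes_update[OF _ prior.obs_lik_pos prior.obs_lik_le] prior.prob_density_predict) auto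
qed

text \<open>Prediction and multiplication by a likelihood are homogeneous, so normalising at every
  step or never differs by a constant, the product of the evidences met so far.\<close>

lemma unnormalised_eq_filter: "\<exists>N>0. \<forall>z. unnormalised j y z = N * filter_density j y z"
proof (induction j)
  case 0
  then show ?case by (intro exI[of _ 1]) simp
next
  case (Suc j)
  then obtain N where N: "0 < N" "\<And>z. unnormalised j y z = N * filter_density j y z" by blast
  let ?l = "obs_lik H G (y (Suc j))" and ?p = "predict (trans_density A S) (filter_density j y)"
  define I where "I = (\<integral>z. ?l z * ?p z \<partial>lborel)"
  have I: "0 < I"
    unfolding I_def
    by (intro evidence_pos[OF _ prior.obs_lik_pos prior.obs_lik_le] prior.prob_density_predict prob_density_filter) auto
  have "predict (trans_density A S) (unnormalised j y) z = N * ?p z" for z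
  proof -
    have "predict (trans_density A S) (unnormalised j y) z
        = (\<integral>x'. N * (trans_density A S (snd z) x' (fst z) * filter_density j y (x', snd z)) \<partial>lborel)"
      by (simp add: predict_def split_beta' N(2) mult_ac)
    then show ?thesis by (simp add: predict_def split_beta')
  qed
  then have "unnormalised (Suc j) y z = (N * I) * filter_density (Suc j) y z" for z
    using I by (simp add: bayes_update_def flip: I_def)
  moreover have "0 < N * I" using N I by simp
  ultimately show ?case by blast
qed

text \<open>The constant \<open>N\<close> cancels in the quotient defining the posterior. Equality
  can hold only almost everywhere, as \<open>f\<close> is itself determined up to a null set of
  states and parameters.\<close>

lemma posterior_eq_filter:
  assumes f: "joint_density M \<Theta> X Y k f"
  shows "AE z in lborel. posterior f k y z = filter_density k y z"
    "posterior f k y \<in> borel_measurable borel"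
proof -
  note [simp del] = One_nat_def
  obtain N where N: "0 < N" "\<And>z. unnormalised k y z = N * filter_density k y z"
    using unnormalised_eq_filter by blast
  have ae: "AE z in lborel. f z (restrict y {1..k}) = N * filter_density k y z"
    using joint_density_eq_unnormalised(1)[OF f] by eventually_elim (simp add: N)
  have [measurable]: "(\<lambda>z. f z (restrict y {1..k})) \<in> borel_measurable borel"
    by (rule joint_density_eq_unnormalised(2)[OF f])
  have [measurable]: "filter_density k y \<in> borel_measurable borel"
    by (rule prob_densityD(1)[OF prob_density_filter])
  have "(\<integral>z. f z (restrict y {1..k}) \<partial>lborel) = (\<integral>z. N * filter_density k y z \<partial>lborel)"
    using ae by (intro integral_cong_AE) auto
  then have "(\<integral>z. f z (restrict y {1..k}) \<partial>lborel) = N"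
    by (simp add: prob_density_integrable[OF prob_density_filter])
  with N(1) show "AE z in lborel. posterior f k y z = filter_density k y z"
    using ae by (auto elim!: eventually_mono simp: posterior_def)
  show "posterior f k y \<in> borel_measurable borel" unfolding posterior_def by measurable
qed

end

section \<open>Propagation of the one-step errors\<close>

text \<open>Unrolling multiplies each one-step error by all later expansion factors, which is how
  \<open>coeff\<close> grows in its second argument. Errors may be infinite, and multiplication
  distributes over their sum in \<open>ereal\<close> because all terms are nonnegative. The
  hypotheses on \<open>E\<close> stop at \<open>k\<close>, as the evidence lower bounds do.\<close>

lemma error_recursion:
  fixes \<delta> fac err :: "nat \<Rightarrow> real" and coeff :: "nat \<Rightarrow> nat \<Rightarrow> real" and E :: "nat \<Rightarrow> ereal" and a :: real
  assumes \<delta>0: "\<delta> 0 = 0"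
    and step: "\<And>n. \<delta> (Suc n) \<le> fac (Suc n) * \<delta> n + err (Suc n)"
    and err: "\<And>n. n < k \<Longrightarrow> ereal (err (Suc n)) \<le> ereal a * E (Suc n)"
    and diag: "\<And>n. coeff n n = a"
    and coeff_Suc: "\<And>j n. j \<le> n \<Longrightarrow> coeff j (Suc n) = fac (Suc n) * coeff j n"
    and coeff_nn: "\<And>j n. j \<le> n \<Longrightarrow> 0 \<le> coeff j n" and fac: "\<And>n. 0 \<le> fac (Suc n)"
    and E: "\<And>n. n < k \<Longrightarrow> 0 \<le> E (Suc n)"
    and n: "1 \<le> n" "n \<le> k"
  shows "ereal (\<delta> n) \<le> (\<Sum>j=1..<n. ereal (coeff j n) * E j) + ereal a * E n"
  using n
proof (induction n rule: nat_induct_at_least)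
  case base
  have "ereal (\<delta> 1) \<le> ereal (err 1)" using step[of 0] \<delta>0 by simp
  also have "\<dots> \<le> ereal a * E 1" using err[of 0] base by simp
  finally show ?case by simp
next
  case (Suc n)
  have E': "0 \<le> E j" if "j \<in> {1..n}" for j
    using E[of "j - 1"] that Suc.prems by auto
  have nn: "0 \<le> ereal (coeff j n) * E j" if "j \<in> {1..n}" for j
    using E'[OF that] coeff_nn[of j n] that by (intro ereal_0_le_mult) auto
  have "ereal (\<delta> n) \<le> (\<Sum>j=1..<n. ereal (coeff j n) * E j) + ereal (coeff n n) * E n"
    using Suc by (simp add: diag)
  also have "\<dots> = (\<Sum>j\<in>{1..n}. ereal (coeff j n) * E j)"
  proof -
    have "{1..n} = insert n {1..<n}" using Suc.hyps by auto
    then show ?thesis by (simp add: add.commute)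
  qed
  finally have "ereal (fac (Suc n)) * ereal (\<delta> n) \<le> ereal (fac (Suc n)) * (\<Sum>j\<in>{1..n}. ereal (coeff j n) * E j)"
    using fac by (intro ereal_mult_left_mono) auto
  also have "\<dots> = (\<Sum>j\<in>{1..n}. ereal (fac (Suc n)) * (ereal (coeff j n) * E j))"
    using nn by (rule sum_ereal_right_distrib)
  also have "\<dots> = (\<Sum>j=1..<Suc n. ereal (coeff j (Suc n)) * E j)"
    by (intro sum.cong) (auto simp: coeff_Suc mult.assoc[symmetric])
  finally have "ereal (fac (Suc n) * \<delta> n) \<le> (\<Sum>j=1..<Suc n. ereal (coeff j (Suc n)) * E j)" by simp
  then have "ereal (fac (Suc n) * \<delta> n) + ereal (err (Suc n))
      \<le> (\<Sum>j=1..<Suc n. ereal (coeff j (Suc n)) * E j) + ereal a * E (Suc n)"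
    using err[of n] Suc.prems by (intro add_mono) auto
  moreover have "ereal (\<delta> (Suc n)) \<le> ereal (fac (Suc n) * \<delta> n) + ereal (err (Suc n))"
    using step[of n] by simp
  ultimately show ?case by (rule order_trans[rotated])
qed

theorem theorem2:
  fixes M :: "'w measure"
    and A :: "real^'p \<Rightarrow> real^'n^'n"
    and H :: "real^'p \<Rightarrow> real^'n^'r"
    and S :: "real^'p \<Rightarrow> real^'n^'n"
    and G :: "real^'p \<Rightarrow> real^'r^'r"
    and m :: "nat \<Rightarrow> real^'p \<Rightarrow> real^'n"
    and C :: "nat \<Rightarrow> real^'p \<Rightarrow> real^'n^'n"
    and \<nu> :: "nat \<Rightarrow> real^'p \<Rightarrow> real"
    and \<Theta> :: "'w \<Rightarrow> real^'p"
    and X W :: "nat \<Rightarrow> 'w \<Rightarrow> real^'n"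
    and Y V :: "nat \<Rightarrow> 'w \<Rightarrow> real^'r"
    and y :: "nat \<Rightarrow> real^'r"
    and f :: "(real^'n) \<times> (real^'p) \<Rightarrow> (nat \<Rightarrow> real^'r) \<Rightarrow> real"
    and c :: real and \<epsilon> :: "nat \<Rightarrow> real" and k :: nat
  assumes model: "linear_gaussian_ssm M A H S G (m 0) (C 0) (\<nu> 0) \<Theta> X Y W V"
    and nu: "\<And>i. 1 \<le> i \<Longrightarrow> prob_density (\<nu> i)"
    and m_meas: "\<And>i. 1 \<le> i \<Longrightarrow> m i \<in> borel_measurable borel"
    and C_meas: "\<And>i. 1 \<le> i \<Longrightarrow> C i \<in> borel_measurable borel"
    and C_pos: "\<And>i \<theta>. 1 \<le> i \<Longrightarrow> pos_def (C i \<theta>)"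
    and k: "1 \<le> k"
    and joint: "joint_density M \<Theta> X Y k f"
    and c: "(INF \<theta>. det (G \<theta>)) = c" "0 < c"
    and elbo: "\<And>i. \<lbrakk>1 \<le> i; i \<le> k\<rbrakk> \<Longrightarrow> ereal (\<epsilon> i) \<le> ELBO A H S G y m C \<nu> i"
  shows "ereal (tv_dist (posterior f k y) (approx (m k) (C k) (\<nu> k)))
           \<le> (\<Sum>j=1..<k. ereal (coeff_tv A H S G y m C \<nu> c j k)
                          * step_error A H S G y m C \<nu> c \<epsilon> j)
             + ereal (1 / sqrt 2) * step_error A H S G y m C \<nu> c \<epsilon> k
       \<and> ereal (hellinger_dist (posterior f k y) (approx (m k) (C k) (\<nu> k)))
           \<le> (\<Sum>j=1..<k. ereal (coeff_hellinger A H S G y m C \<nu> c j k)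
                          * step_error A H S G y m C \<nu> c \<epsilon> j)
             + ereal (1 / sqrt 2) * step_error A H S G y m C \<nu> c \<epsilon> k"
proof -
  interpret ssm: linear_gaussian_ssm M A H S G "m 0" "C 0" "\<nu> 0" \<Theta> X Y W V by (rule model)
  \<comment> \<open>For real-valued functions an infimum is a lower bound only when one exists;
    positivity of the determinants provides it.\<close>
  have "bdd_below (range (\<lambda>\<theta>. det (G \<theta>)))"
    using pos_def_det_pos[OF ssm.G_pos_def] by (intro bdd_belowI[of _ 0]) (auto simp: less_imp_le)
  then have c_le: "c \<le> det (G \<theta>)" for \<theta>
    unfolding c(1)[symmetric] by (rule cINF_lower) simp
  interpret B: bounded_ssm M A H S G "m 0" "C 0" "\<nu> 0" \<Theta> X Y W V c
    by unfold_locales (rule c c_le)+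
  \<comment> \<open>The sequence starts at the prior, whose regularity belongs to the model; the
    later members obtain theirs from the hypotheses.\<close>
  have ap: "approximation A H S G c (m i) (C i) (\<nu> i)" for i
  proof (cases "i = 0")
    case True
    then show ?thesis using B.prior.approximation_axioms by simp
  next
    case False
    then show ?thesis by unfold_locales (auto intro: nu m_meas C_meas C_pos)
  qed
  define q where "q i = approx (m i) (C i) (\<nu> i)" for i
  define p where "p i = B.filter_density i y" for i
  let ?T = "trans_density A S"
  define upd where "upd i g = bayes_update (obs_lik H G (y i)) (predict ?T g)" for i g
  define E where "E = step_error A H S G y m C \<nu> c \<epsilon>"
  define z where "z i = Z A H S G (y i) (m (i - 1)) (C (i - 1)) (\<nu> (i - 1))" for i
  have z_pos: "0 < z i" for i unfolding z_def by (rule approximation.Z_pos[OF ap])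
  have pp: "prob_density (p i)" for i unfolding p_def by (rule B.prob_density_filter)
  have pq: "prob_density (q i)" for i unfolding q_def by (rule approximation.prob_density_approx[OF ap])
  have pu: "prob_density (upd (Suc i) (q i))" for i
    unfolding upd_def q_def by (rule approximation.prob_density_update_approx[OF ap])
  have p_Suc: "p (Suc i) = upd (Suc i) (p i)" for i by (simp add: p_def upd_def)
  have p0: "p 0 = q 0" by (simp add: p_def q_def)
  \<comment> \<open>The update at time \<open>Suc i\<close> normalises the prediction from the
    approximation at time \<open>i\<close>, hence the shifted indices in \<open>z\<close>.\<close>
  have evid: "(\<integral>w. obs_lik H G (y (Suc i)) w * predict ?T (q i) w \<partial>lborel) = z (Suc i)" for i
    unfolding q_def z_def by (simp add: approximation.evidence_eq_Z[OF ap])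
  note one = approximation.one_step_distance[OF ap ap]
  have step: "ereal (tv_dist (upd (Suc i) (q i)) (q (Suc i))) \<le> ereal (1 / sqrt 2) * E (Suc i)"
    "ereal (hellinger_dist (upd (Suc i) (q i)) (q (Suc i))) \<le> ereal (1 / sqrt 2) * E (Suc i)"
    "0 \<le> E (Suc i)" if "i < k" for i
    unfolding E_def step_error_def upd_def q_def
    using one[of "\<epsilon> (Suc i)" "Suc i" "y (Suc i)" i] elbo[of "Suc i"] that by (simp_all add: ELBO_def)
  have stab: "tv_dist (p (Suc i)) (upd (Suc i) (q i)) \<le> B.prior.lik_bound / z (Suc i) * tv_dist (p i) (q i)"
    "hellinger_dist (p (Suc i)) (upd (Suc i) (q i)) \<le> 2 * sqrt (B.prior.lik_bound / z (Suc i)) * hellinger_dist (p i) (q i)" for i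
  proof -
    note pr = B.prior.prob_density_predict[OF pp[of i]] B.prior.prob_density_predict[OF pq[of i]]
    have "tv_dist (p (Suc i)) (upd (Suc i) (q i)) \<le> B.prior.lik_bound / z (Suc i) * tv_dist (predict ?T (p i)) (predict ?T (q i))"
      unfolding p_Suc upd_def evid[symmetric]
      by (rule tv_dist_bayes_update[OF _ B.prior.obs_lik_pos B.prior.obs_lik_le pr]) measurable
    also have "\<dots> \<le> B.prior.lik_bound / z (Suc i) * tv_dist (p i) (q i)"
      using z_pos[of "Suc i"] B.prior.lik_bound_pos by (intro mult_left_mono B.prior.tv_dist_predict pp pq) auto
    finally show "tv_dist (p (Suc i)) (upd (Suc i) (q i)) \<le> B.prior.lik_bound / z (Suc i) * tv_dist (p i) (q i)" .
    have "hellinger_dist (p (Suc i)) (upd (Suc i) (q i))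
        \<le> 2 * sqrt (B.prior.lik_bound / z (Suc i)) * hellinger_dist (predict ?T (p i)) (predict ?T (q i))"
      unfolding p_Suc upd_def evid[symmetric]
      by (rule hellinger_dist_bayes_update[OF _ B.prior.obs_lik_pos B.prior.obs_lik_le pr]) measurable
    also have "\<dots> \<le> 2 * sqrt (B.prior.lik_bound / z (Suc i)) * hellinger_dist (p i) (q i)"
      using z_pos[of "Suc i"] B.prior.lik_bound_pos by (intro mult_left_mono B.prior.hellinger_dist_predict pp pq) auto
    finally show "hellinger_dist (p (Suc i)) (upd (Suc i) (q i)) \<le> 2 * sqrt (B.prior.lik_bound / z (Suc i)) * hellinger_dist (p i) (q i)" .
  qed
  have prod_Suc: "(\<Prod>i=j+1..Suc n. z i) = (\<Prod>i=j+1..n. z i) * z (Suc n)" if "j \<le> n" for j n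
    using that by (simp add: prod.nat_ivl_Suc')
  have prod_pos: "0 < (\<Prod>i=j+1..n. z i)" for j n by (rule prod_pos) (simp add: z_pos)
  define err_tv where "err_tv i = tv_dist (upd i (q (i - 1))) (q i)" for i
  define err_hell where "err_hell i = hellinger_dist (upd i (q (i - 1))) (q i)" for i
  have tv: "ereal (tv_dist (p k) (q k)) \<le> (\<Sum>j=1..<k. ereal (coeff_tv A H S G y m C \<nu> c j k) * E j) + ereal (1 / sqrt 2) * E k"
  proof (rule error_recursion[where fac="\<lambda>i. B.prior.lik_bound / z i" and k=k])
    show "tv_dist (p 0) (q 0) = 0" by (simp add: p0 tv_dist_def)
    fix n
    show "0 \<le> B.prior.lik_bound / z (Suc n)" using z_pos[of "Suc n"] B.prior.lik_bound_pos by simp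
    \<comment> \<open>Zero exponents and an empty product: the separate last term of the bound is
      the diagonal case of the coefficient.\<close>
    show "coeff_tv A H S G y m C \<nu> c n n = 1 / sqrt 2" using c(2) by (simp add: coeff_tv_def)
    show "tv_dist (p (Suc n)) (q (Suc n)) \<le> B.prior.lik_bound / z (Suc n) * tv_dist (p n) (q n) + err_tv (Suc n)"
      using stab(1)[of n] tv_dist_triangle[OF pp[of "Suc n", THEN prob_density_integrable(1)]
          pu[of n, THEN prob_density_integrable(1)] pq[of "Suc n", THEN prob_density_integrable(1)]]
      by (simp add: err_tv_def)
    show "ereal (err_tv (Suc n)) \<le> ereal (1 / sqrt 2) * E (Suc n)" if "n < k"
      using step(1)[OF that] by (simp add: err_tv_def)
    fix j assume j: "j \<le> n"
    show "0 \<le> coeff_tv A H S G y m C \<nu> c j n"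
      using prod_pos[of j n] by (simp add: coeff_tv_def z_def less_imp_le)
    have d: "real (Suc n - j) = real (n - j) + 1" using j by (simp add: Suc_diff_le)
    have e: "(2 * pi) powr (- (real CARD('r) * (real (n - j) + 1)) / 2) = (2 * pi) powr (- (real CARD('r) * real (n - j)) / 2) * (2 * pi) powr (- real CARD('r) / 2)"
      "c powr (- (real (n - j) + 1) / 2) = c powr (- real (n - j) / 2) * c powr (- 1 / 2)"
      by (simp_all add: powr_add[symmetric] field_simps)
    show "coeff_tv A H S G y m C \<nu> c j (Suc n) = B.prior.lik_bound / z (Suc n) * coeff_tv A H S G y m C \<nu> c j n"
      unfolding coeff_tv_def d e B.prior.lik_bound_def z_def[symmetric] prod_Suc[OF j] by (simp add: mult_ac)
  qed (use step(3) k in auto)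
  have hell: "ereal (hellinger_dist (p k) (q k)) \<le> (\<Sum>j=1..<k. ereal (coeff_hellinger A H S G y m C \<nu> c j k) * E j) + ereal (1 / sqrt 2) * E k"
  proof (rule error_recursion[where fac="\<lambda>i. 2 * sqrt (B.prior.lik_bound / z i)" and k=k])
    show "hellinger_dist (p 0) (q 0) = 0" by (simp add: p0 hellinger_dist_def)
    fix n
    show "0 \<le> 2 * sqrt (B.prior.lik_bound / z (Suc n))" using z_pos[of "Suc n"] B.prior.lik_bound_pos by simp
    show "coeff_hellinger A H S G y m C \<nu> c n n = 1 / sqrt 2" using c(2) by (simp add: coeff_hellinger_def)
    show "hellinger_dist (p (Suc n)) (q (Suc n))
        \<le> 2 * sqrt (B.prior.lik_bound / z (Suc n)) * hellinger_dist (p n) (q n) + err_hell (Suc n)"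
      using stab(2)[of n] hellinger_dist_triangle[OF pp[of "Suc n"] pu[of n] pq[of "Suc n"]] by (simp add: err_hell_def)
    show "ereal (err_hell (Suc n)) \<le> ereal (1 / sqrt 2) * E (Suc n)" if "n < k"
      using step(2)[OF that] by (simp add: err_hell_def)
    fix j assume j: "j \<le> n"
    show "0 \<le> coeff_hellinger A H S G y m C \<nu> c j n"
      using prod_pos[of j n] by (simp add: coeff_hellinger_def z_def less_imp_le)
    have d: "real (Suc n - j) = real (n - j) + 1" "(2::real) ^ (Suc n - j) = 2 ^ (n - j) * 2"
      using j by (simp_all add: Suc_diff_le)
    have e: "(2 * pi) powr (- (real CARD('r) * (real (n - j) + 1)) / 4) = (2 * pi) powr (- (real CARD('r) * real (n - j)) / 4) * (2 * pi) powr (- real CARD('r) / 4)"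
      "c powr (- (real (n - j) + 1) / 4) = c powr (- real (n - j) / 4) * c powr (- 1 / 4)"
      by (simp_all add: powr_add[symmetric] field_simps)
    \<comment> \<open>The expansion factor of the Hellinger distance contains the root of the
      likelihood bound, which is where the quarter powers originate.\<close>
    have l: "sqrt B.prior.lik_bound = (2 * pi) powr (- real CARD('r) / 4) * c powr (- 1 / 4)"
      using c(2) by (simp add: B.prior.lik_bound_def real_sqrt_mult powr_powr flip: powr_half_sqrt)
    show "coeff_hellinger A H S G y m C \<nu> c j (Suc n) = 2 * sqrt (B.prior.lik_bound / z (Suc n)) * coeff_hellinger A H S G y m C \<nu> c j n"
      unfolding coeff_hellinger_def d e real_sqrt_divide l z_def[symmetric] prod_Suc[OF j]
      by (simp add: real_sqrt_mult mult_ac)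
  qed (use step(3) k in auto)
  note post = B.posterior_eq_filter[OF joint, of y]
  \<comment> \<open>The distances are integrals and do not see the null set on which the posterior
    and the filter density may differ.\<close>
  have eq: "tv_dist (posterior f k y) (q k) = tv_dist (p k) (q k)"
    "hellinger_dist (posterior f k y) (q k) = hellinger_dist (p k) (q k)"
    using post pp[of k] pq[of k]
    by (auto intro!: tv_dist_cong_AE hellinger_dist_cong_AE dest: prob_densityD(1) simp: p_def)
  show ?thesis
    using tv hell unfolding eq[symmetric] by (simp add: q_def E_def)
qed

end
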